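(* Suppose that $f(x,u)=|u|^{p-2}u$ with $p\in(2,2^* )$. For each $a,b>0$ there exists $\tilde\lambda:=\tilde\lambda(a,b,p)>0$ such that for all $\lambda>\tilde\lambda$, problem $(\mathcal P_\lambda)$ has a non-zero solution $v_\lambda$ with positive energy, i.e. $\Phi_\lambda(v_\lambda)>0$.
   Context: $N>4$ is an integer, $2^*=\frac{2N}{N-2}$, $\Omega\subseteq\mathbb R^N$ is a bounded domain. $H_0^1(\Omega)$ has norm $\|u\|=(\int_\Omega|\nabla u|^2dx)^{1/2}$ and $\|u\|_q$ is the $L^q(\Omega)$ norm. Problem $(\mathcal P_\lambda)$: $-\left(a+b\int_\Omega|\nabla u|^2dx\right)\Delta u=|u|^{2^*-2}u+\lambda|u|^{p-2}u$ in $\Omega$, $u=0$ on $\partial\Omega$. Solutions are weak solutions, i.e. critical points in $H_0^1(\Omega)$ of the energy functional $\Phi_\lambda(u)=\frac a2\|u\|^2+\frac b4\|u\|^4-\frac1{2^*}\|u\|_{2^*}^{2^*}-\frac\lambda p\|u\|_p^p$. *)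

theory Defs
  imports "HOL-Analysis.Analysis"
begin

definition partial_deriv :: "'n \<Rightarrow> (real^'n \<Rightarrow> real) \<Rightarrow> (real^'n \<Rightarrow> real)" where
  "partial_deriv i f x = frechet_derivative f (at x) (axis i 1)"

text \<open>\<open>C_k k f\<close>: \<open>f\<close> is \<open>k\<close> times continuously differentiable on the whole space.\<close>

primrec C_k :: "nat \<Rightarrow> (real^'n \<Rightarrow> real) \<Rightarrow> bool" where
  "C_k 0 f \<longleftrightarrow> continuous_on UNIV f"
| "C_k (Suc k) f \<longleftrightarrow> f differentiable_on UNIV \<and> (\<forall>i. C_k k (partial_deriv i f))"

definition test_functions :: "(real^'n) set \<Rightarrow> (real^'n \<Rightarrow> real) set" where
  "test_functions \<Omega> =
     {\<phi>. (\<forall>k. C_k k \<phi>) \<and> compact (closure {x. \<phi> x \<noteq> 0}) \<and> closure {x. \<phi> x \<noteq> 0} \<subseteq> \<Omega>}"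

text \<open>Elements of Lebesgue and Sobolev spaces are represented by functions on all of space,
  of which only the values on \<open>\<Omega>\<close>, up to null sets, matter.\<close>

definition Lspace :: "(real^'n) set \<Rightarrow> real \<Rightarrow> (real^'n \<Rightarrow> 'b::real_normed_vector) set" where
  "Lspace \<Omega> q = {u. u \<in> borel_measurable (lebesgue_on \<Omega>) \<and>
                    integrable (lebesgue_on \<Omega>) (\<lambda>x. norm (u x) powr q)}"

definition Lnorm :: "(real^'n) set \<Rightarrow> real \<Rightarrow> (real^'n \<Rightarrow> 'b::real_normed_vector) \<Rightarrow> real" where
  "Lnorm \<Omega> q u = (\<integral>x. norm (u x) powr q \<partial>lebesgue_on \<Omega>) powr (1 / q)"

definition has_weak_gradient ::
    "(real^'n) set \<Rightarrow> (real^'n \<Rightarrow> real) \<Rightarrow> (real^'n \<Rightarrow> real^'n) \<Rightarrow> bool" where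
  "has_weak_gradient \<Omega> u g \<longleftrightarrow>
     (\<forall>\<phi>\<in>test_functions \<Omega>. \<forall>i.
        (\<integral>x. u x * partial_deriv i \<phi> x \<partial>lebesgue_on \<Omega>) = - (\<integral>x. g x $ i * \<phi> x \<partial>lebesgue_on \<Omega>))"

definition H1 :: "(real^'n) set \<Rightarrow> (real^'n \<Rightarrow> real) set" where
  "H1 \<Omega> = {u \<in> Lspace \<Omega> 2. \<exists>g \<in> Lspace \<Omega> 2. has_weak_gradient \<Omega> u g}"

text \<open>For \<open>u \<in> H1 \<Omega>\<close> with \<open>\<Omega>\<close> open, the weak gradient is unique up to null sets,
  so the choice does not affect any integral below.\<close>

definition weak_gradient :: "(real^'n) set \<Rightarrow> (real^'n \<Rightarrow> real) \<Rightarrow> (real^'n \<Rightarrow> real^'n)" where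
  "weak_gradient \<Omega> u = (SOME g. g \<in> Lspace \<Omega> 2 \<and> has_weak_gradient \<Omega> u g)"

definition H1_norm :: "(real^'n) set \<Rightarrow> (real^'n \<Rightarrow> real) \<Rightarrow> real" where
  "H1_norm \<Omega> u = sqrt ((Lnorm \<Omega> 2 u)\<^sup>2 + (Lnorm \<Omega> 2 (weak_gradient \<Omega> u))\<^sup>2)"

text \<open>\<open>H01 \<Omega>\<close> is the closure of the test functions in \<open>H1 \<Omega>\<close>.\<close>

definition H01 :: "(real^'n) set \<Rightarrow> (real^'n \<Rightarrow> real) set" where
  "H01 \<Omega> = {u \<in> H1 \<Omega>. \<exists>\<phi> :: nat \<Rightarrow> real^'n \<Rightarrow> real.
     (\<forall>k. \<phi> k \<in> test_functions \<Omega>) \<and> (\<lambda>k. H1_norm \<Omega> (\<lambda>x. \<phi> k x - u x)) \<longlonglongrightarrow> 0}"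

definition H01_norm :: "(real^'n) set \<Rightarrow> (real^'n \<Rightarrow> real) \<Rightarrow> real" where
  "H01_norm \<Omega> u = Lnorm \<Omega> 2 (weak_gradient \<Omega> u)"

text \<open>Frechet differentiability on the normed space \<open>H01 \<Omega>\<close>; \<open>has_derivative\<close> does not apply
  because \<open>H01 \<Omega>\<close> is a set of functions and not a type.\<close>

definition H01_has_derivative ::
    "(real^'n) set \<Rightarrow> ((real^'n \<Rightarrow> real) \<Rightarrow> real) \<Rightarrow> ((real^'n \<Rightarrow> real) \<Rightarrow> real) \<Rightarrow>
     (real^'n \<Rightarrow> real) \<Rightarrow> bool" where
  "H01_has_derivative \<Omega> F T u \<longleftrightarrow>
     (\<forall>h\<in>H01 \<Omega>. \<forall>k\<in>H01 \<Omega>. T (\<lambda>x. h x + k x) = T h + T k) \<and>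
     (\<forall>h\<in>H01 \<Omega>. \<forall>c. T (\<lambda>x. c * h x) = c * T h) \<and>
     (\<exists>C. \<forall>h\<in>H01 \<Omega>. \<bar>T h\<bar> \<le> C * H01_norm \<Omega> h) \<and>
     (\<forall>\<epsilon>>0. \<exists>\<delta>>0. \<forall>h\<in>H01 \<Omega>. H01_norm \<Omega> h < \<delta> \<longrightarrow>
        \<bar>F (\<lambda>x. u x + h x) - F u - T h\<bar> \<le> \<epsilon> * H01_norm \<Omega> h)"

definition critical_point ::
    "(real^'n) set \<Rightarrow> ((real^'n \<Rightarrow> real) \<Rightarrow> real) \<Rightarrow> (real^'n \<Rightarrow> real) \<Rightarrow> bool" where
  "critical_point \<Omega> F u \<longleftrightarrow> u \<in> H01 \<Omega> \<and> H01_has_derivative \<Omega> F (\<lambda>h. 0) u"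

definition critical_exponent :: "nat \<Rightarrow> real" where
  "critical_exponent N = 2 * real N / (real N - 2)"

definition energy ::
    "(real^'n) set \<Rightarrow> real \<Rightarrow> real \<Rightarrow> real \<Rightarrow> real \<Rightarrow> (real^'n \<Rightarrow> real) \<Rightarrow> real" where
  "energy \<Omega> a b p lam u =
     (let s = critical_exponent CARD('n) in
        a / 2 * (H01_norm \<Omega> u) ^ 2 + b / 4 * (H01_norm \<Omega> u) ^ 4
        - 1 / s * (Lnorm \<Omega> s u) powr s - lam / p * (Lnorm \<Omega> p u) powr p)"

text \<open>Weak solutions of the Kirchhoff problem
  \<open>- (a + b \<integral>|\<nabla>u|\<^sup>2) \<Delta>u = |u| powr (s - 2) u + lam |u| powr (p - 2) u\<close> in \<open>\<Omega>\<close>, \<open>u = 0\<close> on the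
  boundary, where \<open>s = 2N/(N - 2)\<close>, are by definition the critical points of its energy functional.\<close>

definition kirchhoff_solution ::
    "(real^'n) set \<Rightarrow> real \<Rightarrow> real \<Rightarrow> real \<Rightarrow> real \<Rightarrow> (real^'n \<Rightarrow> real) \<Rightarrow> bool" where
  "kirchhoff_solution \<Omega> a b p lam u \<longleftrightarrow> critical_point \<Omega> (energy \<Omega> a b p lam) u"

end

theory Submission
  imports Defs "HOL-Library.Function_Algebras" "HOL-Library.Diagonal_Subsequence"
    "HOL-Complex_Analysis.Great_Picard"
begin

text \<open>
  The solution is a minimiser of the energy on the part of the Nehari set lying in a small ball of
  \<open>H01 \<Omega>\<close>. On such a ball the Kirchhoff part minus the critical power is uniformly convex, so
  that loss of compactness by bubbling is excluded, and every ray meets the Nehari set at most once,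
  in the maximum of the energy along the ray. For large \<open>lam\<close> the Nehari set meets an arbitrarily
  small ball, so a minimising sequence stays well inside the original one. The subcritical term
  is compact; hence the energy of midpoints of a minimising sequence, projected back to the Nehari set,
  together with uniform convexity shows that the sequence is Cauchy in \<open>H01 \<Omega>\<close>. The limit is a
  critical point because, by the change of sign along rays, those through \<open>v + k h\<close> meet the Nehari set
  near \<open>v\<close> for small \<open>k\<close>, and its energy is positive because on the Nehari set in the ball the energy dominates the squared norm.
\<close>

section \<open>Powers of real numbers\<close>

text \<open>At the critical exponent \<open>s\<close> the embedding is not compact, so strong
  convergence of a minimising sequence has to come from convexity. By the parallelogram law the
  quadratic part of the energy gains a multiple of the squared half-distance of two points; the
  second difference of the critical power is of order r^(s-2) times the same square and takes away
  only part of the gain when \<open>r\<close> is small. A second reason for a small ball: in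
  dimension above 4 one has 2 < p < s < 4, so the quartic Kirchhoff term outgrows both powers and a
  long ray can meet the full Nehari set more than once. None of the conditions on \<open>r\<close>
  involves \<open>lam\<close>, which can therefore be taken large afterwards. The minimising
  sequence must keep a distance from the boundary of the ball, because a midpoint may have to be
  stretched by a factor up to \<open>\<tau>\<close> to return to the Nehari set; a low energy level
  provides this distance. Sobolev's inequality and Rellich's theorem are proved for test functions
  and carried over to \<open>H01 \<Omega>\<close> by approximation.\<close>

lemma mvt_segment:
  fixes f :: "real \<Rightarrow> real"
  assumes "\<And>x. (f has_real_derivative f' x) (at x)"
  obtains \<theta> where "0 < \<theta>" "\<theta> < 1" "f (x + y) - f x = f' (x + \<theta> * y) * y"
proof -
  have "((\<lambda>t. f (x + t * y)) has_real_derivative f' (x + t * y) * y) (at t)" for t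
    by (rule DERIV_chain2[OF assms]) (auto intro!: derivative_eq_intros)
  from MVT2[of 0 1, OF _ this] that show ?thesis by auto
qed

lemma abs_powr_DERIV:
  assumes q: "q > 1"
  shows "((\<lambda>x. \<bar>x\<bar> powr q) has_real_derivative q * (sgn x * \<bar>x\<bar> powr (q - 1))) (at x)"
proof -
  consider "x > 0" | "x < 0" | "x = 0" by linarith
  then show ?thesis
  proof cases
    case 1
    have "((\<lambda>x. x powr q) has_real_derivative q * (sgn x * \<bar>x\<bar> powr (q - 1))) (at x)"
      using 1 by (auto intro!: derivative_eq_intros simp: powr_diff field_simps)
    then show ?thesis
      by (rule has_field_derivative_transform_within_open[of _ _ _ "{0<..}"]) (use 1 in auto)
  next
    case 2
    have "((\<lambda>x. (-x) powr q) has_real_derivative q * (sgn x * \<bar>x\<bar> powr (q - 1))) (at x)"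
      using 2 by (auto intro!: derivative_eq_intros simp: powr_diff field_simps)
    then show ?thesis
      by (rule has_field_derivative_transform_within_open[of _ _ _ "{..<0}"]) (use 2 in auto)
  next
    case 3
    have "((\<lambda>h::real. \<bar>h\<bar> powr (q - 1)) \<longlongrightarrow> \<bar>0\<bar> powr (q - 1)) (at 0)"
      using q by (intro tendsto_powr' tendsto_intros) auto
    then have lim: "((\<lambda>h::real. \<bar>h\<bar> powr (q - 1)) \<longlongrightarrow> 0) (at 0)" using q by simp
    have "((\<lambda>h::real. \<bar>h\<bar> powr q / h) \<longlongrightarrow> 0) (at 0)"
    proof (rule Lim_null_comparison[OF _ lim])
      show "\<forall>\<^sub>F h in at 0. norm (\<bar>h\<bar> powr q / h) \<le> \<bar>h\<bar> powr (q - 1)"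
        unfolding eventually_at_filter by (auto simp: powr_diff)
    qed
    then show ?thesis using 3 q by (simp add: has_field_derivative_iff)
  qed
qed

lemma sgn_powr_DERIV:
  assumes q: "q > 1"
  shows "((\<lambda>x. sgn x * \<bar>x\<bar> powr q) has_real_derivative q * \<bar>x\<bar> powr (q - 1)) (at x)"
proof -
  consider "x > 0" | "x < 0" | "x = 0" by linarith
  then show ?thesis
  proof cases
    case 1
    have "((\<lambda>x. x powr q) has_real_derivative q * \<bar>x\<bar> powr (q - 1)) (at x)"
      using 1 by (auto intro!: derivative_eq_intros simp: powr_diff field_simps)
    then show ?thesis
      by (rule has_field_derivative_transform_within_open[of _ _ _ "{0<..}"]) (use 1 in auto)
  next
    case 2
    have "((\<lambda>x. - ((-x) powr q)) has_real_derivative q * \<bar>x\<bar> powr (q - 1)) (at x)"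
      using 2 by (auto intro!: derivative_eq_intros simp: powr_diff field_simps)
    then show ?thesis
      by (rule has_field_derivative_transform_within_open[of _ _ _ "{..<0}"]) (use 2 in auto)
  next
    case 3
    have "((\<lambda>h::real. \<bar>h\<bar> powr (q - 1)) \<longlongrightarrow> \<bar>0\<bar> powr (q - 1)) (at 0)"
      using q by (intro tendsto_powr' tendsto_intros) auto
    then have lim: "((\<lambda>h::real. \<bar>h\<bar> powr (q - 1)) \<longlongrightarrow> 0) (at 0)" using q by simp
    have "((\<lambda>h::real. sgn h * \<bar>h\<bar> powr q / h) \<longlongrightarrow> 0) (at 0)"
    proof (rule Lim_null_comparison[OF _ lim])
      show "\<forall>\<^sub>F h in at 0. norm (sgn h * \<bar>h\<bar> powr q / h) \<le> \<bar>h\<bar> powr (q - 1)"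
        unfolding eventually_at_filter by (auto simp: powr_diff abs_mult abs_sgn_eq)
    qed
    then show ?thesis using 3 q by (simp add: has_field_derivative_iff)
  qed
qed

lemma powr_add_le:
  fixes x y e :: real
  assumes "0 \<le> x" "0 \<le> y" "0 \<le> e"
  shows "(x + y) powr e \<le> 2 powr e * (x powr e + y powr e)"
proof -
  have "(x + y) powr e \<le> (2 * max x y) powr e" using assms by (intro powr_mono2) auto
  also have "\<dots> = 2 powr e * (max x y) powr e" using assms by (simp add: powr_mult)
  also have "(max x y) powr e \<le> x powr e + y powr e" by (simp add: max_def)
  finally show ?thesis by simp
qed

text \<open>The factor \<open>q * (q - 1)\<close> comes from the second derivative of the power, and
  \<open>2 powr (q - 2)\<close> from \<open>powr_add_le\<close>, which separates the two summands of
  the intermediate point.\<close>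

definition taylor_const :: "real \<Rightarrow> real" where
  "taylor_const q = q * (q - 1) * 2 powr (q - 2)"

lemma taylor_const_pos: "q > 2 \<Longrightarrow> taylor_const q > 0"
  by (simp add: taylor_const_def)

text \<open>The mean value theorem is applied twice, to the power and then to its derivative.
  Splitting the power at the intermediate point leaves a mixed term, which Hoelder's inequality can
  bound after integration, and a pure power of \<open>y\<close>.\<close>

lemma abs_powr_taylor:
  fixes x y q :: real
  assumes q: "q > 2"
  shows "\<bar>\<bar>x + y\<bar> powr q - \<bar>x\<bar> powr q - q * (sgn x * \<bar>x\<bar> powr (q - 1)) * y\<bar>
    \<le> taylor_const q * (\<bar>x\<bar> powr (q - 2) * y\<^sup>2 + \<bar>y\<bar> powr q)"
proof -
  define g where "g = (\<lambda>x::real. sgn x * \<bar>x\<bar> powr (q - 1))"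
  obtain \<theta> where \<theta>: "0 < \<theta>" "\<theta> < 1" and 1: "\<bar>x + y\<bar> powr q - \<bar>x\<bar> powr q = q * g (x + \<theta> * y) * y"
    using mvt_segment[OF abs_powr_DERIV[of q]] q unfolding g_def by auto
  have "(g has_real_derivative (q - 1) * \<bar>z\<bar> powr (q - 2)) (at z)" for z
    using sgn_powr_DERIV[of "q - 1" z] q by (simp add: g_def)
  from mvt_segment[OF this, of x "\<theta> * y"]
  obtain \<eta> where \<eta>: "0 < \<eta>" "\<eta> < 1"
    and 2: "g (x + \<theta> * y) - g x = (q - 1) * \<bar>x + \<eta> * (\<theta> * y)\<bar> powr (q - 2) * (\<theta> * y)" by metis
  have "\<eta> * \<theta> \<le> 1" using \<theta> \<eta> by (simp add: mult_le_one)
  then have "\<bar>\<eta> * (\<theta> * y)\<bar> \<le> \<bar>y\<bar>" using \<theta> \<eta>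
    by (simp add: abs_mult mult.assoc[symmetric] mult_left_le_one_le)
  then have "\<bar>x + \<eta> * (\<theta> * y)\<bar> \<le> \<bar>x\<bar> + \<bar>y\<bar>" by linarith
  then have 3: "\<bar>x + \<eta> * (\<theta> * y)\<bar> powr (q - 2) \<le> 2 powr (q - 2) * (\<bar>x\<bar> powr (q - 2) + \<bar>y\<bar> powr (q - 2))"
    using powr_mono2[of "q - 2" "\<bar>x + \<eta> * (\<theta> * y)\<bar>" "\<bar>x\<bar> + \<bar>y\<bar>"] powr_add_le[of "\<bar>x\<bar>" "\<bar>y\<bar>" "q - 2"] q
    by linarith
  have "\<bar>x + y\<bar> powr q - \<bar>x\<bar> powr q - q * g x * y = q * (g (x + \<theta> * y) - g x) * y"
    using 1 by (simp add: algebra_simps)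
  also have "\<dots> = q * (q - 1) * \<bar>x + \<eta> * (\<theta> * y)\<bar> powr (q - 2) * (\<theta> * y\<^sup>2)"
    unfolding 2 by (simp add: power2_eq_square)
  finally have "\<bar>\<bar>x + y\<bar> powr q - \<bar>x\<bar> powr q - q * g x * y\<bar> =
      q * (q - 1) * \<bar>x + \<eta> * (\<theta> * y)\<bar> powr (q - 2) * (\<theta> * y\<^sup>2)"
    using q \<theta> by (simp add: abs_mult)
  also have "\<dots> \<le> q * (q - 1) * (2 powr (q - 2) * (\<bar>x\<bar> powr (q - 2) + \<bar>y\<bar> powr (q - 2))) * (1 * y\<^sup>2)"
    using q \<theta> 3 by (intro mult_mono) auto
  also have "\<dots> = taylor_const q * (\<bar>x\<bar> powr (q - 2) * y\<^sup>2 + \<bar>y\<bar> powr (q - 2) * y\<^sup>2)"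
    by (simp add: taylor_const_def algebra_simps)
  also have "\<bar>y\<bar> powr (q - 2) * y\<^sup>2 = \<bar>y\<bar> powr q"
    by (cases "y = 0") (auto simp: powr_diff)
  finally show ?thesis by (simp add: g_def)
qed

text \<open>Replacing the smaller of \<open>x\<close> and \<open>y\<close> by the larger one gives a
  cruder form of Young's inequality, with both weights equal to 1.\<close>

lemma powr_young:
  fixes x y :: real
  assumes "0 \<le> x" "0 \<le> y" "0 < i" "0 < j"
  shows "x powr i * y powr j \<le> x powr (i + j) + y powr (i + j)"
proof (cases "x \<le> y")
  case True
  then have "x powr i * y powr j \<le> y powr i * y powr j" using assms by (intro mult_mono powr_mono2) auto
  then show ?thesis by (simp add: powr_add) (smt (verit) powr_ge_zero mult_nonneg_nonneg)
next
  case False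
  then have "x powr i * y powr j \<le> x powr i * x powr j" using assms by (intro mult_mono powr_mono2) auto
  then show ?thesis by (simp add: powr_add) (smt (verit) powr_ge_zero mult_nonneg_nonneg)
qed

text \<open>Below a threshold the linear term dominates, above it the \<open>s\<close>-th power
  does. Together with a bound in the critical space this upgrades L1 convergence to convergence with
  exponent \<open>p\<close>.\<close>

lemma powr_interpolate:
  fixes p s \<eta> :: real
  assumes "1 \<le> p" "p < s" "\<eta> > 0"
  shows "\<exists>C>0. \<forall>x\<ge>0. x powr p \<le> \<eta> * x powr s + C * x"
proof -
  \<comment> \<open>The threshold is the solution of
    \<open>\<eta> * M powr (s - p) = 1\<close>.\<close>
  define M where "M = \<eta> powr (- 1 / (s - p))"
  have M: "M > 0" using assms by (simp add: M_def)
  have "x powr p \<le> \<eta> * x powr s + M powr (p - 1) * x" if x: "x \<ge> 0" for x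
  proof (cases "x \<le> M")
    case True
    have "x powr p = x powr (p - 1) * x" using x by (cases "x = 0") (auto simp: powr_diff)
    also have "\<dots> \<le> M powr (p - 1) * x" using x True assms by (intro mult_right_mono powr_mono2) auto
    finally show ?thesis using assms by (smt (verit) mult_nonneg_nonneg powr_ge_zero)
  next
    case False
    have "M powr (s - p) = \<eta> powr (- 1)" unfolding M_def powr_powr using assms by simp
    then have "1 / \<eta> = M powr (s - p)" using assms by (simp add: powr_minus_divide)
    also have "\<dots> \<le> x powr (s - p)" using False assms M by (intro powr_mono2) auto
    finally have "1 \<le> \<eta> * x powr (s - p)" using assms by (simp add: field_simps)
    then have "x powr p \<le> \<eta> * x powr (s - p) * x powr p" using mult_right_mono[of 1 _ "x powr p"] by fastforce
    also have "\<dots> = \<eta> * x powr s" using False M by (simp add: powr_diff)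
    finally show ?thesis using x M by (smt (verit) mult_nonneg_nonneg powr_ge_zero)
  qed
  then show ?thesis using M by (intro exI[of _ "M powr (p - 1)"]) auto
qed

section \<open>The energy along a ray\<close>

locale fibering =
  fixes a b p s A B D :: real
  assumes ab: "a > 0" "b > 0" and ps: "2 < p" "p < s" and AB: "A > 0" "B \<ge> 0"
begin

text \<open>For a vector u, \<open>A\<close> is its squared norm, \<open>B\<close> its critical
  power and \<open>D\<close> its subcritical power times \<open>lam\<close> (see
  \<open>g_ray\<close> and \<open>E_ray\<close>). Then \<open>E t\<close> is the energy of t u, and
  \<open>G t\<close> is \<open>t\<close> times the derivative of \<open>E\<close>.\<close>

definition G :: "real \<Rightarrow> real" where
  "G t = a * A * t\<^sup>2 + b * A\<^sup>2 * t ^ 4 - B * t powr s - D * t powr p"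

definition E :: "real \<Rightarrow> real" where
  "E t = a / 2 * A * t\<^sup>2 + b / 4 * A\<^sup>2 * t ^ 4 - B * t powr s / s - D * t powr p / p"

lemma G_div_powr:
  assumes "t > 0"
  shows "G t / t powr p = a * A * t powr (2 - p) + b * A\<^sup>2 * t powr (4 - p) - B * t powr (s - p) - D"
proof -
  have e: "t powr c / t powr p = t powr (c - p)" for c by (simp add: powr_diff)
  have "t\<^sup>2 = t powr 2" "t ^ 4 = t powr 4" using assms by simp_all
  then have "G t = a * A * t powr 2 + b * A\<^sup>2 * t powr 4 - B * t powr s - D * t powr p"
    by (simp only: G_def)
  then have "G t / t powr p = a * A * (t powr 2 / t powr p) + b * A\<^sup>2 * (t powr 4 / t powr p)
      - B * (t powr s / t powr p) - D * (t powr p / t powr p)"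
    by (simp only: add_divide_distrib diff_divide_distrib times_divide_eq_right)
  then show ?thesis using assms unfolding e by simp
qed

text \<open>Division by \<open>t powr p\<close> turns the subcritical term into a constant, and the
  critical term contributes a nonincreasing part. Only the quartic term, now with exponent
  \<open>4 - p\<close>, can grow; the smallness of \<open>t2\<close> lets the quadratic term
  outweigh it.\<close>

lemma G_div_powr_decreasing:
  assumes t: "0 < t1" "t1 < t2" "8 * b * A * t2\<^sup>2 \<le> a * (p - 2)"
  shows "G t2 / t2 powr p < G t1 / t1 powr p"
proof -
  have "a * A * t2 powr (2 - p) + b * A\<^sup>2 * t2 powr (4 - p) < a * A * t1 powr (2 - p) + b * A\<^sup>2 * t1 powr (4 - p)"
  proof (rule DERIV_neg_imp_decreasing[OF t(2)])
    fix t assume tt: "t1 \<le> t" "t \<le> t2"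
    then have t0: "t > 0" using t by simp
    let ?d = "a * A * ((2 - p) * t powr (1 - p)) + b * A\<^sup>2 * ((4 - p) * t powr (3 - p))"
    have "((\<lambda>t. a * A * t powr (2 - p) + b * A\<^sup>2 * t powr (4 - p)) has_real_derivative ?d) (at t)"
      using DERIV_add[OF DERIV_cmult[OF has_real_derivative_powr[OF t0]] DERIV_cmult[OF has_real_derivative_powr[OF t0]],
          of "a * A" "2 - p" "b * A\<^sup>2" "4 - p"] by (simp add: diff_diff_eq add.commute)
    moreover have "?d < 0"
    proof -
      have "t powr (3 - p) = t\<^sup>2 * t powr (1 - p)" using t0
        by (simp add: powr_diff field_simps power2_eq_square power3_eq_cube)
      then have d: "?d = A * t powr (1 - p) * (a * (2 - p) + (4 - p) * (b * A * t\<^sup>2))"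
        by (simp add: algebra_simps power2_eq_square)
      have bt: "0 < b * A * t\<^sup>2" using ab AB t0 by simp
      have "b * A * t\<^sup>2 \<le> b * A * t2\<^sup>2" using ab AB tt t0 by (intro mult_left_mono power_mono) auto
      with t(3) have "8 * (b * A * t\<^sup>2) \<le> a * (p - 2)" by simp
      \<comment> \<open>Since \<open>p > 2\<close>, the factor \<open>4 - p\<close> is below 2
        whatever its sign; the quartic contribution is then at most a quarter of
        \<open>a * (p - 2)\<close>.\<close>
      moreover have "(4 - p) * (b * A * t\<^sup>2) \<le> 2 * (b * A * t\<^sup>2)" using ps bt by (intro mult_right_mono) auto
      ultimately have "a * (2 - p) + (4 - p) * (b * A * t\<^sup>2) < 0" using bt by (simp add: algebra_simps)
      then show ?thesis unfolding d using AB t0 by (simp add: mult_pos_neg)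
    qed
    ultimately show "\<exists>y. ((\<lambda>t. a * A * t powr (2 - p) + b * A\<^sup>2 * t powr (4 - p)) has_real_derivative y) (at t) \<and> y < 0"
      by blast
  qed
  moreover have "B * t1 powr (s - p) \<le> B * t2 powr (s - p)"
    using t ps AB by (intro mult_left_mono powr_mono2) auto
  ultimately show ?thesis using t by (simp add: G_div_powr)
qed

lemma G_neg_after:
  assumes "0 < t1" "t1 < t2" "8 * b * A * t2\<^sup>2 \<le> a * (p - 2)" "G t1 \<le> 0"
  shows "G t2 < 0"
proof -
  have "G t1 / t1 powr p \<le> 0" using assms by (simp add: divide_nonpos_pos)
  then have "G t2 / t2 powr p < 0" using G_div_powr_decreasing[OF assms(1-3)] by linarith
  then show ?thesis using assms by (simp add: divide_less_0_iff)
qed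

lemma G_pos_before:
  assumes "0 < t1" "t1 < t2" "8 * b * A * t2\<^sup>2 \<le> a * (p - 2)" "0 \<le> G t2"
  shows "0 < G t1"
  using G_neg_after[OF assms(1-3)] assms(4) by force

lemma E_DERIV:
  assumes "t > 0"
  shows "(E has_real_derivative G t / t) (at t)"
proof -
  have "(E has_real_derivative a * A * t + b * A\<^sup>2 * t ^ 3 - B * t powr (s - 1) - D * t powr (p - 1)) (at t)"
    unfolding E_def[abs_def] using assms ps
    by (auto intro!: derivative_eq_intros simp: powr_diff field_simps power2_eq_square)
  also have "a * A * t + b * A\<^sup>2 * t ^ 3 - B * t powr (s - 1) - D * t powr (p - 1) = G t / t"
    using assms by (simp add: G_def powr_diff field_simps power2_eq_square power3_eq_cube power4_eq_xxxx)
  finally show ?thesis .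
qed

text \<open>The derivative \<open>G t / t\<close> changes sign from plus to minus at
  \<open>t0\<close>, as long as the arguments stay in the range where \<open>G t / t powr p\<close>
  decreases.\<close>

lemma E_le_max:
  assumes t: "0 < t" "0 < t0" "8 * b * A * t\<^sup>2 \<le> a * (p - 2)" "8 * b * A * t0\<^sup>2 \<le> a * (p - 2)" and G: "G t0 = 0"
  shows "E t \<le> E t0"
proof (rule linorder_cases[of t t0])
  assume less: "t < t0"
  show ?thesis
  proof (rule DERIV_nonneg_imp_nondecreasing[of t t0])
    fix x assume x: "t \<le> x" "x \<le> t0"
    then have "0 \<le> G x" using G_pos_before[of x t0] t G by (cases "x = t0") auto
    then show "\<exists>y. (E has_real_derivative y) (at x) \<and> 0 \<le> y" using E_DERIV[of x] x t by force
  qed (use less in auto)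
next
  assume less: "t0 < t"
  show ?thesis
  proof (rule DERIV_nonpos_imp_nonincreasing[of t0 t])
    fix x assume x: "t0 \<le> x" "x \<le> t"
    have "x\<^sup>2 \<le> t\<^sup>2" using x t by (intro power_mono) auto
    then have "8 * b * A * x\<^sup>2 \<le> 8 * b * A * t\<^sup>2" using ab AB by (intro mult_left_mono) auto
    then have "G x \<le> 0" using G_neg_after[of t0 x] x t G by (cases "x = t0") auto
    then show "\<exists>y. (E has_real_derivative y) (at x) \<and> y \<le> 0"
      using E_DERIV[of x] x t by (force simp: divide_le_0_iff)
  qed (use less in auto)
qed auto

end

section \<open>Test functions\<close>

lemma C_k_Suc_D:
  "C_k (Suc k) f \<Longrightarrow> f differentiable_on UNIV" "C_k (Suc k) f \<Longrightarrow> C_k k (partial_deriv i f)"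
  by auto

lemma C_k_Suc_imp: "C_k (Suc k) f \<Longrightarrow> C_k k f"
proof (induction k arbitrary: f)
  case 0
  then show ?case using differentiable_imp_continuous_on by auto
next
  case (Suc k)
  then show ?case by (metis C_k.simps(2))
qed

lemma partial_deriv_eq:
  assumes "(f has_derivative f') (at x)"
  shows "partial_deriv i f x = f' (axis i 1)"
  using frechet_derivative_at[OF assms] by (simp add: partial_deriv_def)

lemma has_derivative_frechet:
  assumes "f differentiable_on UNIV"
  shows "(f has_derivative frechet_derivative f (at x)) (at x)"
  using assms by (simp add: differentiable_on_def frechet_derivative_works)

lemma partial_deriv_const [simp]: "partial_deriv i (\<lambda>_. c) = (\<lambda>_. 0)"
  by (rule ext) (simp add: partial_deriv_eq[OF has_derivative_const])

lemma C_k_const [simp]: "C_k k (\<lambda>_. c)"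
  by (induction k arbitrary: c) auto

lemma C_k_add: "C_k k f \<Longrightarrow> C_k k g \<Longrightarrow> C_k k (\<lambda>x. f x + g x)"
proof (induction k arbitrary: f g)
  case 0
  then show ?case by (auto intro: continuous_on_add)
next
  case (Suc k)
  note d = C_k_Suc_D(1)[OF Suc.prems(1)] C_k_Suc_D(1)[OF Suc.prems(2)]
  have "partial_deriv i (\<lambda>x. f x + g x) = (\<lambda>x. partial_deriv i f x + partial_deriv i g x)" for i
    by (rule ext) (simp add: partial_deriv_eq[OF has_derivative_add[OF d[THEN has_derivative_frechet]]] partial_deriv_def)
  then show ?case using Suc d by (auto intro: differentiable_on_add)
qed

lemma C_k_mult: "C_k k f \<Longrightarrow> C_k k g \<Longrightarrow> C_k k (\<lambda>x. f x * g x)"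
proof (induction k arbitrary: f g)
  case 0
  then show ?case by (auto intro: continuous_on_mult)
next
  case (Suc k)
  note d = C_k_Suc_D(1)[OF Suc.prems(1)] C_k_Suc_D(1)[OF Suc.prems(2)]
  have "partial_deriv i (\<lambda>x. f x * g x) = (\<lambda>x. f x * partial_deriv i g x + partial_deriv i f x * g x)" for i
    by (rule ext) (simp add: partial_deriv_eq[OF has_derivative_mult[OF d[THEN has_derivative_frechet]]] partial_deriv_def)
  moreover have "C_k k (\<lambda>x. f x * partial_deriv i g x + partial_deriv i f x * g x)" for i
    by (intro C_k_add Suc.IH C_k_Suc_imp[OF Suc.prems(1)] C_k_Suc_imp[OF Suc.prems(2)]
        C_k_Suc_D(2)[OF Suc.prems(1)] C_k_Suc_D(2)[OF Suc.prems(2)])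
  ultimately show ?case using d by (auto intro!: differentiable_on_mult)
qed

lemma C_k_prod: "finite I \<Longrightarrow> (\<And>i. i \<in> I \<Longrightarrow> C_k k (f i)) \<Longrightarrow> C_k k (\<lambda>x. \<Prod>i\<in>I. f i x)"
  by (induction I rule: finite_induct) (auto intro!: C_k_mult)

text \<open>A whole sequence of successive derivatives is assumed because each induction step on
  \<open>k\<close> replaces \<open>f j\<close> by \<open>f (Suc j)\<close>.\<close>

lemma C_k_real_comp:
  assumes "\<And>j t. (f j has_real_derivative f (Suc j) t) (at t)"
  shows "C_k k (\<lambda>x::real^'n. f j (c * x $ i + d))"
proof (induction k arbitrary: j)
  case 0
  have "continuous_on UNIV (f j)" using assms DERIV_isCont continuous_at_imp_continuous_on by blast
  then have "continuous_on UNIV (\<lambda>x::real^'n. f j (c * x $ i + d))"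
    by (rule continuous_on_compose2) (auto intro!: continuous_intros)
  then show ?case by simp
next
  case (Suc k)
  have der: "((\<lambda>x::real^'n. f j (c * x $ i + d)) has_derivative (\<lambda>h. f (Suc j) (c * x $ i + d) * (c * h $ i))) (at x)" for x
  proof -
    have "(f j has_derivative (*) (f (Suc j) (c * x $ i + d))) (at (c * x $ i + d))"
      using assms by (simp add: has_field_derivative_def)
    moreover have "((\<lambda>x. c * x $ i + d) has_derivative (\<lambda>h. c * h $ i)) (at x)"
      by (auto intro!: derivative_eq_intros bounded_linear_imp_has_derivative bounded_linear_vec_nth)
    ultimately show ?thesis by (rule has_derivative_compose[rotated])
  qed
  have pd: "partial_deriv l (\<lambda>x::real^'n. f j (c * x $ i + d)) =
      (\<lambda>x. f (Suc j) (c * x $ i + d) * (c * axis l 1 $ i))" for l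
    by (rule ext) (rule partial_deriv_eq[OF der])
  have "C_k k (partial_deriv l (\<lambda>x::real^'n. f j (c * x $ i + d)))" for l
    unfolding pd by (intro C_k_mult Suc C_k_const)
  then show ?case using der unfolding C_k.simps differentiable_on_def differentiable_def by auto
qed

section \<open>Smooth bump functions\<close>

definition flat :: "real poly \<Rightarrow> real \<Rightarrow> real" where
  "flat P t = (if t > 0 then poly P (1 / t) * exp (- (1 / t)) else 0)"

text \<open>With y = 1/t, the derivative of P(y) exp(-y) in t is y^2 (P - P')(y) exp(-y). The
  polynomial in \<open>flat\<close> is there to make the family closed under differentiation;
  \<open>flat 1\<close> is the classical function exp(-1/t).\<close>

lemma flat_DERIV: "(flat P has_real_derivative flat ([:0, 0, 1:] * (P - pderiv P)) t) (at t)"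
proof -
  consider "t > 0" | "t < 0" | "t = 0" by linarith
  then show ?thesis
  proof cases
    case 1
    have "((\<lambda>t. poly P (1 / t) * exp (- (1 / t))) has_real_derivative flat ([:0, 0, 1:] * (P - pderiv P)) t) (at t)"
      using 1 by (auto intro!: derivative_eq_intros DERIV_chain2[OF poly_DERIV]
          simp: flat_def field_simps power2_eq_square)
    then show ?thesis
      by (rule has_field_derivative_transform_within_open[of _ _ _ "{0<..}"]) (use 1 in \<open>auto simp: flat_def\<close>)
  next
    case 2
    have "((\<lambda>_. 0) has_real_derivative flat ([:0, 0, 1:] * (P - pderiv P)) t) (at t)"
      using 2 by (auto simp: flat_def)
    then show ?thesis
      by (rule has_field_derivative_transform_within_open[of _ _ _ "{..<0}"]) (use 2 in \<open>auto simp: flat_def\<close>)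
  next
    case 3
    have pe: "((\<lambda>y. poly Q y / exp y) \<longlongrightarrow> 0) at_top" for Q :: "real poly"
    proof -
      have "((\<lambda>y. \<Sum>i\<le>degree Q. coeff Q i * (y ^ i / exp y)) \<longlongrightarrow> (\<Sum>i\<le>degree Q. coeff Q i * 0)) at_top"
        by (intro tendsto_intros tendsto_power_div_exp_0)
      then show ?thesis by (simp add: poly_altdef sum_divide_distrib)
    qed
    \<comment> \<open>With y = 1/h the quotient is y P(y) / exp y, and y tends to infinity.\<close>
    have "((\<lambda>h. flat P h / h) \<longlongrightarrow> 0) (at_right 0)"
    proof (rule Lim_transform_eventually)
      show "((\<lambda>h::real. poly ([:0, 1:] * P) (inverse h) / exp (inverse h)) \<longlongrightarrow> 0) (at_right 0)"
        by (rule filterlim_compose[OF pe filterlim_inverse_at_top_right])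
      show "\<forall>\<^sub>F h in at_right 0. poly ([:0, 1:] * P) (inverse h) / exp (inverse h) = flat P h / h"
        using eventually_at_right_less[of 0]
        by eventually_elim (simp add: flat_def exp_minus field_simps)
    qed
    moreover have "((\<lambda>h. flat P h / h) \<longlongrightarrow> 0) (at_left 0)"
    proof (rule Lim_transform_eventually[OF tendsto_const])
      show "\<forall>\<^sub>F h in at_left 0. 0 = flat P h / h"
        unfolding eventually_at_filter by (auto simp: flat_def)
    qed
    ultimately have "((\<lambda>h. flat P h / h) \<longlongrightarrow> 0) (at 0)" by (rule filterlim_split_at[rotated])
    then show ?thesis using 3 by (simp add: has_field_derivative_iff flat_def)
  qed
qed

lemma C_k_flat: "C_k k (\<lambda>x::real^'n. flat P (c * x $ i + d))"
proof -
  define f where "f j = flat (((\<lambda>P. [:0, 0, 1:] * (P - pderiv P)) ^^ j) P)" for j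
  have "(f j has_real_derivative f (Suc j) t) (at t)" for j t
    unfolding f_def by (simp only: funpow.simps comp_apply flat_DERIV)
  then have "C_k k (\<lambda>x::real^'n. f 0 (c * x $ i + d))" by (rule C_k_real_comp)
  then show ?thesis by (simp add: f_def)
qed

text \<open>As \<open>flat 1 (k t) = exp (- 1 / (k t))\<close> for \<open>t > 0\<close>, these functions tend to the indicator of the
  box when \<open>k\<close> grows.\<close>

definition bump :: "nat \<Rightarrow> real^'n \<Rightarrow> real^'n \<Rightarrow> real^'n \<Rightarrow> real" where
  "bump k a b x = (\<Prod>i\<in>UNIV. flat 1 (real k * (x $ i - a $ i)) * flat 1 (real k * (b $ i - x $ i)))"

lemma C_k_bump: "C_k j (bump k (a :: real^'n) b)"
proof -
  have "C_k j (\<lambda>x::real^'n. flat 1 (real k * x $ i + (- real k * a $ i)))" "C_k j (\<lambda>x::real^'n. flat 1 (- real k * x $ i + real k * b $ i))" for i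
    by (rule C_k_flat)+
  then show ?thesis unfolding bump_def
    by (intro C_k_prod C_k_mult) (simp_all add: algebra_simps)
qed

lemma flat_1_bounds: "0 \<le> flat 1 t" "flat 1 t \<le> 1" "0 < t \<Longrightarrow> 0 < flat 1 t" "t \<le> 0 \<Longrightarrow> flat 1 t = 0"
  by (simp_all add: flat_def)

lemma bump_bounds: "0 \<le> bump k a b x" "bump k a b x \<le> 1"
  unfolding bump_def by (auto intro!: prod_nonneg prod_le_1 mult_le_one simp: flat_1_bounds)

lemma bump_eq_0: "x \<notin> box a b \<Longrightarrow> bump k a b x = 0"
  unfolding bump_def by (auto simp: mem_box_cart not_less intro!: flat_1_bounds(4) mult_nonneg_nonpos)

lemma bump_pos: "0 < k \<Longrightarrow> x \<in> box a b \<Longrightarrow> 0 < bump k a b x"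
  unfolding bump_def by (auto simp: mem_box_cart intro!: prod_pos mult_pos_pos flat_1_bounds(3))

lemma bump_tendsto: "(\<lambda>k. bump (Suc k) a b x) \<longlonglongrightarrow> indicator (box a b) x"
proof (cases "x \<in> box a b")
  case True
  have lim: "(\<lambda>k. flat 1 (real (Suc k) * c)) \<longlonglongrightarrow> 1" if "c > 0" for c
  proof -
    have "(\<lambda>k. exp (- (1 / real (Suc k) / c))) \<longlonglongrightarrow> exp (- (0 / c))"
      by (intro tendsto_intros LIMSEQ_Suc[OF lim_1_over_n]) (use that in auto)
    then show ?thesis using that by (simp add: flat_def zero_less_mult_iff)
  qed
  have "(\<lambda>k. bump (Suc k) a b x) \<longlonglongrightarrow> (\<Prod>i\<in>(UNIV::'a set). 1 * 1)"
    unfolding bump_def using True by (intro tendsto_intros lim) (auto simp: mem_box_cart)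
  then show ?thesis using True by simp
qed (simp add: bump_eq_0)

lemma test_functions_D:
  assumes "\<phi> \<in> test_functions \<Omega>"
  shows "C_k k \<phi>" "\<phi> differentiable_on UNIV" "continuous_on UNIV \<phi>" "\<phi> \<in> borel_measurable borel"
    "compact (closure {x. \<phi> x \<noteq> 0})" "x \<notin> \<Omega> \<Longrightarrow> \<phi> x = 0"
proof -
  have C: "C_k k \<phi>" for k using assms by (auto simp: test_functions_def)
  show "C_k k \<phi>" "\<phi> differentiable_on UNIV" "continuous_on UNIV \<phi>" using C[of k] C[of "Suc 0"] C[of 0] by auto
  then show "\<phi> \<in> borel_measurable borel" by (intro borel_measurable_continuous_onI)
  show "compact (closure {x. \<phi> x \<noteq> 0})" using assms by (auto simp: test_functions_def)
  show "\<phi> x = 0" if "x \<notin> \<Omega>" using assms that closure_subset[of "{x. \<phi> x \<noteq> 0}"] by (auto simp: test_functions_def)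
qed

lemma test_functions_support:
  assumes "\<And>k. C_k k \<phi>" "{x. \<phi> x \<noteq> 0} \<subseteq> K" "compact K" "K \<subseteq> \<Omega>"
  shows "\<phi> \<in> test_functions \<Omega>"
proof -
  have "closure {x. \<phi> x \<noteq> 0} \<subseteq> K" using assms compact_imp_closed closure_minimal by blast
  then show ?thesis using assms
    by (auto simp: test_functions_def compact_eq_bounded_closed intro: bounded_subset)
qed

lemma bump_test_function:
  assumes "cbox a b \<subseteq> \<Omega>"
  shows "bump k a b \<in> test_functions \<Omega>"
proof (rule test_functions_support[of _ "cbox a b"])
  show "{x. bump k a b x \<noteq> 0} \<subseteq> cbox a b" using bump_eq_0 box_subset_cbox by blast
qed (use assms C_k_bump in auto)

lemma test_functions_add:
  assumes "\<phi> \<in> test_functions \<Omega>" "\<psi> \<in> test_functions \<Omega>"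
  shows "(\<lambda>x. \<phi> x + \<psi> x) \<in> test_functions \<Omega>"
proof (rule test_functions_support)
  show "{x. \<phi> x + \<psi> x \<noteq> 0} \<subseteq> closure {x. \<phi> x \<noteq> 0} \<union> closure {x. \<psi> x \<noteq> 0}"
    by (rule order_trans[OF _ Un_mono[OF closure_subset closure_subset]]) auto
qed (use assms in \<open>auto simp: test_functions_def intro: C_k_add\<close>)

lemma test_functions_mult:
  assumes "\<phi> \<in> test_functions \<Omega>" "\<psi> \<in> test_functions \<Omega>"
  shows "(\<lambda>x. \<phi> x * \<psi> x) \<in> test_functions \<Omega>"
proof (rule test_functions_support)
  show "{x. \<phi> x * \<psi> x \<noteq> 0} \<subseteq> closure {x. \<phi> x \<noteq> 0}"
    by (rule order_trans[OF _ closure_subset]) auto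
qed (use assms in \<open>auto simp: test_functions_def intro: C_k_mult\<close>)

lemma test_functions_cmult:
  assumes "\<phi> \<in> test_functions \<Omega>"
  shows "(\<lambda>x. c * \<phi> x) \<in> test_functions \<Omega>"
proof (rule test_functions_support)
  show "{x. c * \<phi> x \<noteq> 0} \<subseteq> closure {x. \<phi> x \<noteq> 0}"
    by (rule order_trans[OF _ closure_subset]) auto
qed (use assms in \<open>auto simp: test_functions_def intro: C_k_mult\<close>)

lemma partial_deriv_eq_0:
  assumes "x \<notin> closure {x. \<phi> x \<noteq> 0}"
  shows "partial_deriv i \<phi> x = 0"
proof -
  have "((\<lambda>_. 0) has_derivative (\<lambda>_. 0)) (at x)" by simp
  then have "(\<phi> has_derivative (\<lambda>_. 0)) (at x)"
  proof (rule has_derivative_transform_within_open)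
    show "0 = \<phi> y" if "y \<in> - closure {x. \<phi> x \<noteq> 0}" for y
      using that closure_subset[of "{x. \<phi> x \<noteq> 0}"] by auto
  qed (use assms in auto)
  then show ?thesis by (simp add: partial_deriv_eq)
qed

lemma test_functions_partial_deriv:
  assumes "\<phi> \<in> test_functions \<Omega>"
  shows "partial_deriv i \<phi> \<in> test_functions \<Omega>"
proof (rule test_functions_support)
  show "C_k k (partial_deriv i \<phi>)" for k using test_functions_D(1)[OF assms, of "Suc k"] by simp
  show "{x. partial_deriv i \<phi> x \<noteq> 0} \<subseteq> closure {x. \<phi> x \<noteq> 0}"
    using partial_deriv_eq_0[where \<phi> = \<phi>] by blast
qed (use assms in \<open>auto simp: test_functions_def\<close>)

definition grad :: "(real^'n \<Rightarrow> real) \<Rightarrow> real^'n \<Rightarrow> real^'n" where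
  "grad \<phi> x = (\<chi> i. partial_deriv i \<phi> x)"

lemma test_functions_has_derivative:
  fixes \<phi> :: "real^'n \<Rightarrow> real"
  assumes "\<phi> \<in> test_functions \<Omega>"
  shows "(\<phi> has_derivative (\<lambda>h. grad \<phi> x \<bullet> h)) (at x)"
proof -
  let ?f = "frechet_derivative \<phi> (at x)"
  have d: "(\<phi> has_derivative ?f) (at x)" by (rule has_derivative_frechet[OF test_functions_D(2)[OF assms]])
  then have lin: "linear ?f" by (rule has_derivative_linear)
  have "?f h = grad \<phi> x \<bullet> h" for h
  proof -
    have "?f h = ?f (\<Sum>i\<in>UNIV. h $ i *\<^sub>R axis i 1)" using basis_expansion[of h] by (simp add: scalar_mult_eq_scaleR)
    also have "\<dots> = (\<Sum>i\<in>UNIV. h $ i * partial_deriv i \<phi> x)"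
      by (simp add: linear_sum[OF lin] linear_scale[OF lin] partial_deriv_def)
    finally show ?thesis by (simp add: inner_vec_def grad_def mult.commute)
  qed
  then have "?f = (\<lambda>h. grad \<phi> x \<bullet> h)" by blast
  then show ?thesis using d by simp
qed

lemma test_functions_line_DERIV:
  fixes \<phi> :: "real^'n \<Rightarrow> real"
  assumes "\<phi> \<in> test_functions \<Omega>"
  shows "((\<lambda>t. \<phi> (x + t *\<^sub>R b)) has_real_derivative grad \<phi> (x + t *\<^sub>R b) \<bullet> b) (at t)"
proof -
  have "((\<lambda>t. \<phi> (x + t *\<^sub>R b)) has_derivative (\<lambda>s. grad \<phi> (x + t *\<^sub>R b) \<bullet> (s *\<^sub>R b))) (at t)"
    by (rule has_derivative_compose[OF _ test_functions_has_derivative[OF assms]]) (auto intro!: derivative_eq_intros)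
  then show ?thesis by (simp add: has_field_derivative_def mult_commute_abs)
qed

lemma test_functions_bounded:
  assumes "\<phi> \<in> test_functions \<Omega>"
  shows "\<exists>B>0. \<forall>x. \<bar>\<phi> x\<bar> \<le> B"
proof -
  let ?S = "closure {x. \<phi> x \<noteq> 0}"
  have "compact (\<phi> ` ?S)"
    using test_functions_D(3,5)[OF assms] by (intro compact_continuous_image) (auto intro: continuous_on_subset)
  then obtain B where B: "B > 0" "\<And>y. y \<in> \<phi> ` ?S \<Longrightarrow> norm y \<le> B"
    using bounded_pos compact_imp_bounded by metis
  have "\<bar>\<phi> x\<bar> \<le> B" for x
    using B closure_subset[of "{x. \<phi> x \<noteq> 0}"] by (cases "\<phi> x = 0") (auto simp: image_iff)
  then show ?thesis using B by blast
qed

lemma compact_support_integrable: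
  fixes f :: "'a::euclidean_space \<Rightarrow> 'b::{banach, second_countable_topology}"
  assumes "continuous_on UNIV f" "bounded {x. f x \<noteq> 0}"
  shows "integrable lborel f"
proof -
  obtain R where R: "{x. f x \<noteq> 0} \<subseteq> cball 0 R"
    using assms(2) unfolding bounded_iff subset_iff mem_cball_0 by blast
  have "integrable lborel (\<lambda>x. indicator (cball 0 R) x *\<^sub>R f x)"
    using assms by (intro borel_integrable_compact) (auto intro: continuous_on_subset)
  also have "(\<lambda>x. indicator (cball 0 R) x *\<^sub>R f x) = f" using R by (intro ext) (auto simp: indicator_def subset_iff)
  finally show ?thesis .
qed

lemma test_functions_bounded_support: "\<phi> \<in> test_functions \<Omega> \<Longrightarrow> bounded {x. \<phi> x \<noteq> 0}"
  using test_functions_D(5) compact_imp_bounded bounded_subset closure_subset by metis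

lemma test_functions_integrable: "\<phi> \<in> test_functions \<Omega> \<Longrightarrow> integrable lborel \<phi>"
  using compact_support_integrable test_functions_D(3) test_functions_bounded_support by blast

section \<open>Translation invariance and integration by parts\<close>

lemma lborel_integral_translate:
  fixes f :: "'a::euclidean_space \<Rightarrow> 'b::{banach, second_countable_topology}"
  assumes [measurable]: "f \<in> borel_measurable borel"
  shows "integral\<^sup>L lborel (\<lambda>x. f (x + c)) = integral\<^sup>L lborel f"
proof -
  have "integral\<^sup>L lborel f = integral\<^sup>L (distr lborel borel ((+) c)) f" by (simp add: lborel_distr_plus)
  also have "\<dots> = integral\<^sup>L lborel (\<lambda>x. f (c + x))" by (subst integral_distr) auto
  finally show ?thesis by (simp add: add.commute)
qed

lemma lborel_integrable_translate:
  fixes f :: "'a::euclidean_space \<Rightarrow> 'b::{banach, second_countable_topology}"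
  assumes "integrable lborel f"
  shows "integrable lborel (\<lambda>x. f (x + c))"
proof -
  have "integrable (distr lborel borel ((+) c)) f" using assms by (simp add: lborel_distr_plus)
  then have "integrable lborel (\<lambda>x. f (c + x))" by (rule integrable_distr[rotated]) simp
  then show ?thesis by (simp add: add.commute)
qed

text \<open>The integral of a difference quotient vanishes by translation invariance.\<close>

lemma integral_partial_deriv:
  fixes \<phi> :: "real^'n \<Rightarrow> real"
  assumes \<phi>: "\<phi> \<in> test_functions \<Omega>"
  shows "integral\<^sup>L lborel (partial_deriv i \<phi>) = 0"
proof -
  let ?e = "axis i 1 :: real^'n"
  note [measurable] = test_functions_D(4)[OF \<phi>] test_functions_D(4)[OF test_functions_partial_deriv[OF \<phi>]]
  obtain B where B: "B > 0" "\<And>x. \<bar>partial_deriv i \<phi> x\<bar> \<le> B"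
    using test_functions_bounded[OF test_functions_partial_deriv[OF \<phi>]] by blast
  obtain R where R: "\<And>x. \<phi> x \<noteq> 0 \<Longrightarrow> norm x \<le> R"
    using test_functions_bounded_support[OF \<phi>] by (auto simp: bounded_iff)
  define h where "h k = 1 / real (Suc k)" for k
  have h: "0 < h k" "h k \<le> 1" for k by (simp_all add: h_def)
  define q where "q k x = (\<phi> (x + h k *\<^sub>R ?e) - \<phi> x) / h k" for k x
  have line: "((\<lambda>t. \<phi> (x + t *\<^sub>R ?e)) has_real_derivative partial_deriv i \<phi> (x + t *\<^sub>R ?e)) (at t)" for x t
    using test_functions_line_DERIV[OF \<phi>, of x ?e t] by (simp add: inner_axis grad_def)
  have "(\<lambda>k. integral\<^sup>L lborel (q k)) \<longlonglongrightarrow> integral\<^sup>L lborel (partial_deriv i \<phi>)"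
  proof (rule integral_dominated_convergence)
    \<comment> \<open>All steps \<open>h k\<close> are at most 1, so the difference quotients vanish
      outside the ball of radius \<open>R + 1\<close>; inside, the mean value theorem bounds them by
      \<open>B\<close>.\<close>
    show "integrable lborel (\<lambda>x. indicator (cball 0 (R + 1)) x *\<^sub>R B)"
      by (intro borel_integrable_compact) auto
    show "AE x in lborel. (\<lambda>k. q k x) \<longlonglongrightarrow> partial_deriv i \<phi> x"
    proof (rule AE_I2)
      fix x
      have "((\<lambda>t. (\<phi> (x + t *\<^sub>R ?e) - \<phi> x) / t) \<longlongrightarrow> partial_deriv i \<phi> x) (at 0)"
        using line[of x 0] by (simp add: has_field_derivative_iff)
      moreover have "filterlim h (at 0) sequentially"
        unfolding filterlim_at using h LIMSEQ_Suc[OF lim_1_over_n] by (auto simp: h_def[abs_def] intro!: always_eventually)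
      ultimately show "(\<lambda>k. q k x) \<longlonglongrightarrow> partial_deriv i \<phi> x"
        unfolding q_def by (rule filterlim_compose)
    qed
    show "AE x in lborel. norm (q k x) \<le> indicator (cball 0 (R + 1)) x *\<^sub>R B" for k
    proof (rule AE_I2)
      fix x
      show "norm (q k x) \<le> indicator (cball 0 (R + 1)) x *\<^sub>R B"
      proof (cases "norm x \<le> R + 1")
        case True
        obtain \<theta> where "\<phi> (x + (0 + h k) *\<^sub>R ?e) - \<phi> (x + 0 *\<^sub>R ?e) = partial_deriv i \<phi> (x + (0 + \<theta> * h k) *\<^sub>R ?e) * h k"
          by (rule mvt_segment[OF line[of x], of 0 "h k"])
        then have "q k x = partial_deriv i \<phi> (x + (\<theta> * h k) *\<^sub>R ?e)" using h[of k] by (simp add: q_def)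
        then show ?thesis using B True by (simp add: dist_norm)
      next
        case False
        have "norm x \<le> norm (x + h k *\<^sub>R ?e) + norm (- (h k *\<^sub>R ?e))" using norm_triangle_ineq[of "x + h k *\<^sub>R ?e" "- (h k *\<^sub>R ?e)"] by simp
        then have "norm x \<le> norm (x + h k *\<^sub>R ?e) + 1" using h[of k] by (simp add: norm_axis_1)
        then have "\<phi> (x + h k *\<^sub>R ?e) = 0" "\<phi> x = 0" using False R[of x] R[of "x + h k *\<^sub>R ?e"] by force+
        then show ?thesis using B by (simp add: q_def)
      qed
    qed
    show "q k \<in> borel_measurable lborel" for k unfolding q_def by measurable
  qed simp
  moreover have "integral\<^sup>L lborel (q k) = 0" for k
  proof -
    have "integrable lborel (\<lambda>x. \<phi> (x + h k *\<^sub>R ?e))"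
      by (rule lborel_integrable_translate[OF test_functions_integrable[OF \<phi>]])
    then show ?thesis
      using lborel_integral_translate[of \<phi> "h k *\<^sub>R ?e"] test_functions_integrable[OF \<phi>] by (simp add: q_def[abs_def])
  qed
  ultimately show ?thesis by (simp add: LIMSEQ_const_iff)
qed

lemma integration_by_parts:
  fixes \<phi> \<psi> :: "real^'n \<Rightarrow> real"
  assumes \<phi>: "\<phi> \<in> test_functions \<Omega>" and \<psi>: "\<psi> \<in> test_functions \<Omega>"
  shows "(\<integral>x. \<phi> x * partial_deriv i \<psi> x \<partial>lborel) = - (\<integral>x. partial_deriv i \<phi> x * \<psi> x \<partial>lborel)"
proof -
  have "partial_deriv i (\<lambda>x. \<phi> x * \<psi> x) = (\<lambda>x. \<phi> x * partial_deriv i \<psi> x + partial_deriv i \<phi> x * \<psi> x)"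
    by (rule ext) (simp add: partial_deriv_eq[OF has_derivative_mult[OF
          has_derivative_frechet[OF test_functions_D(2)[OF \<phi>]] has_derivative_frechet[OF test_functions_D(2)[OF \<psi>]]]]
        partial_deriv_def)
  then have "(\<integral>x. \<phi> x * partial_deriv i \<psi> x + partial_deriv i \<phi> x * \<psi> x \<partial>lborel) = 0"
    using integral_partial_deriv[OF test_functions_mult[OF \<phi> \<psi>], of i] by simp
  moreover have "integrable lborel (\<lambda>x. \<phi> x * partial_deriv i \<psi> x)" "integrable lborel (\<lambda>x. partial_deriv i \<phi> x * \<psi> x)"
    using assms test_functions_integrable test_functions_mult test_functions_partial_deriv by blast+
  ultimately show ?thesis by simp
qed

text \<open>Connects the measure of the definitions with \<open>lborel\<close>, on which translation
  invariance and Fubini's theorem are applied.\<close>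

lemma lebesgue_on_lborel:
  fixes f :: "'a::euclidean_space \<Rightarrow> 'b::euclidean_space"
  assumes "f \<in> borel_measurable borel" "\<And>x. x \<notin> \<Omega> \<Longrightarrow> f x = 0" "\<Omega> \<in> sets lebesgue"
  shows "integral\<^sup>L (lebesgue_on \<Omega>) f = integral\<^sup>L lborel f"
    and "integrable (lebesgue_on \<Omega>) f \<longleftrightarrow> integrable lborel f"
proof -
  have e: "(\<lambda>x. if x \<in> \<Omega> then f x else 0) = f" using assms(2) by auto
  have m: "f \<in> borel_measurable lborel" using assms(1) by simp
  show "integral\<^sup>L (lebesgue_on \<Omega>) f = integral\<^sup>L lborel f"
    using Lebesgue_Measure.integral_restrict_UNIV[OF assms(3), of f] integral_completion[OF m] unfolding e by simp
  show "integrable (lebesgue_on \<Omega>) f \<longleftrightarrow> integrable lborel f"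
    using Lebesgue_Measure.integrable_restrict_UNIV[OF assms(3), of f] integrable_completion[OF m] unfolding e by simp
qed

text \<open>Open boxes form an intersection-stable generator of the Borel sets, so the vanishing of
  the integrals extends to all Borel sets by Dynkin's argument. The sets where the function has a
  fixed sign then force it to vanish.\<close>

lemma integral_zero_on_boxes_imp_AE:
  fixes g :: "real^'n \<Rightarrow> real"
  assumes g: "integrable lborel g"
    and zero: "\<And>a b. cbox a b \<subseteq> cbox c d \<Longrightarrow> (\<integral>x. indicator (box a b) x * g x \<partial>lborel) = 0"
  shows "AE x in lborel. x \<in> cbox c d \<longrightarrow> g x = 0"
proof -
  note [measurable] = borel_measurable_integrable[OF g]
  define G where "G x = indicator (box c d) x * g x" for x
  have Gi: "integrable lborel G"
    unfolding G_def using integrable_mult_indicator[OF _ g, of "box c d"] by simp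
  have Gi': "integrable lborel (\<lambda>x. indicator A x * G x)" if "A \<in> sets borel" for A
    using integrable_mult_indicator[OF _ Gi, of A] that by simp
  have "(\<integral>x. indicator A x * G x \<partial>lborel) = 0" if "A \<in> sets borel" for A
  proof -
    have "Int_stable (range (\<lambda>(a, b). box a b :: (real^'n) set))"
      by (auto simp: Int_stable_def box_Int_box)
    moreover have "range (\<lambda>(a, b). box a b :: (real^'n) set) \<subseteq> Pow UNIV" by auto
    moreover have "A \<in> sigma_sets UNIV (range (\<lambda>(a, b). box a b))"
      using that by (simp add: borel_eq_box sets_measure_of)
    ultimately show ?thesis
    proof (induction rule: sigma_sets_induct_disjoint)
      case (basic A)
      then obtain a b where A: "A = box a b" by auto
      \<comment> \<open>The intersection is again an open box, and if it is nonempty its closure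
        lies in \<open>cbox c d\<close>, so \<open>zero\<close> applies to it.\<close>
      have "(\<integral>x. indicator (box a b \<inter> box c d) x * g x \<partial>lborel) = 0"
      proof (cases "box a b \<inter> box c d = {}")
        case False
        obtain a' b' where ab: "box a b \<inter> box c d = box a' b'" using box_Int_box by blast
        then have "cbox a' b' = closure (box a' b')" using False closure_box by metis
        also have "\<dots> \<subseteq> cbox c d" using ab by (intro closure_minimal) (use box_subset_cbox in auto)
        finally show ?thesis unfolding ab by (rule zero)
      qed simp
      also have "(\<lambda>x. indicator (box a b \<inter> box c d) x * g x) = (\<lambda>x. indicator A x * G x)"
        by (auto simp: A G_def indicator_def)
      finally show ?case .
    next
      case empty
      then show ?case by simp
    next
      case (compl A)
      then have Ab: "A \<in> sets borel" by (simp add: borel_eq_box sets_measure_of)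
      have "(\<integral>x. indicator (UNIV - A) x * G x \<partial>lborel) = (\<integral>x. G x - indicator A x * G x \<partial>lborel)"
        by (rule Bochner_Integration.integral_cong) (auto simp: indicator_def)
      also have "\<dots> = (\<integral>x. G x \<partial>lborel)" using compl Gi Gi'[OF Ab] by simp
      \<comment> \<open>The box \<open>box c d\<close> is itself admissible, so the total integral
        of \<open>G\<close> vanishes.\<close>
      also have "\<dots> = 0" using zero[of c d] by (simp add: G_def[abs_def])
      finally show ?case .
    next
      case (union A)
      then have Ab: "A i \<in> sets borel" for i by (auto simp: borel_eq_box sets_measure_of)
      have "set_integrable lborel (\<Union>i. A i) G" "\<And>i. set_lebesgue_integral lborel (A i) G = 0"
        using Gi'[of "\<Union>i. A i"] Ab union by (auto simp: set_integrable_def set_lebesgue_integral_def)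
      then have "set_lebesgue_integral lborel (\<Union>i. A i) G = 0"
        using lebesgue_integral_countable_add[of A lborel G] Ab union(1) by (auto simp: disjoint_family_on_def)
      then show ?case by (simp add: set_lebesgue_integral_def)
    qed
  qed
  note all = this
  have nonneg: "AE x in lborel. indicator A x * G x = 0"
    if "A \<in> sets borel" "(\<forall>x. 0 \<le> indicator A x * G x) \<or> (\<forall>x. indicator A x * G x \<le> 0)" for A
    using that(2)
  proof
    assume "\<forall>x. 0 \<le> indicator A x * G x"
    then show ?thesis using integral_nonneg_eq_0_iff_AE[OF Gi'[OF that(1)]] all[OF that(1)] by auto
  next
    assume "\<forall>x. indicator A x * G x \<le> 0"
    then have "AE x in lborel. 0 \<le> - (indicator A x * G x)" by auto
    moreover have "integrable lborel (\<lambda>x. - (indicator A x * G x))" using Gi'[OF that(1)] by simp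
    ultimately have "AE x in lborel. - (indicator A x * G x) = 0"
      using integral_nonneg_eq_0_iff_AE[of lborel "\<lambda>x. - (indicator A x * G x)"] all[OF that(1)] by auto
    then show ?thesis by simp
  qed
  \<comment> \<open>On these two sets the integrand has a sign, so a vanishing integral makes it
    vanish almost everywhere; together they cover the space.\<close>
  have m: "{x. 0 \<le> G x} \<in> sets borel" "{x. G x \<le> 0} \<in> sets borel" unfolding G_def by measurable
  have "AE x in lborel. indicator {x. 0 \<le> G x} x * G x = 0"
    by (rule nonneg[OF m(1)], rule disjI1) (auto simp: indicator_def)
  moreover have "AE x in lborel. indicator {x. G x \<le> 0} x * G x = 0"
    by (rule nonneg[OF m(2)], rule disjI2) (auto simp: indicator_def)
  ultimately have "AE x in lborel. G x = 0"
  proof eventually_elim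
    case (elim x)
    then show ?case by (cases "0 \<le> G x") (auto simp: indicator_def)
  qed
  moreover have "AE x in lborel. x \<notin> cbox c d - box c d"
    using null_sets_cbox_Diff_box AE_not_in by blast
  ultimately show ?thesis by eventually_elim (auto simp: G_def)
qed

text \<open>Bump functions converge boundedly to indicators of boxes, so \<open>g\<close> integrates
  to zero over every box whose closure lies in the open set; countably many closed boxes exhaust
  that set.\<close>

lemma fundamental_lemma_variations:
  fixes g :: "real^'n \<Rightarrow> real"
  assumes \<Omega>: "open \<Omega>" and g: "integrable (lebesgue_on \<Omega>) g"
    and zero: "\<And>\<phi>. \<phi> \<in> test_functions \<Omega> \<Longrightarrow> (\<integral>x. g x * \<phi> x \<partial>lebesgue_on \<Omega>) = 0"
  shows "AE x in lebesgue_on \<Omega>. g x = 0"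
proof -
  have \<Omega>m: "\<Omega> \<in> sets lebesgue" using \<Omega> by auto
  define g0 where "g0 x = (if x \<in> \<Omega> then g x else 0)" for x
  have g0: "integrable lebesgue g0" using g Lebesgue_Measure.integrable_restrict_UNIV[OF \<Omega>m, of g] by (simp add: g0_def[abs_def])
  \<comment> \<open>\<open>g\<close> is only Lebesgue measurable; the argument with boxes runs on
    \<open>lborel\<close> and needs a Borel representative.\<close>
  then obtain g1 where g1m: "g1 \<in> borel_measurable lborel" and g01: "AE x in lborel. g0 x = g1 x"
    using completion_ex_borel_measurable_real[of g0 lborel] by auto
  have ae: "AE x in lebesgue. g0 x = g1 x" using g01 AE_completion by blast
  have m1: "g1 \<in> borel_measurable lebesgue" using g1m by (simp add: measurable_completion)
  have "integrable lebesgue g1" using integrable_cong_AE[OF borel_measurable_integrable[OF g0] m1 ae] g0 by simp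
  then have g1: "integrable lborel g1" using integrable_completion[OF g1m] by simp
  have test: "(\<integral>x. \<phi> x * g1 x \<partial>lborel) = 0" if \<phi>: "\<phi> \<in> test_functions \<Omega>" for \<phi>
  proof -
    note [measurable] = test_functions_D(4)[OF \<phi>] g1m m1 borel_measurable_integrable[OF g0]
    have \<phi>m: "\<phi> \<in> borel_measurable lebesgue" using test_functions_D(4)[OF \<phi>] by (simp add: measurable_completion)
    have "(\<integral>x. \<phi> x * g1 x \<partial>lborel) = (\<integral>x. \<phi> x * g1 x \<partial>lebesgue)" by (rule integral_completion[symmetric]) measurable
    also have "\<dots> = (\<integral>x. \<phi> x * g0 x \<partial>lebesgue)"
      using \<phi>m m1 borel_measurable_integrable[OF g0] ae by (intro integral_cong_AE) auto
    also have "\<dots> = (\<integral>x. (if x \<in> \<Omega> then g x * \<phi> x else 0) \<partial>lebesgue)"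
      by (rule Bochner_Integration.integral_cong) (auto simp: g0_def)
    also have "\<dots> = 0" using Lebesgue_Measure.integral_restrict_UNIV[OF \<Omega>m, of "\<lambda>x. g x * \<phi> x"] zero[OF \<phi>] by simp
    finally show ?thesis .
  qed
  have box0: "(\<integral>x. indicator (box a b) x * g1 x \<partial>lborel) = 0" if ab: "cbox a b \<subseteq> \<Omega>" for a b
  proof -
    have "(\<lambda>k. \<integral>x. bump (Suc k) a b x * g1 x \<partial>lborel) \<longlonglongrightarrow> (\<integral>x. indicator (box a b) x * g1 x \<partial>lborel)"
    proof (rule integral_dominated_convergence)
      show "integrable lborel (\<lambda>x. norm (g1 x))" using g1 by simp
      show "AE x in lborel. (\<lambda>k. bump (Suc k) a b x * g1 x) \<longlonglongrightarrow> indicator (box a b) x * g1 x"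
        by (intro AE_I2 tendsto_intros bump_tendsto)
      show "AE x in lborel. norm (bump (Suc k) a b x * g1 x) \<le> norm (g1 x)" for k
        using bump_bounds[of "Suc k" a b] by (intro AE_I2) (simp add: abs_mult mult_left_le_one_le)
      show "(\<lambda>x. bump (Suc k) a b x * g1 x) \<in> borel_measurable lborel" for k
        using test_functions_D(4)[OF bump_test_function[OF ab]] g1m by simp
    qed (use g1m in auto)
    then show ?thesis using test[OF bump_test_function[OF ab]] by (simp add: LIMSEQ_const_iff)
  qed
  obtain D where D: "countable D" "D \<subseteq> Pow \<Omega>" "\<And>X. X \<in> D \<Longrightarrow> \<exists>a b. X = cbox a b" "\<Union>D = \<Omega>"
    by (rule open_countable_Union_open_cbox[OF \<Omega>]) (rule that)
  have "AE x in lborel. x \<in> X \<longrightarrow> g1 x = 0" if X: "X \<in> D" for X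
  proof -
    obtain a b where "X = cbox a b" using D(3)[OF X] by blast
    then show ?thesis using D(2) X box0 by (auto intro!: integral_zero_on_boxes_imp_AE[OF g1])
  qed
  then have "AE x in lborel. \<forall>X\<in>D. x \<in> X \<longrightarrow> g1 x = 0" unfolding AE_ball_countable[OF D(1)] by blast
  then have "AE x in lborel. x \<in> \<Omega> \<longrightarrow> g x = 0"
    using g01
  proof eventually_elim
    case (elim x)
    show ?case
    proof
      assume x: "x \<in> \<Omega>"
      then have "g1 x = 0" using elim(1) D(4) by blast
      then show "g x = 0" using elim(2) x by (simp add: g0_def)
    qed
  qed
  then have "AE x in lebesgue. x \<in> \<Omega> \<longrightarrow> g x = 0" by (rule AE_completion)
  then show ?thesis using \<Omega>m by (simp add: AE_restrict_space_iff)
qed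

section \<open>The Gagliardo--Nirenberg--Sobolev inequality\<close>

text \<open>The real power on the extended half-line, with infinity as a fixed point. Extended
  values allow Hoelder's inequality and Tonelli's theorem to be applied to line integrals that may
  be infinite.\<close>

definition epow :: "real \<Rightarrow> ennreal \<Rightarrow> ennreal" where
  "epow \<alpha> x = (if x = top then top else ennreal (enn2real x powr \<alpha>))"

lemma epow_ennreal: "0 \<le> r \<Longrightarrow> epow \<alpha> (ennreal r) = ennreal (r powr \<alpha>)"
  by (simp add: epow_def)

lemma epow_0 [simp]: "epow \<alpha> 0 = 0" and epow_top [simp]: "epow \<alpha> top = top"
  by (simp_all add: epow_def)

lemma epow_mono: "0 < \<alpha> \<Longrightarrow> x \<le> y \<Longrightarrow> epow \<alpha> x \<le> epow \<alpha> y"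
  by (cases x; cases y) (auto simp: epow_ennreal ennreal_le_iff top_unique intro!: powr_mono2 ennreal_leI)

lemma epow_eq_0_iff: "epow \<alpha> x = 0 \<longleftrightarrow> x = 0"
  by (cases x) (auto simp: epow_ennreal)

lemma epow_measurable [measurable]:
  assumes [measurable]: "f \<in> borel_measurable M"
  shows "(\<lambda>x. epow \<alpha> (f x)) \<in> borel_measurable M"
  unfolding epow_def by measurable

text \<open>The inequality of arithmetic and geometric means for the quotients of \<open>f i\<close>
  by weights \<open>c i\<close>. In Hoelder's inequality the weights become the integrals of the
  factors.\<close>

lemma prod_epow_le_arith_mean:
  assumes S: "finite S" "S \<noteq> {}" and c: "\<And>i. i \<in> S \<Longrightarrow> 0 < c i"
  shows "(\<Prod>i\<in>S. epow (1 / card S) (f i))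
     \<le> ennreal ((\<Prod>i\<in>S. c i powr (1 / card S)) / card S) * (\<Sum>i\<in>S. ennreal (1 / c i) * f i)"
proof (cases "\<exists>i\<in>S. f i = top")
  case True
  then obtain i where i: "i \<in> S" "f i = top" by blast
  \<comment> \<open>The weights are positive and finite, so one infinite entry makes the right-hand
    side infinite.\<close>
  have "(\<Sum>i\<in>S. ennreal (1 / c i) * f i) = top" using c[OF i(1)] i(2)
    by (subst sum.remove[OF S(1) i(1)]) (simp add: ennreal_mult_eq_top_iff)
  moreover have "0 < (\<Prod>i\<in>S. c i powr (1 / card S)) / card S" using S c
    by (intro divide_pos_pos prod_pos) (auto simp: card_gt_0_iff less_imp_neq[symmetric])
  ultimately show ?thesis using ennreal_mult_top[of "ennreal ((\<Prod>i\<in>S. c i powr (1 / card S)) / card S)"]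
    by (simp only: ennreal_eq_0_iff not_le[symmetric] if_False top_greatest)
next
  case False
  define r where "r i = enn2real (f i)" for i
  have f: "f i = ennreal (r i)" "0 \<le> r i" if "i \<in> S" for i using False that
    by (auto simp: r_def less_top)
  have card: "0 < card S" using S by (simp add: card_gt_0_iff)
  have "(\<Prod>i\<in>S. r i powr (1 / card S)) = (\<Prod>i\<in>S. c i powr (1 / card S)) * (\<Prod>i\<in>S. (r i / c i) powr (1 / card S))"
    unfolding prod.distrib[symmetric] using c f by (intro prod.cong) (auto simp: less_imp_le powr_divide less_imp_neq[symmetric])
  also have "(\<Prod>i\<in>S. (r i / c i) powr (1 / card S)) = (\<Prod>i\<in>S. r i / c i) powr (1 / card S)"
    using c f by (simp add: prod_powr_distrib less_imp_le divide_nonneg_pos)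
  also have "(\<Prod>i\<in>S. c i powr (1 / card S)) * \<dots> \<le> (\<Prod>i\<in>S. c i powr (1 / card S)) * (\<Sum>i\<in>S. r i / c i / card S)"
    using S c f by (intro mult_left_mono arith_geom_mean) (auto simp: divide_nonneg_pos prod_nonneg)
  also have "\<dots> = (\<Prod>i\<in>S. c i powr (1 / card S)) / card S * (\<Sum>i\<in>S. 1 / c i * r i)"
    unfolding sum_divide_distrib[symmetric] by simp
  finally have "(\<Prod>i\<in>S. r i powr (1 / card S)) \<le> (\<Prod>i\<in>S. c i powr (1 / card S)) / card S * (\<Sum>i\<in>S. 1 / c i * r i)" .
  moreover have "(\<Prod>i\<in>S. epow (1 / card S) (f i)) = ennreal (\<Prod>i\<in>S. r i powr (1 / card S))"
    using f by (subst prod_ennreal[symmetric]) (auto simp: epow_ennreal intro!: prod.cong)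
  moreover have "(\<Sum>i\<in>S. ennreal (1 / c i) * f i) = ennreal (\<Sum>i\<in>S. 1 / c i * r i)"
  proof -
    have "(\<Sum>i\<in>S. ennreal (1 / c i) * f i) = (\<Sum>i\<in>S. ennreal (1 / c i * r i))"
    proof (rule sum.cong[OF refl])
      fix i assume i: "i \<in> S"
      show "ennreal (1 / c i) * f i = ennreal (1 / c i * r i)"
        unfolding f(1)[OF i] using c[OF i] f(2)[OF i] by (intro ennreal_mult[symmetric]) auto
    qed
    also have "\<dots> = ennreal (\<Sum>i\<in>S. 1 / c i * r i)"
    proof (rule sum_ennreal)
      show "0 \<le> 1 / c i * r i" if "i \<in> S" for i using c[OF that] f(2)[OF that] by simp
    qed
    finally show ?thesis .
  qed
  ultimately show ?thesis using c f
    by (auto simp: ennreal_mult[symmetric] sum_nonneg prod_nonneg less_imp_le divide_nonneg_pos intro!: ennreal_leI)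
qed

text \<open>Weighting each factor by its own integral and integrating the pointwise mean inequality
  turns the sum into \<open>card S\<close> ones, which cancel the denominator. Factors with integral
  zero or infinity are treated separately, since they cannot serve as weights.\<close>

lemma generalized_Hoelder:
  assumes S: "finite S" "S \<noteq> {}" and [measurable]: "\<And>i. i \<in> S \<Longrightarrow> f i \<in> borel_measurable M"
  shows "(\<integral>\<^sup>+x. (\<Prod>i\<in>S. epow (1 / card S) (f i x)) \<partial>M) \<le> (\<Prod>i\<in>S. epow (1 / card S) (\<integral>\<^sup>+x. f i x \<partial>M))"
proof (cases "\<exists>i\<in>S. (\<integral>\<^sup>+x. f i x \<partial>M) = 0")
  case True
  then obtain i where i: "i \<in> S" "(\<integral>\<^sup>+x. f i x \<partial>M) = 0" by blast
  then have "AE x in M. f i x = 0" using nn_integral_0_iff_AE[of "f i" M] assms(3) by simp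
  then have "AE x in M. (\<Prod>i\<in>S. epow (1 / card S) (f i x)) = 0"
    by eventually_elim (use i S in \<open>auto intro!: prod_zero bexI[of _ i]\<close>)
  then have "(\<integral>\<^sup>+x. (\<Prod>i\<in>S. epow (1 / card S) (f i x)) \<partial>M) = 0" by (subst nn_integral_0_iff_AE) measurable
  then show ?thesis by simp
next
  case False
  have card: "0 < card S" using S by (simp add: card_gt_0_iff)
  show ?thesis
  proof (cases "\<exists>i\<in>S. (\<integral>\<^sup>+x. f i x \<partial>M) = top")
    case True
    then obtain i where i: "i \<in> S" "(\<integral>\<^sup>+x. f i x \<partial>M) = top" by blast
    have "(\<Prod>i\<in>S. epow (1 / card S) (\<integral>\<^sup>+x. f i x \<partial>M)) = top"
      using i S False by (subst prod.remove[OF S(1) i(1)]) (auto simp: ennreal_top_mult epow_eq_0_iff)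
    then show ?thesis by simp
  next
    case fin: False
    define c where "c i = enn2real (\<integral>\<^sup>+x. f i x \<partial>M)" for i
    have c: "(\<integral>\<^sup>+x. f i x \<partial>M) = ennreal (c i)" "0 < c i" if "i \<in> S" for i
      using fin False that by (auto simp: c_def less_top enn2real_positive_iff zero_less_iff_neq_zero)
    let ?C = "ennreal ((\<Prod>i\<in>S. c i powr (1 / card S)) / card S)"
    have "(\<integral>\<^sup>+x. (\<Prod>i\<in>S. epow (1 / card S) (f i x)) \<partial>M) \<le> (\<integral>\<^sup>+x. ?C * (\<Sum>i\<in>S. ennreal (1 / c i) * f i x) \<partial>M)"
      using S c by (intro nn_integral_mono prod_epow_le_arith_mean) auto
    also have "\<dots> = ?C * (\<Sum>i\<in>S. ennreal (1 / c i) * (\<integral>\<^sup>+x. f i x \<partial>M))"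
      by (simp add: nn_integral_cmult nn_integral_sum)
    also have "(\<Sum>i\<in>S. ennreal (1 / c i) * (\<integral>\<^sup>+x. f i x \<partial>M)) = (\<Sum>i\<in>S. 1)"
      using c by (intro sum.cong) (auto simp: ennreal_mult[symmetric] less_imp_le less_imp_neq[symmetric])
    also have "?C * (\<Sum>i\<in>S. 1) = ennreal (\<Prod>i\<in>S. c i powr (1 / card S))"
      using card by (simp add: ennreal_of_nat_eq_real_of_nat ennreal_mult[symmetric] prod_nonneg)
    also have "\<dots> = (\<Prod>i\<in>S. epow (1 / card S) (\<integral>\<^sup>+x. f i x \<partial>M))"
      using c by (subst prod_ennreal[symmetric]) (auto simp: epow_ennreal less_imp_le intro!: prod.cong)
    finally show ?thesis .
  qed
qed

section \<open>The Gagliardo-Nirenberg inequality by integrating out coordinates\<close>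

definition line_int :: "'i \<Rightarrow> (('i \<Rightarrow> real) \<Rightarrow> ennreal) \<Rightarrow> ('i \<Rightarrow> real) \<Rightarrow> ennreal" where
  "line_int i h x = (\<integral>\<^sup>+t. h (x(i := t)) \<partial>lborel)"

text \<open>Integrating one coordinate at a time gives the list induction in which each step uses
  Hoelder's inequality in a single variable. Functions on the index set are used so that a
  coordinate can be replaced by an update.\<close>

primrec iter_int :: "'i list \<Rightarrow> (('i \<Rightarrow> real) \<Rightarrow> ennreal) \<Rightarrow> ('i \<Rightarrow> real) \<Rightarrow> ennreal" where
  "iter_int [] h = h"
| "iter_int (i # js) h = line_int i (iter_int js h)"

abbreviation lebPi :: "'i set \<Rightarrow> ('i \<Rightarrow> real) measure" where
  "lebPi I \<equiv> PiM I (\<lambda>_. lborel)"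

interpretation lebPi: product_sigma_finite "\<lambda>_. lborel :: real measure"
  by standard

lemma measurable_line_int:
  assumes "i \<in> I" and h: "h \<in> borel_measurable (lebPi I)"
  shows "line_int i h \<in> borel_measurable (lebPi I)"
proof -
  have I: "insert i I = I" using assms by auto
  have "(\<lambda>(x, t). x(i := t)) \<in> measurable (lebPi I \<Otimes>\<^sub>M lborel) (lebPi I)"
    using measurable_add_dim[of i I "\<lambda>_. lborel"] unfolding I .
  from measurable_compose[OF this h]
  have "(\<lambda>(x, t). h (x(i := t))) \<in> borel_measurable (lebPi I \<Otimes>\<^sub>M lborel)" by (simp add: case_prod_beta')
  then show ?thesis unfolding line_int_def[abs_def] by (rule lborel.borel_measurable_nn_integral)
qed

lemma measurable_iter_int:
  "set js \<subseteq> I \<Longrightarrow> h \<in> borel_measurable (lebPi I) \<Longrightarrow> iter_int js h \<in> borel_measurable (lebPi I)"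
  by (induction js) (auto intro: measurable_line_int)

lemma space_lebPi_upd: "x \<in> space (lebPi I) \<Longrightarrow> i \<in> I \<Longrightarrow> x(i := t) \<in> space (lebPi I)"
  by (auto simp: space_PiM PiE_iff extensional_def)

lemma measurable_line:
  assumes "x \<in> space (lebPi I)" "i \<in> I" and h: "h \<in> borel_measurable (lebPi I)"
  shows "(\<lambda>t. h (x(i := t))) \<in> borel_measurable lborel"
proof -
  have "(\<lambda>t. x(i := t)) \<in> measurable lborel (lebPi I)"
    using assms by (intro measurable_fun_upd[where J = I]) auto
  from measurable_compose[OF this h] show ?thesis .
qed

lemma line_int_commute:
  assumes x: "x \<in> space (lebPi I)" and ij: "i \<in> I" "j \<in> I" "i \<noteq> j" and h: "h \<in> borel_measurable (lebPi I)"
  shows "line_int i (line_int j h) x = line_int j (line_int i h) x"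
proof -
  have "(\<lambda>p. x(i := fst p, j := snd p)) \<in> measurable (lborel \<Otimes>\<^sub>M lborel) (lebPi I)"
    using x ij by (intro measurable_fun_upd[where J = I]) auto
  from measurable_compose[OF this h]
  have m: "(\<lambda>(s, t). h (x(i := s, j := t))) \<in> borel_measurable (lborel \<Otimes>\<^sub>M lborel)" by (simp add: case_prod_beta')
  have "line_int i (line_int j h) x = (\<integral>\<^sup>+s. \<integral>\<^sup>+t. h (x(i := s, j := t)) \<partial>lborel \<partial>lborel)"
    by (simp add: line_int_def)
  also have "\<dots> = (\<integral>\<^sup>+t. \<integral>\<^sup>+s. h (x(i := s, j := t)) \<partial>lborel \<partial>lborel)"
    by (rule lborel_pair.Fubini'[OF m, symmetric])
  also have "\<dots> = line_int j (line_int i h) x"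
    using ij by (simp add: line_int_def fun_upd_twist)
  finally show ?thesis .
qed

text \<open>The \<open>i\<close>-th factor does not depend on the coordinate \<open>i\<close>. On
  integrating in coordinate \<open>k\<close>, factor \<open>k\<close> is therefore a constant, and
  the remaining \<open>card I - 1\<close> factors carry exactly the exponents of Hoelder's
  inequality. Factors with index in \<open>js\<close> have been hit by all integrals of the list;
  the others still carry their own line integral in front.\<close>

lemma iter_int_product_le:
  assumes I: "finite I" "2 \<le> card I" and h: "\<And>i. i \<in> I \<Longrightarrow> h i \<in> borel_measurable (lebPi I)"
    and js: "distinct js" "set js \<subseteq> I" and x: "x \<in> space (lebPi I)"
  defines "\<alpha> \<equiv> 1 / (real (card I) - 1)"
  shows "iter_int js (\<lambda>x. \<Prod>i\<in>I. epow \<alpha> (line_int i (h i) x)) x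
    \<le> (\<Prod>i\<in>set js. epow \<alpha> (iter_int js (h i) x)) * (\<Prod>i\<in>I - set js. epow \<alpha> (iter_int (i # js) (h i) x))"
  using js x
proof (induction js arbitrary: x)
  case Nil
  then show ?case by simp
next
  case (Cons k js)
  have k: "k \<in> I" "k \<notin> set js" and js: "distinct js" "set js \<subseteq> I" using Cons.prems by auto
  let ?P = "\<lambda>x. \<Prod>i\<in>I. epow \<alpha> (line_int i (h i) x)"
  let ?S = "I - {k}"
  have S: "finite ?S" "?S \<noteq> {}" "card ?S = card I - 1"
  proof -
    show "card ?S = card I - 1" using I k by simp
    then show "?S \<noteq> {}" using I by (metis card.empty diff_is_0_eq not_less_eq_eq numeral_2_eq_2 One_nat_def)
  qed (use I in auto)
  have \<alpha>: "\<alpha> = 1 / card ?S" using S(3) I by (simp add: \<alpha>_def of_nat_diff)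
  \<comment> \<open>The \<open>card I - 1\<close> factors that vary along the line in direction
    \<open>k\<close>.\<close>
  define f where "f i t = (if i \<in> set js then iter_int js (h i) (x(k := t)) else iter_int (i # js) (h i) (x(k := t)))" for i t
  have fm: "f i \<in> borel_measurable lborel" if "i \<in> ?S" for i
    using that measurable_line[OF Cons.prems(3) k(1) measurable_iter_int[of js I "h i"]]
      measurable_line[OF Cons.prems(3) k(1) measurable_iter_int[of "i # js" I "h i"]] js h
    unfolding f_def[abs_def] by (cases "i \<in> set js") auto
  \<comment> \<open>If \<open>i\<close> is still outside the list, the new integral in direction
    \<open>k\<close> has to be moved inside the line integral in direction \<open>i\<close> by
    Tonelli's theorem.\<close>
  have fi: "(\<integral>\<^sup>+t. f i t \<partial>lborel) = (if i \<in> set js then iter_int (k # js) (h i) x else iter_int (i # k # js) (h i) x)"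
    if "i \<in> ?S" for i
  proof (cases "i \<in> set js")
    case False
    have "(\<integral>\<^sup>+t. f i t \<partial>lborel) = line_int k (line_int i (iter_int js (h i))) x"
      using False by (simp add: f_def line_int_def)
    also have "\<dots> = line_int i (line_int k (iter_int js (h i))) x"
      using that k js h by (intro line_int_commute[OF Cons.prems(3)] measurable_iter_int) auto
    finally show ?thesis using False by simp
  qed (simp add: f_def line_int_def)
  let ?c = "epow \<alpha> (iter_int (k # js) (h k) x)"
  have merge: "(\<Prod>i\<in>?S. if i \<in> set js then a i else b i) = (\<Prod>i\<in>set js. a i) * (\<Prod>i\<in>I - set js - {k}. b i)"
    for a b :: "'a \<Rightarrow> ennreal"
  proof -
    have "?S = set js \<union> (I - set js - {k})" using js k by auto
    then have "(\<Prod>i\<in>?S. if i \<in> set js then a i else b i) = (\<Prod>i\<in>set js \<union> (I - set js - {k}). if i \<in> set js then a i else b i)" by simp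
    also have "\<dots> = (\<Prod>i\<in>set js. if i \<in> set js then a i else b i) * (\<Prod>i\<in>I - set js - {k}. if i \<in> set js then a i else b i)"
      using I by (intro prod.union_disjoint) auto
    also have "\<dots> = (\<Prod>i\<in>set js. a i) * (\<Prod>i\<in>I - set js - {k}. b i)"
      by (intro arg_cong2[where f = "(*)"] prod.cong) auto
    finally show ?thesis .
  qed
  have split: "(\<Prod>i\<in>set js. a i) * (\<Prod>i\<in>I - set js. b i) = b k * (\<Prod>i\<in>?S. if i \<in> set js then a i else b i)"
    for a b :: "'a \<Rightarrow> ennreal"
  proof -
    have "(\<Prod>i\<in>I - set js. b i) = b k * (\<Prod>i\<in>I - set js - {k}. b i)"
      using I k by (intro prod.remove) auto
    then show ?thesis unfolding merge by (simp add: mult_ac)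
  qed
  have "iter_int (k # js) ?P x = (\<integral>\<^sup>+t. iter_int js ?P (x(k := t)) \<partial>lborel)" by (simp add: line_int_def)
  also have "\<dots> \<le> (\<integral>\<^sup>+t. (\<Prod>i\<in>set js. epow \<alpha> (iter_int js (h i) (x(k := t)))) *
       (\<Prod>i\<in>I - set js. epow \<alpha> (iter_int (i # js) (h i) (x(k := t)))) \<partial>lborel)"
    using Cons.IH js space_lebPi_upd[OF Cons.prems(3) k(1)] by (intro nn_integral_mono) blast
  also have "\<dots> = (\<integral>\<^sup>+t. ?c * (\<Prod>i\<in>?S. epow \<alpha> (f i t)) \<partial>lborel)"
  proof (rule nn_integral_cong)
    fix t :: real
    have "(\<Prod>i\<in>?S. if i \<in> set js then epow \<alpha> (iter_int js (h i) (x(k := t))) else epow \<alpha> (iter_int (i # js) (h i) (x(k := t))))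
        = (\<Prod>i\<in>?S. epow \<alpha> (f i t))" by (intro prod.cong) (auto simp: f_def)
    moreover have "iter_int (k # js) (h k) (x(k := t)) = iter_int (k # js) (h k) x" by (simp add: line_int_def)
    ultimately show "(\<Prod>i\<in>set js. epow \<alpha> (iter_int js (h i) (x(k := t)))) *
       (\<Prod>i\<in>I - set js. epow \<alpha> (iter_int (i # js) (h i) (x(k := t)))) = ?c * (\<Prod>i\<in>?S. epow \<alpha> (f i t))"
      unfolding split by simp
  qed
  also have "\<dots> = ?c * (\<integral>\<^sup>+t. (\<Prod>i\<in>?S. epow \<alpha> (f i t)) \<partial>lborel)"
    using fm by (intro nn_integral_cmult borel_measurable_prod_ennreal epow_measurable) auto
  also have "\<dots> \<le> ?c * (\<Prod>i\<in>?S. epow \<alpha> (\<integral>\<^sup>+t. f i t \<partial>lborel))"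
    unfolding \<alpha> using fm S by (intro mult_left_mono generalized_Hoelder) auto
  also have "\<dots> = ?c * (\<Prod>i\<in>?S. if i \<in> set js then epow \<alpha> (iter_int (k # js) (h i) x) else epow \<alpha> (iter_int (i # k # js) (h i) x))"
    by (intro arg_cong2[where f = "(*)"] prod.cong) (auto simp: fi simp del: iter_int.simps)
  also have "\<dots> = (\<Prod>i\<in>set (k # js). epow \<alpha> (iter_int (k # js) (h i) x)) * (\<Prod>i\<in>I - set (k # js). epow \<alpha> (iter_int (i # k # js) (h i) x))"
  proof -
    have e: "I - set (k # js) = I - set js - {k}" by auto
    show ?thesis unfolding e merge using k by (simp add: mult_ac del: iter_int.simps)
  qed
  finally show ?case .
qed

text \<open>Tonelli's theorem, by induction on the list: \<open>override_on\<close> keeps the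
  coordinates outside \<open>js\<close> at their values in \<open>x\<close>.\<close>

lemma iter_int_eq_nn_integral:
  assumes "finite I" "distinct js" "set js \<subseteq> I" "x \<in> space (lebPi I)" and h: "h \<in> borel_measurable (lebPi I)"
  shows "iter_int js h x = (\<integral>\<^sup>+y. h (override_on x y (set js)) \<partial>lebPi (set js))"
  using assms(2-4)
proof (induction js arbitrary: x)
  case Nil
  have "(\<integral>\<^sup>+y. h (override_on x y {}) \<partial>lebPi {}) = h (override_on x (\<lambda>_. undefined) {})"
    by (rule lebPi.nn_integral_empty) simp
  then show ?case by simp
next
  case (Cons k js)
  have k: "k \<in> I" "k \<notin> set js" using Cons.prems by auto
  have "(\<lambda>y. override_on x y (set (k # js))) = (\<lambda>y i. if i \<in> set (k # js) then y i else x i)"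
    by (auto simp: override_on_def)
  moreover have "(\<lambda>y i. if i \<in> set (k # js) then y i else x i) \<in> measurable (lebPi (set (k # js))) (lebPi I)"
  proof (rule measurable_PiM_single')
    show "(\<lambda>y i. if i \<in> set (k # js) then y i else x i) \<in> space (lebPi (set (k # js))) \<rightarrow> (\<Pi>\<^sub>E i\<in>I. space lborel)"
      using Cons.prems by (auto simp: space_PiM PiE_iff extensional_def)
    show "(\<lambda>y. if i \<in> set (k # js) then y i else x i) \<in> measurable (lebPi (set (k # js))) lborel" if "i \<in> I" for i
      by (cases "i \<in> set (k # js)") (auto intro: measurable_component_singleton[of i "set (k # js)" "\<lambda>_. lborel", simplified])
  qed
  ultimately have "(\<lambda>y. override_on x y (set (k # js))) \<in> measurable (lebPi (set (k # js))) (lebPi I)" by simp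
  from measurable_compose[OF this h]
  have m: "(\<lambda>y. h (override_on x y (insert k (set js)))) \<in> borel_measurable (lebPi (insert k (set js)))" by simp
  have "iter_int (k # js) h x = (\<integral>\<^sup>+t. \<integral>\<^sup>+y. h (override_on (x(k := t)) y (set js)) \<partial>lebPi (set js) \<partial>lborel)"
  proof -
    have "iter_int js h (x(k := t)) = (\<integral>\<^sup>+y. h (override_on (x(k := t)) y (set js)) \<partial>lebPi (set js))" for t
      by (rule Cons.IH[OF _ _ space_lebPi_upd[OF Cons.prems(3) k(1)]]) (use Cons.prems in auto)
    then show ?thesis unfolding iter_int.simps line_int_def by (rule arg_cong[OF ext])
  qed
  also have "\<dots> = (\<integral>\<^sup>+t. \<integral>\<^sup>+y. h (override_on x (y(k := t)) (insert k (set js))) \<partial>lebPi (set js) \<partial>lborel)"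
  proof -
    have "override_on (x(k := t)) y (set js) = override_on x (y(k := t)) (insert k (set js))" for y t
      using k by (auto simp: override_on_def)
    then show ?thesis by simp
  qed
  also have "\<dots> = (\<integral>\<^sup>+y. h (override_on x y (insert k (set js))) \<partial>lebPi (insert k (set js)))"
    by (rule lebPi.product_nn_integral_insert_rev[OF _ k(2) m, symmetric]) simp
  finally show ?case by simp
qed

text \<open>The list now enumerates all of \<open>I\<close>, so the second product in
  \<open>iter_int_product_le\<close> is empty and the iterated integrals are full integrals. The
  base point is irrelevant and taken to be zero.\<close>

theorem Gagliardo_Nirenberg_PiM:
  assumes I: "finite I" "2 \<le> card I" and h: "\<And>i. i \<in> I \<Longrightarrow> h i \<in> borel_measurable (lebPi I)"
  defines "\<alpha> \<equiv> 1 / (real (card I) - 1)"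
  shows "(\<integral>\<^sup>+x. (\<Prod>i\<in>I. epow \<alpha> (line_int i (h i) x)) \<partial>lebPi I) \<le> (\<Prod>i\<in>I. epow \<alpha> (\<integral>\<^sup>+x. h i x \<partial>lebPi I))"
proof -
  obtain js where js: "set js = I" "distinct js" using finite_distinct_list[OF I(1)] by blast
  define x :: "'a \<Rightarrow> real" where "x = restrict (\<lambda>_. 0) I"
  have x: "x \<in> space (lebPi I)" by (simp add: x_def space_PiM)
  have full: "iter_int js f x = (\<integral>\<^sup>+y. f y \<partial>lebPi I)" if "f \<in> borel_measurable (lebPi I)" for f
  proof -
    have "override_on x y I = y" if "y \<in> space (lebPi I)" for y
      using that by (auto simp: override_on_def x_def space_PiM PiE_iff extensional_def)
    then show ?thesis using iter_int_eq_nn_integral[OF I(1) js(2) _ x that] js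
      by (auto intro!: nn_integral_cong)
  qed
  have "(\<lambda>x. \<Prod>i\<in>I. epow \<alpha> (line_int i (h i) x)) \<in> borel_measurable (lebPi I)"
    by (intro borel_measurable_prod_ennreal epow_measurable measurable_line_int h)
  from full[OF this] full[OF h] iter_int_product_le[where h = h, OF I h js(2) _ x] js
  show ?thesis unfolding \<alpha>_def by simp
qed

lemma prod_mono_ennreal:
  fixes f g :: "'a \<Rightarrow> ennreal"
  shows "(\<And>i. i \<in> A \<Longrightarrow> f i \<le> g i) \<Longrightarrow> prod f A \<le> prod g A"
  by (induction A rule: infinite_finite_induct) (auto intro!: mult_mono)

lemma quadratic_nonneg_imp_discriminant:
  fixes A B C :: real
  assumes "\<And>t. 0 \<le> A - 2 * t * B + t\<^sup>2 * C" "0 \<le> C"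
  shows "B\<^sup>2 \<le> A * C"
proof (cases "C = 0")
  case True
  have "B = 0"
  proof (rule ccontr)
    assume "B \<noteq> 0"
    \<comment> \<open>This value of \<open>t\<close> makes the quadratic expression equal to
      -1.\<close>
    then show False using assms(1)[of "(A + 1) / (2 * B)"] True by (simp add: field_simps)
  qed
  then show ?thesis using True by simp
next
  case False
  then show ?thesis using assms(1)[of "B / C"] assms(2) by (simp add: field_simps power2_eq_square)
qed

lemma Cauchy_Schwarz_integral:
  fixes f g :: "'a \<Rightarrow> real"
  assumes fg: "integrable M (\<lambda>x. f x * g x)" and f: "integrable M (\<lambda>x. (f x)\<^sup>2)" and g: "integrable M (\<lambda>x. (g x)\<^sup>2)"
  shows "(\<integral>x. f x * g x \<partial>M)\<^sup>2 \<le> (\<integral>x. (f x)\<^sup>2 \<partial>M) * (\<integral>x. (g x)\<^sup>2 \<partial>M)"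
proof (rule quadratic_nonneg_imp_discriminant)
  fix t
  have "0 \<le> (\<integral>x. (f x - t * g x)\<^sup>2 \<partial>M)" by (rule integral_nonneg_AE) simp
  also have "(\<lambda>x. (f x - t * g x)\<^sup>2) = (\<lambda>x. (f x)\<^sup>2 - 2 * t * (f x * g x) + t\<^sup>2 * (g x)\<^sup>2)"
    by (auto simp: power2_eq_square algebra_simps)
  finally show "0 \<le> (\<integral>x. (f x)\<^sup>2 \<partial>M) - 2 * t * (\<integral>x. f x * g x \<partial>M) + t\<^sup>2 * (\<integral>x. (g x)\<^sup>2 \<partial>M)"
    using assms by simp
qed (auto intro: integral_nonneg_AE)

lemma continuous_grad:
  assumes "\<phi> \<in> test_functions \<Omega>"
  shows "continuous_on UNIV (grad \<phi>)"
  unfolding grad_def using test_functions_D(3)[OF test_functions_partial_deriv[OF assms]]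
  by (intro continuous_on_vec_lambda)

lemma grad_support: "grad \<phi> x \<noteq> 0 \<Longrightarrow> x \<in> closure {x. \<phi> x \<noteq> 0}"
  using partial_deriv_eq_0[of x \<phi>] by (auto simp: grad_def vec_eq_iff)

lemma continuous_abs_powr:
  fixes f :: "'a::topological_space \<Rightarrow> real"
  shows "continuous_on S f \<Longrightarrow> 0 < q \<Longrightarrow> continuous_on S (\<lambda>x. \<bar>f x\<bar> powr q)"
  by (intro continuous_on_powr' continuous_intros) auto

text \<open>The fundamental theorem of calculus for the \<open>\<gamma>\<close>-th power along the
  line through \<open>x\<close>, started at a point outside the support.\<close>

lemma test_function_line_bound:
  fixes \<phi> :: "real^'n \<Rightarrow> real"
  assumes \<phi>: "\<phi> \<in> test_functions \<Omega>" and \<gamma>: "\<gamma> > 2" and b: "norm b = 1"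
  shows "ennreal (\<bar>\<phi> x\<bar> powr \<gamma>)
    \<le> (\<integral>\<^sup>+t. ennreal (\<gamma> * \<bar>\<phi> (x + t *\<^sub>R b)\<bar> powr (\<gamma> - 1) * norm (grad \<phi> (x + t *\<^sub>R b))) \<partial>lborel)"
proof -
  define u where "u t = \<bar>\<phi> (x + t *\<^sub>R b)\<bar> powr \<gamma>" for t
  define \<sigma> where "\<sigma> y = sgn y * \<bar>y\<bar> powr (\<gamma> - 1)" for y :: real
  define u' where "u' t = \<gamma> * \<sigma> (\<phi> (x + t *\<^sub>R b)) * (grad \<phi> (x + t *\<^sub>R b) \<bullet> b)" for t
  note line = test_functions_line_DERIV[OF \<phi>, of x b]
  have "isCont \<sigma> y" for y unfolding \<sigma>_def using DERIV_isCont[OF sgn_powr_DERIV[of "\<gamma> - 1"]] \<gamma> by simp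
  then have \<sigma>: "continuous_on UNIV \<sigma>" by (simp add: continuous_at_imp_continuous_on)
  have c\<phi>: "continuous_on UNIV (\<lambda>t. \<phi> (x + t *\<^sub>R b))"
    by (rule continuous_on_compose2[OF test_functions_D(3)[OF \<phi>]]) (auto intro!: continuous_intros)
  have cg: "continuous_on UNIV (\<lambda>t. grad \<phi> (x + t *\<^sub>R b))"
    by (rule continuous_on_compose2[OF continuous_grad[OF \<phi>]]) (auto intro!: continuous_intros)
  have "continuous_on UNIV u'" unfolding u'_def
    by (intro continuous_intros cg continuous_on_compose2[OF \<sigma> c\<phi>]) auto
  then have cu': "isCont u' t" for t by (simp add: continuous_on_eq_continuous_at)
  have du: "(u has_real_derivative u' t) (at t)" for t
    unfolding u_def[abs_def] u'_def \<sigma>_def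
    using DERIV_chain2[OF abs_powr_DERIV line[of t], of \<gamma>] \<gamma> by simp
  obtain R where R: "\<And>y. \<phi> y \<noteq> 0 \<Longrightarrow> norm y \<le> R" using test_functions_bounded_support[OF \<phi>] by (auto simp: bounded_iff)
  \<comment> \<open>Since \<open>b\<close> is a unit vector, the point with parameter
    \<open>a\<close> has norm at least \<open>\<bar>R\<bar> + 1\<close>, hence lies outside the
    support.\<close>
  define a where "a = - (\<bar>R\<bar> + norm x + 1)"
  have a: "a \<le> 0" unfolding a_def using norm_ge_zero[of x] by linarith
  have "\<bar>a\<bar> - norm x \<le> norm (x + a *\<^sub>R b)" using norm_diff_ineq[of "a *\<^sub>R b" x] b by (simp add: add.commute)
  moreover have "\<bar>a\<bar> = \<bar>R\<bar> + norm x + 1" unfolding a_def using norm_ge_zero[of x] by linarith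
  ultimately have "\<phi> (x + a *\<^sub>R b) = 0" using R[of "x + a *\<^sub>R b"] by linarith
  then have ua: "u a = 0" using \<gamma> by (simp add: u_def)
  have "(\<integral>t. u' t * indicator {a..0} t \<partial>lborel) = u 0 - u a"
    by (rule integral_FTC_Icc_real[OF a]) (use du cu' in auto)
  then have "ennreal (u 0) = ennreal (norm (\<integral>t. u' t * indicator {a..0} t \<partial>lborel))" using ua by (simp add: u_def)
  also have "\<dots> \<le> (\<integral>\<^sup>+t. ennreal (norm (u' t * indicator {a..0} t)) \<partial>lborel)"
  proof (rule integral_norm_bound_ennreal)
    show "integrable lborel (\<lambda>t. u' t * indicator {a..0} t)"
      using borel_integrable_compact[of "{a..0}" u'] \<open>continuous_on UNIV u'\<close>
      by (auto intro: continuous_on_subset simp: mult.commute)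
  qed
  also have "\<dots> \<le> (\<integral>\<^sup>+t. ennreal (\<gamma> * \<bar>\<phi> (x + t *\<^sub>R b)\<bar> powr (\<gamma> - 1) * norm (grad \<phi> (x + t *\<^sub>R b))) \<partial>lborel)"
  proof (intro nn_integral_mono ennreal_leI)
    fix t
    have "\<bar>\<sigma> y\<bar> \<le> \<bar>y\<bar> powr (\<gamma> - 1)" for y by (simp add: \<sigma>_def abs_mult abs_sgn_eq)
    moreover have "\<bar>grad \<phi> (x + t *\<^sub>R b) \<bullet> b\<bar> \<le> norm (grad \<phi> (x + t *\<^sub>R b))"
      using Cauchy_Schwarz_ineq2[of "grad \<phi> (x + t *\<^sub>R b)" b] b by simp
    ultimately have "\<bar>u' t\<bar> \<le> \<gamma> * \<bar>\<phi> (x + t *\<^sub>R b)\<bar> powr (\<gamma> - 1) * norm (grad \<phi> (x + t *\<^sub>R b))"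
      using \<gamma> unfolding u'_def abs_mult by (intro mult_mono) auto
    then show "norm (u' t * indicator {a..0} t) \<le> \<gamma> * \<bar>\<phi> (x + t *\<^sub>R b)\<bar> powr (\<gamma> - 1) * norm (grad \<phi> (x + t *\<^sub>R b))"
      using \<gamma> by (auto simp: indicator_def)
  qed
  finally show ?thesis by (simp add: u_def)
qed

text \<open>By the bound along lines, the \<open>\<gamma>\<close>-th power is at most the line
  integral of \<open>k\<close> in each of the N coordinate directions. The product of these N
  bounds, each raised to 1/(N-1), gives the exponent on the left, and
  \<open>Gagliardo_Nirenberg_PiM\<close> integrates it.\<close>

lemma Gagliardo_Nirenberg_test_function:
  fixes \<phi> :: "real^'n \<Rightarrow> real"
  assumes n: "CARD('n) > 2" and \<phi>: "\<phi> \<in> test_functions \<Omega>" and \<gamma>: "\<gamma> > 2"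
  defines "N \<equiv> real CARD('n)"
  shows "(\<integral>x. \<bar>\<phi> x\<bar> powr (\<gamma> * N / (N - 1)) \<partial>lborel)
    \<le> (\<integral>x. \<gamma> * \<bar>\<phi> x\<bar> powr (\<gamma> - 1) * norm (grad \<phi> x) \<partial>lborel) powr (N / (N - 1))"
proof -
  have N: "N > 2" using n by (simp add: N_def)
  define \<alpha> where "\<alpha> = 1 / (N - 1)"
  have \<alpha>: "\<alpha> > 0" using N by (simp add: \<alpha>_def)
  define k where "k x = \<gamma> * \<bar>\<phi> x\<bar> powr (\<gamma> - 1) * norm (grad \<phi> x)" for x
  have k0: "0 \<le> k x" for x using \<gamma> by (simp add: k_def)
  have kc: "continuous_on UNIV k" unfolding k_def
    using \<gamma> by (intro continuous_intros continuous_abs_powr continuous_grad[OF \<phi>] test_functions_D(3)[OF \<phi>]) auto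
  have km [measurable]: "k \<in> borel_measurable borel" using kc by (rule borel_measurable_continuous_onI)
  have bnd: "bounded {x. k x \<noteq> 0}"
    by (rule bounded_subset[OF test_functions_bounded_support[OF \<phi>]]) (auto simp: k_def)
  have ki: "integrable lborel k" by (rule compact_support_integrable[OF kc bnd])
  let ?B = "Basis :: (real^'n) set"
  let ?T = "\<lambda>y. \<Sum>b\<in>?B. y b *\<^sub>R b"
  have card: "card ?B = CARD('n)" by simp
  have T [measurable]: "?T \<in> measurable (lebPi ?B) borel" by measurable
  have nnT: "(\<integral>\<^sup>+x. f x \<partial>lborel) = (\<integral>\<^sup>+y. f (?T y) \<partial>lebPi ?B)" if "f \<in> borel_measurable borel" for f
    using that by (subst lborel_eq) (simp add: nn_integral_distr)
  define h where "h y = ennreal (k (?T y))" for y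
  have hm: "h \<in> borel_measurable (lebPi ?B)" unfolding h_def by measurable
  have line: "ennreal (\<bar>\<phi> (?T y)\<bar> powr \<gamma>) \<le> line_int b h y" if b: "b \<in> ?B" for b y
  proof -
    \<comment> \<open>Updating the coordinate \<open>b\<close> moves the point by
      \<open>t - y b\<close> along \<open>b\<close>; an affine substitution later removes the
      shift.\<close>
    have Tb: "?T (y(b := t)) = ?T y + (t - y b) *\<^sub>R b" for t
    proof -
      have "?T (y(b := t)) = t *\<^sub>R b + (\<Sum>c\<in>?B - {b}. y c *\<^sub>R c)"
        using b by (subst sum.remove[OF finite_Basis b]) (auto intro!: sum.cong)
      moreover have "?T y = y b *\<^sub>R b + (\<Sum>c\<in>?B - {b}. y c *\<^sub>R c)"
        by (rule sum.remove[OF finite_Basis b])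
      ultimately show ?thesis by (simp add: algebra_simps)
    qed
    have "ennreal (\<bar>\<phi> (?T y)\<bar> powr \<gamma>) \<le> (\<integral>\<^sup>+t. ennreal (k (?T y + t *\<^sub>R b)) \<partial>lborel)"
      unfolding k_def by (rule test_function_line_bound[OF \<phi> \<gamma>]) (use b in simp)
    also have "\<dots> = line_int b h y"
      unfolding line_int_def h_def Tb by (subst nn_integral_real_affine[of _ 1 "y b"]) auto
    finally show ?thesis .
  qed
  have "(\<integral>\<^sup>+x. ennreal (\<bar>\<phi> x\<bar> powr (\<gamma> * N / (N - 1))) \<partial>lborel)
      = (\<integral>\<^sup>+y. ennreal (\<bar>\<phi> (?T y)\<bar> powr (\<gamma> * N / (N - 1))) \<partial>lebPi ?B)"
    using test_functions_D(4)[OF \<phi>] by (intro nnT) measurable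
  also have "\<dots> \<le> (\<integral>\<^sup>+y. (\<Prod>b\<in>?B. epow \<alpha> (line_int b h y)) \<partial>lebPi ?B)"
  proof (rule nn_integral_mono)
    fix y
    have "ennreal (\<bar>\<phi> (?T y)\<bar> powr (\<gamma> * N / (N - 1))) = (\<Prod>b\<in>?B. ennreal ((\<bar>\<phi> (?T y)\<bar> powr \<gamma>) powr \<alpha>))"
    proof (cases "\<phi> (?T y) = 0")
      case False
      then show ?thesis by (simp add: powr_powr ennreal_power powr_realpow[symmetric] \<alpha>_def N_def mult_ac)
    qed simp
    also have "\<dots> \<le> (\<Prod>b\<in>?B. epow \<alpha> (line_int b h y))"
      by (intro prod_mono_ennreal) (use epow_mono[OF \<alpha> line] in \<open>auto simp: epow_ennreal\<close>)
    finally show "ennreal (\<bar>\<phi> (?T y)\<bar> powr (\<gamma> * N / (N - 1))) \<le> (\<Prod>b\<in>?B. epow \<alpha> (line_int b h y))" .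
  qed
  also have "\<dots> \<le> (\<Prod>b\<in>?B. epow \<alpha> (\<integral>\<^sup>+y. h y \<partial>lebPi ?B))"
    using Gagliardo_Nirenberg_PiM[of ?B "\<lambda>_. h"] hm n unfolding card by (simp add: \<alpha>_def N_def)
  also have "(\<integral>\<^sup>+y. h y \<partial>lebPi ?B) = ennreal (integral\<^sup>L lborel k)"
    unfolding h_def by (subst nnT[symmetric]) (auto simp: nn_integral_eq_integral[OF ki] k0)
  also have "(\<Prod>b\<in>?B. epow \<alpha> (ennreal (integral\<^sup>L lborel k))) = ennreal (integral\<^sup>L lborel k powr (N / (N - 1)))"
  proof (cases "integral\<^sup>L lborel k = 0")
    case False
    moreover have "0 \<le> integral\<^sup>L lborel k" using k0 by simp
    ultimately show ?thesis
      by (simp add: epow_ennreal ennreal_power powr_realpow[symmetric] powr_powr \<alpha>_def N_def)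
  qed simp
  finally have le: "(\<integral>\<^sup>+x. ennreal (\<bar>\<phi> x\<bar> powr (\<gamma> * N / (N - 1))) \<partial>lborel) \<le> ennreal (integral\<^sup>L lborel k powr (N / (N - 1)))" .
  have "integrable lborel (\<lambda>x. \<bar>\<phi> x\<bar> powr (\<gamma> * N / (N - 1)))"
  proof (rule compact_support_integrable)
    show "continuous_on UNIV (\<lambda>x. \<bar>\<phi> x\<bar> powr (\<gamma> * N / (N - 1)))"
      using \<gamma> N by (intro continuous_abs_powr test_functions_D(3)[OF \<phi>]) auto
    show "bounded {x. \<bar>\<phi> x\<bar> powr (\<gamma> * N / (N - 1)) \<noteq> 0}" using test_functions_bounded_support[OF \<phi>] by simp
  qed
  from nn_integral_eq_integral[OF this] le show ?thesis
    by (simp add: k_def[symmetric])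
qed

text \<open>The Gagliardo-Nirenberg inequality for a power of the function, followed by the
  Cauchy-Schwarz inequality. The integral of the \<open>s\<close>-th power then reappears on the
  right with exponent N/(2(N-1)), which is below 1, and can be divided out.\<close>

theorem Sobolev_test_function:
  fixes \<phi> :: "real^'n \<Rightarrow> real"
  assumes n: "CARD('n) > 2" and \<phi>: "\<phi> \<in> test_functions \<Omega>"
  defines "N \<equiv> real CARD('n)" and "s \<equiv> critical_exponent CARD('n)"
  shows "(\<integral>x. \<bar>\<phi> x\<bar> powr s \<partial>lborel) powr (1 / s) \<le> 2 * (N - 1) / (N - 2) * sqrt (\<integral>x. (norm (grad \<phi> x))\<^sup>2 \<partial>lborel)"
proof -
  have N: "N > 2" using n by (simp add: N_def)
  \<comment> \<open>The exponent for which both \<open>\<gamma> * N / (N - 1)\<close> and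
    \<open>2 * (\<gamma> - 1)\<close> equal \<open>s\<close>.\<close>
  define \<gamma> where "\<gamma> = 2 * (N - 1) / (N - 2)"
  have \<gamma>: "\<gamma> > 2" using N by (simp add: \<gamma>_def field_simps)
  have s: "s = 2 * N / (N - 2)" by (simp add: s_def N_def critical_exponent_def)
  have s0: "s > 0" using N by (simp add: s)
  have e1: "\<gamma> * N / (N - 1) = s"
  proof -
    have g: "\<gamma> * (N - 2) = 2 * (N - 1)" using N by (simp add: \<gamma>_def)
    have "\<gamma> * N * (N - 2) = N * (\<gamma> * (N - 2))" by simp
    also have "\<dots> = 2 * N * (N - 1)" unfolding g by simp
    finally show ?thesis unfolding s using N by (simp add: frac_eq_eq)
  qed
  have e2: "2 * (\<gamma> - 1) = s" using N by (simp add: s \<gamma>_def field_simps)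
  let ?A = "\<integral>x. \<bar>\<phi> x\<bar> powr s \<partial>lborel" and ?B = "\<integral>x. (norm (grad \<phi> x))\<^sup>2 \<partial>lborel"
  note c\<phi> = test_functions_D(3)[OF \<phi>] and bs = test_functions_bounded_support[OF \<phi>]
  have sq: "(\<bar>\<phi> x\<bar> powr (\<gamma> - 1))\<^sup>2 = \<bar>\<phi> x\<bar> powr s" for x
    unfolding e2[symmetric] by (simp add: power2_eq_square powr_add[symmetric])
  have bc: "bounded (closure {x. \<phi> x \<noteq> 0})" by (rule bounded_closure[OF bs])
  have ints: "integrable lborel (\<lambda>x. \<bar>\<phi> x\<bar> powr s)" "integrable lborel (\<lambda>x. (norm (grad \<phi> x))\<^sup>2)"
    "integrable lborel (\<lambda>x. \<bar>\<phi> x\<bar> powr (\<gamma> - 1) * norm (grad \<phi> x))"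
    using s0 \<gamma>
    by (intro compact_support_integrable continuous_intros continuous_abs_powr c\<phi> continuous_grad[OF \<phi>]
        bounded_subset[OF bc]; use closure_subset[of "{x. \<phi> x \<noteq> 0}"] in \<open>auto dest: grad_support\<close>)+
  have A0: "0 \<le> ?A" and B0: "0 \<le> ?B" by auto
  have "(\<integral>x. \<bar>\<phi> x\<bar> powr (\<gamma> - 1) * norm (grad \<phi> x) \<partial>lborel)\<^sup>2 \<le> ?A * ?B"
    using Cauchy_Schwarz_integral[OF ints(3)] ints unfolding sq by simp
  then have CS: "(\<integral>x. \<bar>\<phi> x\<bar> powr (\<gamma> - 1) * norm (grad \<phi> x) \<partial>lborel) \<le> sqrt (?A * ?B)"
    by (rule real_le_rsqrt)
  have "?A \<le> (\<integral>x. \<gamma> * \<bar>\<phi> x\<bar> powr (\<gamma> - 1) * norm (grad \<phi> x) \<partial>lborel) powr (N / (N - 1))"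
    using Gagliardo_Nirenberg_test_function[OF n \<phi> \<gamma>] e1 by (simp add: N_def)
  also have "(\<integral>x. \<gamma> * \<bar>\<phi> x\<bar> powr (\<gamma> - 1) * norm (grad \<phi> x) \<partial>lborel)
      = \<gamma> * (\<integral>x. \<bar>\<phi> x\<bar> powr (\<gamma> - 1) * norm (grad \<phi> x) \<partial>lborel)" by (simp add: mult.assoc)
  also have "\<dots> powr (N / (N - 1)) \<le> (\<gamma> * sqrt (?A * ?B)) powr (N / (N - 1))"
    using CS \<gamma> N by (intro powr_mono2 mult_left_mono mult_nonneg_nonneg integral_nonneg_AE) auto
  finally have main: "?A \<le> (\<gamma> * sqrt (?A * ?B)) powr (N / (N - 1))" .
  show ?thesis
  proof (cases "?A = 0")
    case True
    then show ?thesis using N B0 by (simp add: \<gamma>_def[symmetric])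
  next
    case False
    then have A: "?A > 0" using A0 by linarith
    \<comment> \<open>The remaining exponent is 1/s, because (N-1)/N - 1/2 = (N-2)/(2N).\<close>
    have "?A powr ((N - 1) / N) \<le> ((\<gamma> * sqrt (?A * ?B)) powr (N / (N - 1))) powr ((N - 1) / N)"
      using main A N by (intro powr_mono2) auto
    also have "\<dots> = \<gamma> * sqrt ?B * sqrt ?A" using N \<gamma> A0 B0 by (simp add: powr_powr real_sqrt_mult)
    also have "sqrt ?A = ?A powr (1 / 2)" using A by (simp add: powr_half_sqrt)
    finally have "?A powr ((N - 1) / N) / ?A powr (1 / 2) \<le> \<gamma> * sqrt ?B" using A by (simp add: divide_le_eq)
    also have "?A powr ((N - 1) / N) / ?A powr (1 / 2) = ?A powr (1 / s)"
      unfolding powr_diff[symmetric] s using N by (simp add: field_simps)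
    finally show ?thesis by (simp add: \<gamma>_def)
  qed
qed

section \<open>Lebesgue spaces\<close>

text \<open>Fatou's lemma in a form that also delivers integrability of the limit, which is how
  limits of test functions are placed in Lebesgue spaces.\<close>

lemma integral_Fatou:
  fixes g :: "nat \<Rightarrow> 'a \<Rightarrow> real"
  assumes g: "\<And>k. integrable M (g k)" "\<And>k x. 0 \<le> g k x" and G [measurable]: "G \<in> borel_measurable M"
    and lim: "AE x in M. (\<lambda>k. g k x) \<longlonglongrightarrow> G x"
    and C: "\<forall>\<^sub>F k in sequentially. (\<integral>x. g k x \<partial>M) \<le> C"
  shows "integrable M G" "(\<integral>x. G x \<partial>M) \<le> C"
proof -
  note [measurable] = borel_measurable_integrable[OF g(1)]
  have G0: "AE x in M. 0 \<le> G x"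
    using lim by eventually_elim (rule LIMSEQ_le_const, auto simp: g)
  have C0: "0 \<le> C"
  proof -
    obtain k where "(\<integral>x. g k x \<partial>M) \<le> C" using C by (auto simp: eventually_sequentially)
    moreover have "0 \<le> (\<integral>x. g k x \<partial>M)" using g by simp
    ultimately show ?thesis by linarith
  qed
  have "(\<integral>\<^sup>+x. ennreal (G x) \<partial>M) = (\<integral>\<^sup>+x. liminf (\<lambda>k. ennreal (g k x)) \<partial>M)"
  proof (rule nn_integral_cong_AE)
    show "AE x in M. ennreal (G x) = liminf (\<lambda>k. ennreal (g k x))"
      using lim by eventually_elim (rule lim_imp_Liminf[OF trivial_limit_sequentially tendsto_ennrealI, symmetric])
  qed
  also have "\<dots> \<le> liminf (\<lambda>k. \<integral>\<^sup>+x. ennreal (g k x) \<partial>M)" by (rule nn_integral_liminf) measurable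
  also have "\<dots> \<le> ennreal C"
  proof (rule Liminf_le)
    show "\<forall>\<^sub>F k in sequentially. (\<integral>\<^sup>+x. ennreal (g k x) \<partial>M) \<le> ennreal C"
      using C by eventually_elim (simp add: nn_integral_eq_integral[OF g(1)] g ennreal_leI)
  qed simp
  finally have le: "(\<integral>\<^sup>+x. ennreal (G x) \<partial>M) \<le> ennreal C" .
  show i: "integrable M G"
    using G0 le by (intro integrableI_nonneg) (auto intro: le_less_trans)
  show "(\<integral>x. G x \<partial>M) \<le> C"
    using le C0 unfolding nn_integral_eq_integral[OF i G0] by simp
qed

section \<open>Square-integrable functions\<close>

definition L2 :: "'a measure \<Rightarrow> ('a \<Rightarrow> 'b::euclidean_space) set" where
  "L2 M = {f \<in> borel_measurable M. integrable M (\<lambda>x. (norm (f x))\<^sup>2)}"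

definition N2 :: "'a measure \<Rightarrow> ('a \<Rightarrow> 'b::euclidean_space) \<Rightarrow> real" where
  "N2 M f = (\<integral>x. (norm (f x))\<^sup>2 \<partial>M)"

lemma N2_nonneg [simp]: "0 \<le> N2 M f" by (simp add: N2_def)

lemma L2_D: "f \<in> L2 M \<Longrightarrow> f \<in> borel_measurable M" "f \<in> L2 M \<Longrightarrow> integrable M (\<lambda>x. (norm (f x))\<^sup>2)"
  by (auto simp: L2_def)

lemma norm_add_square_le: "(norm (x + y))\<^sup>2 \<le> 2 * (norm x)\<^sup>2 + 2 * (norm (y :: 'b::real_inner))\<^sup>2"
proof -
  have "0 \<le> (norm (x - y))\<^sup>2" by simp
  then show ?thesis by (simp add: power2_norm_eq_inner inner_add inner_diff inner_commute)
qed

lemma L2_scale: "f \<in> L2 M \<Longrightarrow> (\<lambda>x. c *\<^sub>R f x) \<in> L2 M"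
  by (auto simp: L2_def power_mult_distrib)

lemma L2_add:
  assumes "f \<in> L2 M" "g \<in> L2 M"
  shows "(\<lambda>x. f x + g x) \<in> L2 M"
proof -
  note [measurable] = L2_D(1)[OF assms(1)] L2_D(1)[OF assms(2)]
  have "integrable M (\<lambda>x. 2 * (norm (f x))\<^sup>2 + 2 * (norm (g x))\<^sup>2)" using assms by (auto simp: L2_def)
  then have "integrable M (\<lambda>x. (norm (f x + g x))\<^sup>2)"
    by (rule Bochner_Integration.integrable_bound) (auto simp: norm_add_square_le)
  then show ?thesis by (simp add: L2_def)
qed

lemma L2_diff: "f \<in> L2 M \<Longrightarrow> g \<in> L2 M \<Longrightarrow> (\<lambda>x. f x - g x) \<in> L2 M"
  using L2_add[of f M "\<lambda>x. (-1) *\<^sub>R g x"] L2_scale[of g M "-1"] by simp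

lemma N2_cong_AE:
  assumes "f \<in> borel_measurable M" "g \<in> borel_measurable M" "AE x in M. f x = g x"
  shows "N2 M f = N2 M g"
  unfolding N2_def using assms by (intro integral_cong_AE) (auto elim!: eventually_mono)

lemma N2_add_le:
  assumes "f \<in> L2 M" "g \<in> L2 M"
  shows "N2 M (\<lambda>x. f x + g x) \<le> 2 * N2 M f + 2 * N2 M g"
proof -
  have "N2 M (\<lambda>x. f x + g x) \<le> (\<integral>x. 2 * (norm (f x))\<^sup>2 + 2 * (norm (g x))\<^sup>2 \<partial>M)"
    unfolding N2_def using assms L2_D(2)[OF L2_add[OF assms]]
    by (intro integral_mono) (auto simp: L2_D norm_add_square_le)
  also have "\<dots> = 2 * N2 M f + 2 * N2 M g" unfolding N2_def using assms by (simp add: L2_D)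
  finally show ?thesis .
qed

lemma N2_scale: "N2 M (\<lambda>x. c *\<^sub>R f x) = c\<^sup>2 * N2 M f"
  by (simp add: N2_def power_mult_distrib)

lemma N2_diff_triangle:
  assumes "f \<in> L2 M" "g \<in> L2 M" "h \<in> L2 M"
  shows "N2 M (\<lambda>x. f x - h x) \<le> 2 * N2 M (\<lambda>x. f x - g x) + 2 * N2 M (\<lambda>x. g x - h x)"
  using N2_add_le[OF L2_diff[OF assms(1,2)] L2_diff[OF assms(2,3)]] by simp

lemma L2_norm_mult_integrable:
  assumes "f \<in> L2 M" "g \<in> L2 M"
  shows "integrable M (\<lambda>x. norm (f x) * norm (g x))"
proof -
  note [measurable] = L2_D(1)[OF assms(1)] L2_D(1)[OF assms(2)]
  have i: "integrable M (\<lambda>x. (norm (f x))\<^sup>2 + (norm (g x))\<^sup>2)" using assms by (auto simp: L2_def)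
  have "norm (f x) * norm (g x) \<le> (norm (f x))\<^sup>2 + (norm (g x))\<^sup>2" for x
  proof -
    have "2 * (norm (f x) * norm (g x)) \<le> (norm (f x))\<^sup>2 + (norm (g x))\<^sup>2"
      using sum_squares_bound[of "norm (f x)" "norm (g x)"] by (simp add: mult.assoc)
    moreover have "0 \<le> norm (f x) * norm (g x)" by simp
    ultimately show ?thesis by linarith
  qed
  then show ?thesis by (intro Bochner_Integration.integrable_bound[OF i]) auto
qed

lemma L2_inner_integrable:
  assumes "f \<in> L2 M" "g \<in> L2 M"
  shows "integrable M (\<lambda>x. f x \<bullet> g x)"
proof -
  note [measurable] = L2_D(1)[OF assms(1)] L2_D(1)[OF assms(2)]
  show ?thesis
    by (rule Bochner_Integration.integrable_bound[OF L2_norm_mult_integrable[OF assms]])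
      (auto simp: abs_mult Cauchy_Schwarz_ineq2)
qed

lemma L2_mult_le:
  assumes "f \<in> L2 M" "g \<in> L2 M"
  shows "(\<integral>x. norm (f x) * norm (g x) \<partial>M) \<le> sqrt (N2 M f) * sqrt (N2 M g)"
proof -
  have "(\<integral>x. norm (f x) * norm (g x) \<partial>M)\<^sup>2 \<le> N2 M f * N2 M g"
    unfolding N2_def using assms by (intro Cauchy_Schwarz_integral L2_norm_mult_integrable) (auto simp: L2_D)
  then show ?thesis by (metis real_le_rsqrt real_sqrt_mult)
qed

lemma (in finite_measure) L2_imp_integrable:
  assumes "f \<in> L2 M"
  shows "integrable M f" "(\<integral>x. norm (f x) \<partial>M) \<le> sqrt (measure M (space M)) * sqrt (N2 M f)"
proof -
  note [measurable] = L2_D(1)[OF assms]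
  have one: "(\<lambda>_. 1 :: real) \<in> L2 M" by (simp add: L2_def)
  have "integrable M (\<lambda>x. norm (f x))" using L2_norm_mult_integrable[OF assms one] by simp
  then show "integrable M f" by (simp add: integrable_norm_iff)
  show "(\<integral>x. norm (f x) \<partial>M) \<le> sqrt (measure M (space M)) * sqrt (N2 M f)"
    using L2_mult_le[OF one assms] by (simp add: N2_def)
qed

lemma AE_summable_of_integrals:
  fixes g :: "nat \<Rightarrow> 'a \<Rightarrow> 'b::euclidean_space"
  assumes g: "\<And>k. integrable M (g k)" and C: "\<And>k. (\<integral>x. norm (g k x) \<partial>M) \<le> c k" "summable c"
  shows "AE x in M. summable (\<lambda>k. norm (g k x))"
proof -
  note [measurable] = borel_measurable_integrable[OF g]
  have c0: "0 \<le> c k" for k by (rule order_trans[OF integral_nonneg_AE C(1)]) simp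
  have "(\<integral>\<^sup>+x. (\<Sum>k. ennreal (norm (g k x))) \<partial>M) = (\<Sum>k. \<integral>\<^sup>+x. ennreal (norm (g k x)) \<partial>M)"
    by (rule nn_integral_suminf) measurable
  also have "\<dots> \<le> (\<Sum>k. ennreal (c k))"
  proof (rule suminf_le)
    show "(\<integral>\<^sup>+x. ennreal (norm (g k x)) \<partial>M) \<le> ennreal (c k)" for k
      using g C(1)[of k] by (subst nn_integral_eq_integral) (auto intro: ennreal_leI)
  qed auto
  also have "\<dots> = ennreal (suminf c)" using C(2) c0 by (intro suminf_ennreal2) auto
  finally have "(\<integral>\<^sup>+x. (\<Sum>k. ennreal (norm (g k x))) \<partial>M) \<noteq> \<infinity>" by (auto simp: top_unique)
  then have "AE x in M. (\<Sum>k. ennreal (norm (g k x))) \<noteq> \<infinity>" by (intro nn_integral_PInf_AE) measurable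
  then show ?thesis by eventually_elim (auto intro: summable_suminf_not_top)
qed

text \<open>The Riesz-Fischer argument: on a finite measure space a rapidly convergent subsequence
  has summable L1 distances, hence converges almost everywhere, and Fatou's lemma identifies the
  limit in the mean.\<close>

lemma (in finite_measure) L2_complete:
  fixes f :: "nat \<Rightarrow> 'a \<Rightarrow> 'b::euclidean_space"
  assumes f: "\<And>k. f k \<in> L2 M"
    and Cauchy: "\<And>\<epsilon>. 0 < \<epsilon> \<Longrightarrow> \<exists>K. \<forall>i\<ge>K. \<forall>j\<ge>K. N2 M (\<lambda>x. f i x - f j x) < \<epsilon>"
  shows "\<exists>F\<in>L2 M. (\<lambda>k. N2 M (\<lambda>x. f k x - F x)) \<longlonglongrightarrow> 0"
proof -
  note fm [measurable] = L2_D(1)[OF f]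
  have "\<exists>K. \<forall>i\<ge>K. \<forall>j\<ge>K. N2 M (\<lambda>x. f i x - f j x) < (1 / 4) ^ k" for k :: nat by (rule Cauchy) simp
  then obtain K where K: "\<And>k i j. i \<ge> K k \<Longrightarrow> j \<ge> K k \<Longrightarrow> N2 M (\<lambda>x. f i x - f j x) < (1 / 4) ^ k" by metis
  \<comment> \<open>Both \<open>r k\<close> and \<open>r (Suc k)\<close> are at least
    \<open>K k\<close>, so consecutive terms are closer than (1/4)^k in \<open>N2\<close>, and their
    L1 distance is at most \<open>c k\<close>. The summand \<open>k\<close> gives
    \<open>k \<le> r k\<close>.\<close>
  define r where "r k = (\<Sum>i\<le>k. K i) + k" for k
  have rK: "K k \<le> r k" "K k \<le> r (Suc k)" for k
    by (auto simp del: sum.atMost_Suc simp: r_def intro!: trans_le_add1 le_SucI member_le_sum)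
  have rk: "k \<le> r k" for k by (simp add: r_def)
  define c where "c k = sqrt (measure M (space M)) * (1 / 2) ^ k" for k :: nat
  have "AE x in M. summable (\<lambda>k. norm (f (r (Suc k)) x - f (r k) x))"
  proof (rule AE_summable_of_integrals)
    show "integrable M (\<lambda>x. f (r (Suc k)) x - f (r k) x)" for k
      by (intro L2_imp_integrable L2_diff f)
    show "(\<integral>x. norm (f (r (Suc k)) x - f (r k) x) \<partial>M) \<le> c k" for k
    proof -
      have "sqrt (N2 M (\<lambda>x. f (r (Suc k)) x - f (r k) x)) \<le> sqrt ((1 / 4) ^ k)"
        using K[OF rK(2) rK(1)] by (intro real_sqrt_le_mono less_imp_le)
      also have "sqrt ((1 / 4) ^ k) = (1 / 2 :: real) ^ k" by (simp add: real_sqrt_power real_sqrt_divide)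
      finally show ?thesis unfolding c_def
        by (intro order_trans[OF L2_imp_integrable(2)[OF L2_diff[OF f f]]] mult_left_mono) auto
    qed
    show "summable c" unfolding c_def by (intro summable_mult summable_geometric) simp
  qed
  then have conv: "AE x in M. (\<lambda>k. f (r k) x) \<longlonglongrightarrow> lim (\<lambda>k. f (r k) x)"
  proof eventually_elim
    case (elim x)
    then have "summable (\<lambda>k. f (r (Suc k)) x - f (r k) x)" by (rule summable_norm_cancel)
    then have "convergent (\<lambda>n. \<Sum>k<n. f (r (Suc k)) x - f (r k) x)" by (simp add: summable_iff_convergent)
    then have "convergent (\<lambda>n. f (r n) x - f (r 0) x)" using sum_lessThan_telescope[of "\<lambda>k. f (r k) x"] by simp
    then have "convergent (\<lambda>n. f (r n) x)" using convergent_diff_const_right_iff by blast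
    then show ?case by (simp add: convergent_LIMSEQ_iff)
  qed
  define F where "F x = lim (\<lambda>k. f (r k) x)" for x
  have Fm [measurable]: "F \<in> borel_measurable M" unfolding F_def by (rule borel_measurable_lim_metric) measurable
  \<comment> \<open>Fatou's lemma along the subsequence, with the first index fixed, carries the
    Cauchy bound over to the limit.\<close>
  have bound: "integrable M (\<lambda>x. (norm (f i x - F x))\<^sup>2)" "(\<integral>x. (norm (f i x - F x))\<^sup>2 \<partial>M) \<le> \<epsilon>"
    if i: "\<And>j. j \<ge> L \<Longrightarrow> N2 M (\<lambda>x. f i x - f j x) \<le> \<epsilon>" for i L \<epsilon>
  proof -
    have g: "integrable M (\<lambda>x. (norm (f i x - f (r k) x))\<^sup>2)" for k by (rule L2_D(2)[OF L2_diff[OF f f]])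
    have "AE x in M. (\<lambda>k. (norm (f i x - f (r k) x))\<^sup>2) \<longlonglongrightarrow> (norm (f i x - F x))\<^sup>2"
      using conv by eventually_elim (auto intro!: tendsto_intros simp: F_def)
    moreover have "\<forall>\<^sub>F k in sequentially. (\<integral>x. (norm (f i x - f (r k) x))\<^sup>2 \<partial>M) \<le> \<epsilon>"
      using eventually_ge_at_top[of L]
    proof eventually_elim
      case (elim k)
      show ?case using i[OF order_trans[OF elim rk]] by (simp add: N2_def)
    qed
    ultimately show "integrable M (\<lambda>x. (norm (f i x - F x))\<^sup>2)" "(\<integral>x. (norm (f i x - F x))\<^sup>2 \<partial>M) \<le> \<epsilon>"
      using integral_Fatou[of M "\<lambda>k x. (norm (f i x - f (r k) x))\<^sup>2" "\<lambda>x. (norm (f i x - F x))\<^sup>2" \<epsilon>] g by auto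
  qed
  obtain L where "\<And>j. j \<ge> L \<Longrightarrow> N2 M (\<lambda>x. f L x - f j x) \<le> 1" using Cauchy[of 1] by (auto intro: less_imp_le)
  then have "(\<lambda>x. f L x - F x) \<in> L2 M" using bound(1)[of L L 1] by (simp add: L2_def)
  from L2_diff[OF f[of L] this] have F: "F \<in> L2 M" by simp
  have "(\<lambda>k. N2 M (\<lambda>x. f k x - F x)) \<longlonglongrightarrow> 0"
  proof (rule LIMSEQ_I)
    fix e :: real assume e: "0 < e"
    obtain L where L: "\<And>i j. i \<ge> L \<Longrightarrow> j \<ge> L \<Longrightarrow> N2 M (\<lambda>x. f i x - f j x) < e / 2" using Cauchy[of "e / 2"] e by auto
    have "N2 M (\<lambda>x. f k x - F x) \<le> e / 2" if "k \<ge> L" for k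
      using bound(2)[of L k "e / 2"] L[OF that] by (simp add: N2_def less_imp_le)
    then show "\<exists>no. \<forall>n\<ge>no. norm (N2 M (\<lambda>x. f n x - F x) - 0) < e" using e by (intro exI[of _ L]) fastforce
  qed
  then show ?thesis using F by blast
qed

text \<open>On a finite measure space convergence in L2 implies convergence in L1, from which a
  subsequence converging almost everywhere can be extracted.\<close>

lemma (in finite_measure) L2_tendsto_AE_subseq:
  fixes f :: "nat \<Rightarrow> 'a \<Rightarrow> 'b::euclidean_space"
  assumes f: "\<And>k. f k \<in> L2 M" "F \<in> L2 M" and lim: "(\<lambda>k. N2 M (\<lambda>x. f k x - F x)) \<longlonglongrightarrow> 0"
  shows "\<exists>r::nat\<Rightarrow>nat. strict_mono r \<and> (AE x in M. (\<lambda>k. f (r k) x) \<longlonglongrightarrow> F x)"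
proof -
  have "(\<lambda>k. \<integral>x. norm (f k x - F x) \<partial>M) \<longlonglongrightarrow> 0"
  proof (rule Lim_null_comparison[OF always_eventually])
    show "\<forall>k. norm (\<integral>x. norm (f k x - F x) \<partial>M) \<le> sqrt (measure M (space M)) * sqrt (N2 M (\<lambda>x. f k x - F x))"
      using L2_imp_integrable(2)[OF L2_diff[OF f]] by simp
    have "(\<lambda>k. sqrt (measure M (space M)) * sqrt (N2 M (\<lambda>x. f k x - F x))) \<longlonglongrightarrow> sqrt (measure M (space M)) * sqrt 0"
      by (intro tendsto_intros lim)
    then show "(\<lambda>k. sqrt (measure M (space M)) * sqrt (N2 M (\<lambda>x. f k x - F x))) \<longlonglongrightarrow> 0" by simp
  qed
  from tendsto_L1_AE_subseq[OF _ this] L2_imp_integrable(1)[OF L2_diff[OF f]]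
  obtain r :: "nat \<Rightarrow> nat" where r: "strict_mono r" "AE x in M. (\<lambda>k. f (r k) x - F x) \<longlonglongrightarrow> 0" by blast
  from r(2) have "AE x in M. (\<lambda>k. f (r k) x) \<longlonglongrightarrow> F x" by eventually_elim (rule LIM_zero_cancel)
  then show ?thesis using r(1) by blast
qed

section \<open>Lebesgue spaces with a real exponent\<close>

definition Lq :: "'a measure \<Rightarrow> real \<Rightarrow> ('a \<Rightarrow> real) set" where
  "Lq M q = {u \<in> borel_measurable M. integrable M (\<lambda>x. \<bar>u x\<bar> powr q)}"

definition Lqn :: "'a measure \<Rightarrow> real \<Rightarrow> ('a \<Rightarrow> real) \<Rightarrow> real" where
  "Lqn M q u = (\<integral>x. \<bar>u x\<bar> powr q \<partial>M) powr (1 / q)"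

lemma Lq_D: "u \<in> Lq M q \<Longrightarrow> u \<in> borel_measurable M" "u \<in> Lq M q \<Longrightarrow> integrable M (\<lambda>x. \<bar>u x\<bar> powr q)"
  by (auto simp: Lq_def)

lemma Lqn_nonneg [simp]: "0 \<le> Lqn M q u" by (simp add: Lqn_def)

lemma Lqn_powr: "0 < q \<Longrightarrow> Lqn M q u powr q = (\<integral>x. \<bar>u x\<bar> powr q \<partial>M)"
  by (simp add: Lqn_def powr_powr)

lemma Lqn_scale: "0 < q \<Longrightarrow> Lqn M q (\<lambda>x. c * u x) = \<bar>c\<bar> * Lqn M q u"
  by (simp add: Lqn_def abs_mult powr_mult powr_powr)

lemma Lq_add:
  assumes q: "0 < q" and "u \<in> Lq M q" "v \<in> Lq M q"
  shows "(\<lambda>x. u x + v x) \<in> Lq M q"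
proof -
  note [measurable] = Lq_D(1)[OF assms(2)] Lq_D(1)[OF assms(3)]
  have i: "integrable M (\<lambda>x. 2 powr q * (\<bar>u x\<bar> powr q + \<bar>v x\<bar> powr q))" using assms by (auto simp: Lq_def)
  have "integrable M (\<lambda>x. \<bar>u x + v x\<bar> powr q)"
  proof (rule Bochner_Integration.integrable_bound[OF i])
    show "AE x in M. norm (\<bar>u x + v x\<bar> powr q) \<le> norm (2 powr q * (\<bar>u x\<bar> powr q + \<bar>v x\<bar> powr q))"
    proof (rule AE_I2)
      fix x
      have "\<bar>u x + v x\<bar> powr q \<le> (\<bar>u x\<bar> + \<bar>v x\<bar>) powr q" using q by (intro powr_mono2) auto
      also have "\<dots> \<le> 2 powr q * (\<bar>u x\<bar> powr q + \<bar>v x\<bar> powr q)" using q by (intro powr_add_le) auto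
      finally show "norm (\<bar>u x + v x\<bar> powr q) \<le> norm (2 powr q * (\<bar>u x\<bar> powr q + \<bar>v x\<bar> powr q))" by simp
    qed
  qed measurable
  then show ?thesis by (simp add: Lq_def)
qed

lemma Lq_scale: "u \<in> Lq M q \<Longrightarrow> (\<lambda>x. c * u x) \<in> Lq M q"
  by (auto simp: Lq_def abs_mult powr_mult)

text \<open>The factor 2 comes from Young's inequality for the normalised functions.\<close>

lemma Lq_Hoelder:
  assumes u: "u \<in> Lq M q" and v: "v \<in> Lq M q" and ij: "0 < i" "0 < j" "i + j = q"
  shows "integrable M (\<lambda>x. \<bar>u x\<bar> powr i * \<bar>v x\<bar> powr j)"
    and "(\<integral>x. \<bar>u x\<bar> powr i * \<bar>v x\<bar> powr j \<partial>M) \<le> 2 * (Lqn M q u powr i * Lqn M q v powr j)"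
proof -
  have q: "0 < q" using ij by simp
  note [measurable] = Lq_D(1)[OF u] Lq_D(1)[OF v]
  have young: "\<bar>a\<bar> powr i * \<bar>b\<bar> powr j \<le> \<bar>a\<bar> powr q + \<bar>b\<bar> powr q" for a b :: real
    using powr_young[of "\<bar>a\<bar>" "\<bar>b\<bar>" i j] ij by simp
  have int: "integrable M (\<lambda>x. \<bar>f x\<bar> powr i * \<bar>g x\<bar> powr j)" if "f \<in> Lq M q" "g \<in> Lq M q" for f g
  proof (rule Bochner_Integration.integrable_bound)
    show "integrable M (\<lambda>x. \<bar>f x\<bar> powr q + \<bar>g x\<bar> powr q)" using that by (auto simp: Lq_def)
  qed (use that young in \<open>auto simp: Lq_def\<close>)
  show "integrable M (\<lambda>x. \<bar>u x\<bar> powr i * \<bar>v x\<bar> powr j)" by (rule int[OF u v])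
  let ?A = "Lqn M q u" and ?B = "Lqn M q v"
  have AE0: "AE x in M. f x = 0" if f: "f \<in> Lq M q" "Lqn M q f = 0" for f
  proof -
    have "(\<integral>x. \<bar>f x\<bar> powr q \<partial>M) = 0" using f(2) by (simp add: Lqn_def)
    then have "AE x in M. \<bar>f x\<bar> powr q = 0" using integral_nonneg_eq_0_iff_AE[OF Lq_D(2)[OF f(1)]] by simp
    then show ?thesis by simp
  qed
  show "(\<integral>x. \<bar>u x\<bar> powr i * \<bar>v x\<bar> powr j \<partial>M) \<le> 2 * (?A powr i * ?B powr j)"
  proof (cases "?A = 0 \<or> ?B = 0")
    case True
    then have "AE x in M. \<bar>u x\<bar> powr i * \<bar>v x\<bar> powr j = 0"
      using AE0[OF u] AE0[OF v] by (auto elim!: eventually_mono)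
    then have "(\<integral>x. \<bar>u x\<bar> powr i * \<bar>v x\<bar> powr j \<partial>M) = 0" by (rule integral_eq_zero_AE)
    then show ?thesis by simp
  next
    case False
    then have A: "?A > 0" and B: "?B > 0" by (simp_all add: less_le)
    define u' where "u' x = (1 / ?A) * u x" for x
    define v' where "v' x = (1 / ?B) * v x" for x
    have u': "u' \<in> Lq M q" "v' \<in> Lq M q" unfolding u'_def v'_def by (rule Lq_scale[OF u] Lq_scale[OF v])+
    have one: "Lqn M q u' = 1" "Lqn M q v' = 1"
      unfolding u'_def v'_def Lqn_scale[OF q] using A B by auto
    have "(\<integral>x. \<bar>u' x\<bar> powr i * \<bar>v' x\<bar> powr j \<partial>M) \<le> (\<integral>x. \<bar>u' x\<bar> powr q + \<bar>v' x\<bar> powr q \<partial>M)"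
      using u' int young by (intro integral_mono) (auto simp: Lq_D)
    also have "\<dots> = 2" using u' Lqn_powr[OF q, of M u'] Lqn_powr[OF q, of M v'] one by (simp add: Lq_D)
    finally have le: "(\<integral>x. \<bar>u' x\<bar> powr i * \<bar>v' x\<bar> powr j \<partial>M) \<le> 2" .
    have "\<bar>u x\<bar> powr i * \<bar>v x\<bar> powr j = (?A powr i * ?B powr j) * (\<bar>u' x\<bar> powr i * \<bar>v' x\<bar> powr j)" for x
    proof -
      have "\<bar>u x\<bar> = ?A * \<bar>u' x\<bar>" "\<bar>v x\<bar> = ?B * \<bar>v' x\<bar>" using A B by (simp_all add: u'_def v'_def abs_mult)
      then show ?thesis using A B by (simp add: powr_mult)
    qed
    then have "(\<integral>x. \<bar>u x\<bar> powr i * \<bar>v x\<bar> powr j \<partial>M) = (?A powr i * ?B powr j) * (\<integral>x. \<bar>u' x\<bar> powr i * \<bar>v' x\<bar> powr j \<partial>M)" by simp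
    also have "\<dots> \<le> (?A powr i * ?B powr j) * 2" using le by (intro mult_left_mono) auto
    finally show ?thesis by simp
  qed
qed

text \<open>After normalising the \<open>s\<close>-norm to 1, integrate the elementary bound of the
  \<open>q\<close>-th power by 1 plus the \<open>s\<close>-th power; this is the origin of the
  constant \<open>measure M (space M) + 1\<close>.\<close>

lemma (in finite_measure) Lq_mono:
  assumes u: "u \<in> Lq M s" and q: "0 < q" "q \<le> s"
  shows "u \<in> Lq M q" "Lqn M q u \<le> (measure M (space M) + 1) powr (1 / q) * Lqn M s u"
proof -
  note [measurable] = Lq_D(1)[OF u]
  have le: "\<bar>a\<bar> powr q \<le> 1 + \<bar>a\<bar> powr s" for a :: real
  proof (cases "\<bar>a\<bar> \<le> 1")
    case True
    then have "\<bar>a\<bar> powr q \<le> 1" using q powr_le1 by auto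
    then show ?thesis by (smt (verit) powr_ge_zero)
  next
    case False
    then have "\<bar>a\<bar> powr q \<le> \<bar>a\<bar> powr s" using q by (intro powr_mono) auto
    then show ?thesis by simp
  qed
  have mono: "f \<in> Lq M q" if "f \<in> Lq M s" for f
  proof -
    have i: "integrable M (\<lambda>x. 1 + \<bar>f x\<bar> powr s)" using that by (auto simp: Lq_def)
    have "integrable M (\<lambda>x. \<bar>f x\<bar> powr q)"
      by (rule Bochner_Integration.integrable_bound[OF i]) (use that le in \<open>auto simp: Lq_def\<close>)
    then show ?thesis using that by (auto simp: Lq_def)
  qed
  show uq: "u \<in> Lq M q" by (rule mono[OF u])
  have s: "0 < s" using q by simp
  show "Lqn M q u \<le> (measure M (space M) + 1) powr (1 / q) * Lqn M s u"
  proof (cases "Lqn M s u = 0")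
    case True
    then have "(\<integral>x. \<bar>u x\<bar> powr s \<partial>M) = 0" by (simp add: Lqn_def)
    then have "AE x in M. \<bar>u x\<bar> powr s = 0" using integral_nonneg_eq_0_iff_AE[OF Lq_D(2)[OF u]] by simp
    then have "AE x in M. \<bar>u x\<bar> powr q = 0" by simp
    then have "(\<integral>x. \<bar>u x\<bar> powr q \<partial>M) = 0" by (rule integral_eq_zero_AE)
    then show ?thesis by (simp add: Lqn_def)
  next
    case False
    then have A: "Lqn M s u > 0" by (simp add: less_le)
    define v where "v x = (1 / Lqn M s u) * u x" for x
    have v: "v \<in> Lq M s" unfolding v_def by (rule Lq_scale[OF u])
    have one: "Lqn M s v = 1" unfolding v_def Lqn_scale[OF s] using A by simp
    have "(\<integral>x. \<bar>v x\<bar> powr q \<partial>M) \<le> (\<integral>x. 1 + \<bar>v x\<bar> powr s \<partial>M)"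
      using v mono[OF v] le by (intro integral_mono) (auto simp: Lq_D)
    also have "\<dots> = measure M (space M) + 1" using v Lqn_powr[OF s, of M v] one by (simp add: Lq_D)
    finally have "Lqn M q v \<le> (measure M (space M) + 1) powr (1 / q)"
      unfolding Lqn_def using q by (intro powr_mono2) auto
    moreover have "Lqn M q v = Lqn M q u / Lqn M s u" unfolding v_def Lqn_scale[OF q(1)] using A by simp
    ultimately show ?thesis using A by (simp add: divide_le_eq)
  qed
qed

section \<open>Compactness of test functions\<close>

lemma grad_measurable [measurable (raw)]: "\<phi> \<in> test_functions \<Omega> \<Longrightarrow> grad \<phi> \<in> borel_measurable borel"
  using continuous_grad by (rule borel_measurable_continuous_onI)

lemma grad_norm_integrable:
  assumes "\<phi> \<in> test_functions \<Omega>"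
  shows "integrable lborel (\<lambda>x. norm (grad \<phi> x))"
proof (rule compact_support_integrable)
  show "bounded {x. norm (grad \<phi> x) \<noteq> 0}"
    by (rule bounded_subset[OF bounded_closure[OF test_functions_bounded_support[OF assms]]])
      (auto dest: grad_support)
qed (intro continuous_intros continuous_grad[OF assms])

text \<open>The increment is the integral of the derivative along the segment; exchanging the
  integrals and translating back makes the inner one independent of the parameter.\<close>

lemma test_function_translate:
  fixes \<phi> :: "real^'n \<Rightarrow> real"
  assumes \<phi>: "\<phi> \<in> test_functions \<Omega>"
  shows "(\<integral>\<^sup>+x. ennreal \<bar>\<phi> (x + h) - \<phi> x\<bar> \<partial>lborel) \<le> ennreal (norm h * (\<integral>x. norm (grad \<phi> x) \<partial>lborel))"
proof -
  note [measurable] = grad_measurable[OF \<phi>] test_functions_D(4)[OF \<phi>]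
  let ?F = "\<lambda>x t. ennreal (norm (grad \<phi> (x + t *\<^sub>R h)) * norm h) * indicator {0..1::real} t"
  have point: "ennreal \<bar>\<phi> (x + h) - \<phi> x\<bar> \<le> (\<integral>\<^sup>+t. ?F x t \<partial>lborel)" for x
  proof -
    define u' where "u' t = grad \<phi> (x + t *\<^sub>R h) \<bullet> h" for t
    have line: "((\<lambda>t. \<phi> (x + t *\<^sub>R h)) has_real_derivative u' t) (at t)" for t
      unfolding u'_def by (rule test_functions_line_DERIV[OF \<phi>])
    have "continuous_on UNIV u'" unfolding u'_def
      by (intro continuous_intros continuous_on_compose2[OF continuous_grad[OF \<phi>]]) auto
    then have cu': "isCont u' t" for t by (simp add: continuous_on_eq_continuous_at)
    have "(\<integral>t. u' t * indicator {0..1} t \<partial>lborel) = \<phi> (x + 1 *\<^sub>R h) - \<phi> (x + 0 *\<^sub>R h)"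
      by (rule integral_FTC_Icc_real) (use line cu' in auto)
    then have "ennreal \<bar>\<phi> (x + h) - \<phi> x\<bar> = ennreal (norm (\<integral>t. u' t * indicator {0..1} t \<partial>lborel))" by simp
    also have "\<dots> \<le> (\<integral>\<^sup>+t. ennreal (norm (u' t * indicator {0..1} t)) \<partial>lborel)"
      by (rule integral_norm_bound_ennreal[OF borel_integrable_atLeastAtMost]) (rule cu')
    also have "\<dots> \<le> (\<integral>\<^sup>+t. ?F x t \<partial>lborel)"
    proof (rule nn_integral_mono)
      fix t :: real
      have "\<bar>u' t\<bar> \<le> norm (grad \<phi> (x + t *\<^sub>R h)) * norm h" unfolding u'_def by (rule Cauchy_Schwarz_ineq2)
      then show "ennreal (norm (u' t * indicator {0..1} t)) \<le> ?F x t"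
        by (auto simp: indicator_def intro: ennreal_leI)
    qed
    finally show ?thesis .
  qed
  have "(\<integral>\<^sup>+x. ennreal \<bar>\<phi> (x + h) - \<phi> x\<bar> \<partial>lborel) \<le> (\<integral>\<^sup>+x. \<integral>\<^sup>+t. ?F x t \<partial>lborel \<partial>lborel)"
    by (intro nn_integral_mono point)
  also have "\<dots> = (\<integral>\<^sup>+t. \<integral>\<^sup>+x. ?F x t \<partial>lborel \<partial>lborel)"
    by (rule lborel_pair.Fubini'[symmetric]) measurable
  also have "\<dots> = (\<integral>\<^sup>+t. ennreal (norm h * (\<integral>x. norm (grad \<phi> x) \<partial>lborel)) * indicator {0..1::real} t \<partial>lborel)"
  proof (rule nn_integral_cong)
    fix t :: real
    have "(\<integral>\<^sup>+x. ?F x t \<partial>lborel) = (\<integral>\<^sup>+x. ennreal (norm (grad \<phi> (x + t *\<^sub>R h)) * norm h) \<partial>lborel) * indicator {0..1} t"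
      by (rule nn_integral_multc) measurable
    also have "(\<integral>\<^sup>+x. ennreal (norm (grad \<phi> (x + t *\<^sub>R h)) * norm h) \<partial>lborel)
        = ennreal (\<integral>x. norm (grad \<phi> (x + t *\<^sub>R h)) * norm h \<partial>lborel)"
      by (rule nn_integral_eq_integral)
        (auto intro: lborel_integrable_translate[OF grad_norm_integrable[OF \<phi>]])
    also have "(\<integral>x. norm (grad \<phi> (x + t *\<^sub>R h)) * norm h \<partial>lborel) = norm h * (\<integral>x. norm (grad \<phi> x) \<partial>lborel)"
      by (simp add: lborel_integral_translate[of "\<lambda>x. norm (grad \<phi> x)"] mult.commute)
    finally show "(\<integral>\<^sup>+x. ?F x t \<partial>lborel) = ennreal (norm h * (\<integral>x. norm (grad \<phi> x) \<partial>lborel)) * indicator {0..1} t" .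
  qed
  also have "\<dots> = ennreal (norm h * (\<integral>x. norm (grad \<phi> x) \<partial>lborel))"
    by (simp add: nn_integral_cmult_indicator)
  finally show ?thesis .
qed

text \<open>Convolution with the indicator of a ball, without normalisation. It serves as the
  mollifier in Rellich's theorem, where Lipschitz continuity of the averages is enough
  regularity.\<close>

definition ball_integral :: "real \<Rightarrow> (real^'n \<Rightarrow> real) \<Rightarrow> real^'n \<Rightarrow> real" where
  "ball_integral \<epsilon> \<phi> x = (\<integral>y. indicator (ball 0 \<epsilon>) y * \<phi> (x + y) \<partial>lborel)"

lemma integrable_ball_translate:
  fixes \<phi> :: "real^'n \<Rightarrow> real"
  assumes "\<phi> \<in> test_functions \<Omega>"
  shows "integrable lborel (\<lambda>y. indicator (ball 0 \<epsilon>) y * \<phi> (x + y))"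
proof -
  have "integrable lborel (\<lambda>y. \<phi> (y + x))" by (rule lborel_integrable_translate[OF test_functions_integrable[OF assms]])
  from integrable_mult_indicator[OF _ this, of "ball 0 \<epsilon>"] show ?thesis by (simp add: add.commute)
qed

lemma ball_integral_bound:
  fixes \<phi> :: "real^'n \<Rightarrow> real"
  assumes \<phi>: "\<phi> \<in> test_functions \<Omega>"
  shows "\<bar>ball_integral \<epsilon> \<phi> x\<bar> \<le> (\<integral>x. \<bar>\<phi> x\<bar> \<partial>lborel)"
proof -
  have i: "integrable lborel (\<lambda>y. \<bar>\<phi> (y + x)\<bar>)"
    using lborel_integrable_translate[OF test_functions_integrable[OF \<phi>]] by simp
  have "\<bar>ball_integral \<epsilon> \<phi> x\<bar> \<le> (\<integral>y. \<bar>\<phi> (y + x)\<bar> \<partial>lborel)"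
    unfolding ball_integral_def
    by (rule order_trans[OF integral_abs_bound])
      (intro integral_mono integrable_abs integrable_ball_translate[OF \<phi>] i, auto simp: indicator_def add.commute)
  also have "\<dots> = (\<integral>x. \<bar>\<phi> x\<bar> \<partial>lborel)"
    using test_functions_D(4)[OF \<phi>] by (intro lborel_integral_translate) measurable
  finally show ?thesis .
qed

lemma ball_integral_Lipschitz:
  fixes \<phi> :: "real^'n \<Rightarrow> real"
  assumes \<phi>: "\<phi> \<in> test_functions \<Omega>"
  shows "\<bar>ball_integral \<epsilon> \<phi> x - ball_integral \<epsilon> \<phi> x'\<bar> \<le> norm (x - x') * (\<integral>x. norm (grad \<phi> x) \<partial>lborel)"
proof -
  note [measurable] = test_functions_D(4)[OF \<phi>]
  have tr: "integrable lborel (\<lambda>y. \<phi> (y + z))" for z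
    by (rule lborel_integrable_translate[OF test_functions_integrable[OF \<phi>]])
  have i: "integrable lborel (\<lambda>y. \<bar>\<phi> (y + x) - \<phi> (y + x')\<bar>)" using tr by simp
  have "ball_integral \<epsilon> \<phi> x - ball_integral \<epsilon> \<phi> x' = (\<integral>y. indicator (ball 0 \<epsilon>) y * \<phi> (x + y) - indicator (ball 0 \<epsilon>) y * \<phi> (x' + y) \<partial>lborel)"
    unfolding ball_integral_def by (rule Bochner_Integration.integral_diff[symmetric]) (rule integrable_ball_translate[OF \<phi>])+
  also have "\<bar>\<dots>\<bar> \<le> (\<integral>y. \<bar>\<phi> (y + x) - \<phi> (y + x')\<bar> \<partial>lborel)"
    by (rule order_trans[OF integral_abs_bound])
      (intro integral_mono integrable_abs Bochner_Integration.integrable_diff integrable_ball_translate[OF \<phi>] i, auto simp: indicator_def add.commute)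
  also have "\<dots> = (\<integral>y. \<bar>\<phi> (y + (x - x')) - \<phi> y\<bar> \<partial>lborel)"
    using lborel_integral_translate[of "\<lambda>y. \<bar>\<phi> (y + (x - x')) - \<phi> y\<bar>" x'] by (simp add: algebra_simps)
  also have "\<dots> \<le> norm (x - x') * (\<integral>x. norm (grad \<phi> x) \<partial>lborel)"
  proof -
    have "ennreal (\<integral>y. \<bar>\<phi> (y + (x - x')) - \<phi> y\<bar> \<partial>lborel) = (\<integral>\<^sup>+y. ennreal \<bar>\<phi> (y + (x - x')) - \<phi> y\<bar> \<partial>lborel)"
      using tr test_functions_integrable[OF \<phi>] by (intro nn_integral_eq_integral[symmetric]) auto
    also have "\<dots> \<le> ennreal (norm (x - x') * (\<integral>x. norm (grad \<phi> x) \<partial>lborel))" by (rule test_function_translate[OF \<phi>])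
    finally show ?thesis by (subst (asm) ennreal_le_iff) auto
  qed
  finally show ?thesis .
qed

text \<open>The difference is an integral of translation increments over shifts of length below
  \<open>\<epsilon>\<close>; Tonelli's theorem reduces it to
  \<open>test_function_translate\<close>.\<close>

lemma ball_integral_close:
  fixes \<phi> :: "real^'n \<Rightarrow> real"
  assumes \<phi>: "\<phi> \<in> test_functions \<Omega>" and \<epsilon>: "0 < \<epsilon>"
  shows "(\<integral>\<^sup>+x. ennreal \<bar>ball_integral \<epsilon> \<phi> x - measure lborel (ball 0 \<epsilon> :: (real^'n) set) * \<phi> x\<bar> \<partial>lborel)
    \<le> ennreal (measure lborel (ball 0 \<epsilon> :: (real^'n) set) * (\<epsilon> * (\<integral>x. norm (grad \<phi> x) \<partial>lborel)))"
proof -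
  note [measurable] = test_functions_D(4)[OF \<phi>]
  let ?B = "ball 0 \<epsilon> :: (real^'n) set" and ?M = "\<integral>x. norm (grad \<phi> x) \<partial>lborel"
  have [measurable]: "?B \<in> sets borel" by simp
  have fin: "emeasure lborel ?B < \<infinity>" by (rule emeasure_lborel_ball_finite)
  have iB: "integrable lborel (\<lambda>y. indicator ?B y * c)" for c :: real
    using fin by (intro integrable_mult_left integrable_real_indicator) auto
  have "(\<integral>\<^sup>+x. ennreal \<bar>ball_integral \<epsilon> \<phi> x - measure lborel ?B * \<phi> x\<bar> \<partial>lborel)
     \<le> (\<integral>\<^sup>+x. \<integral>\<^sup>+y. indicator ?B y * ennreal \<bar>\<phi> (x + y) - \<phi> x\<bar> \<partial>lborel \<partial>lborel)"
  proof (rule nn_integral_mono)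
    fix x
    have "ball_integral \<epsilon> \<phi> x - measure lborel ?B * \<phi> x = (\<integral>y. indicator ?B y * \<phi> (x + y) - indicator ?B y * \<phi> x \<partial>lborel)"
      unfolding ball_integral_def using integrable_ball_translate[OF \<phi>, of \<epsilon> x] iB[of "\<phi> x"] by simp
    also have "ennreal \<bar>\<dots>\<bar> \<le> (\<integral>\<^sup>+y. ennreal (norm (indicator ?B y * \<phi> (x + y) - indicator ?B y * \<phi> x)) \<partial>lborel)"
      using integral_norm_bound_ennreal[OF Bochner_Integration.integrable_diff[OF integrable_ball_translate[OF \<phi>, of \<epsilon> x] iB[of "\<phi> x"]]] by simp
    also have "\<dots> = (\<integral>\<^sup>+y. indicator ?B y * ennreal \<bar>\<phi> (x + y) - \<phi> x\<bar> \<partial>lborel)"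
      by (rule nn_integral_cong) (auto simp: indicator_def)
    finally show "ennreal \<bar>ball_integral \<epsilon> \<phi> x - measure lborel ?B * \<phi> x\<bar> \<le> \<dots>" .
  qed
  also have "\<dots> = (\<integral>\<^sup>+y. \<integral>\<^sup>+x. indicator ?B y * ennreal \<bar>\<phi> (x + y) - \<phi> x\<bar> \<partial>lborel \<partial>lborel)"
    by (rule lborel_pair.Fubini'[symmetric]) measurable
  also have "\<dots> \<le> (\<integral>\<^sup>+y. ennreal (\<epsilon> * ?M) * indicator ?B y \<partial>lborel)"
  proof (rule nn_integral_mono)
    fix y
    have "(\<integral>\<^sup>+x. indicator ?B y * ennreal \<bar>\<phi> (x + y) - \<phi> x\<bar> \<partial>lborel) = indicator ?B y * (\<integral>\<^sup>+x. ennreal \<bar>\<phi> (x + y) - \<phi> x\<bar> \<partial>lborel)"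
      by (rule nn_integral_cmult) measurable
    also have "\<dots> \<le> indicator ?B y * ennreal (\<epsilon> * ?M)"
    proof (cases "y \<in> ?B")
      case True
      then have "norm y * ?M \<le> \<epsilon> * ?M" by (intro mult_right_mono integral_nonneg_AE) auto
      then show ?thesis using order_trans[OF test_function_translate[OF \<phi>] ennreal_leI] True by simp
    qed simp
    finally show "(\<integral>\<^sup>+x. indicator ?B y * ennreal \<bar>\<phi> (x + y) - \<phi> x\<bar> \<partial>lborel) \<le> ennreal (\<epsilon> * ?M) * indicator ?B y"
      by (simp add: mult.commute)
  qed
  also have "\<dots> = ennreal (\<epsilon> * ?M) * emeasure lborel ?B" by (simp add: nn_integral_cmult_indicator)
  also have "\<dots> = ennreal (measure lborel ?B * (\<epsilon> * ?M))"
    using \<epsilon> fin by (simp add: emeasure_eq_ennreal_measure ennreal_mult'[symmetric] mult.commute)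
  finally show ?thesis .
qed

text \<open>Averages over balls of radius \<open>\<epsilon>\<close> are uniformly bounded and
  uniformly Lipschitz, so by Arzela-Ascoli a subsequence of them converges uniformly on a ball
  containing \<open>\<Omega>\<close>. In the final bound \<open>2 * M\<close> pays for replacing two
  functions by their averages, and 1 for the distance of the averages.\<close>

lemma Rellich_L1_step:
  fixes \<phi> :: "nat \<Rightarrow> real^'n \<Rightarrow> real"
  assumes \<phi>: "\<And>k. \<phi> k \<in> test_functions \<Omega>" and \<Omega>: "bounded \<Omega>"
    and M: "\<And>k. (\<integral>x. norm (grad (\<phi> k) x) \<partial>lborel) \<le> M" "\<And>k. (\<integral>x. \<bar>\<phi> k x\<bar> \<partial>lborel) \<le> M" and \<epsilon>: "0 < \<epsilon>"
  shows "\<exists>\<sigma>. strict_mono \<sigma> \<and> (\<exists>K::nat. \<forall>i\<ge>K. \<forall>j\<ge>K. (\<integral>x. \<bar>\<phi> (\<sigma> i) x - \<phi> (\<sigma> j) x\<bar> \<partial>lborel) \<le> \<epsilon> * (2 * M + 1))"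
proof -
  obtain R where "\<forall>x\<in>\<Omega>. norm x \<le> R" using \<Omega> by (auto simp: bounded_iff)
  then have R: "\<Omega> \<subseteq> cball 0 R" by auto
  let ?S = "cball 0 R :: (real^'n) set" and ?B = "ball 0 \<epsilon> :: (real^'n) set"
  define V where "V = measure lborel ?B"
  have V: "0 < V" unfolding V_def using \<epsilon> content_ball_pos[of \<epsilon> "0 :: real^'n"] by (simp add: measure_completion)
  have M0: "0 \<le> M" using M(2)[of 0] by (rule order_trans[rotated]) simp
  let ?A = "\<lambda>k. ball_integral \<epsilon> (\<phi> k)"
  have lip: "norm (?A k x - ?A k y) \<le> norm (x - y) * M" for k x y
    using order_trans[OF ball_integral_Lipschitz[OF \<phi>[of k], of \<epsilon> x y] mult_left_mono[OF M(1)[of k]]] by simp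
  obtain g and \<sigma> :: "nat \<Rightarrow> nat" where \<sigma>: "strict_mono \<sigma>"
    and g: "\<And>e. 0 < e \<Longrightarrow> \<exists>N. \<forall>n x. n \<ge> N \<and> x \<in> ?S \<longrightarrow> norm (?A (\<sigma> n) x - g x) < e"
  proof (rule Arzela_Ascoli[of ?S ?A M])
    show "norm (?A k x) \<le> M" for k x using order_trans[OF ball_integral_bound[OF \<phi>] M(2)] by simp
    show "\<exists>d. 0 < d \<and> (\<forall>n y. y \<in> ?S \<and> norm (x - y) < d \<longrightarrow> norm (?A n x - ?A n y) < e)" if "0 < e" for x e
    proof (intro exI conjI allI impI)
      show "0 < e / (M + 1)" using that M0 by simp
      fix n y assume "y \<in> ?S \<and> norm (x - y) < e / (M + 1)"
      then have d: "norm (x - y) * (M + 1) < e" using M0 by (simp add: pos_less_divide_eq)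
      have "norm (?A n x - ?A n y) \<le> norm (x - y) * (M + 1)"
        by (rule order_trans[OF lip]) (intro mult_left_mono, auto)
      then show "norm (?A n x - ?A n y) < e" using d by linarith
    qed
  qed (use that in auto)
  have fin: "emeasure lborel ?S < \<infinity>" by (rule emeasure_lborel_cball_finite)
  define W where "W = measure lborel ?S"
  have W0: "0 \<le> W" by (simp add: W_def)
  \<comment> \<open>Two errors of this size, integrated over a set of measure \<open>W\<close>,
    amount to at most \<open>V * \<epsilon>\<close>.\<close>
  obtain N where N: "\<And>n x. n \<ge> N \<Longrightarrow> x \<in> ?S \<Longrightarrow> norm (?A (\<sigma> n) x - g x) < V * \<epsilon> / (2 * (W + 1))"
    using g[of "V * \<epsilon> / (2 * (W + 1))"] V \<epsilon> W0 by auto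
  have "(\<integral>x. \<bar>\<phi> (\<sigma> i) x - \<phi> (\<sigma> j) x\<bar> \<partial>lborel) \<le> \<epsilon> * (2 * M + 1)" if ij: "N \<le> i" "N \<le> j" for i j
  proof -
    let ?f = "\<phi> (\<sigma> i)" and ?h = "\<phi> (\<sigma> j)"
    note [measurable] = test_functions_D(4)[OF \<phi>]
    have int: "integrable lborel (\<lambda>x. \<bar>?f x - ?h x\<bar>)" using test_functions_integrable[OF \<phi>] by simp
    have Am [measurable]: "?A k \<in> borel_measurable borel" for k
    proof (rule borel_measurable_continuous_onI, rule continuous_onI)
      fix x :: "real^'n" and e :: real assume "0 < e"
      show "\<exists>d>0. \<forall>x'\<in>UNIV. dist x' x < d \<longrightarrow> dist (?A k x') (?A k x) \<le> e"
      proof (intro exI[of _ "e / (M + 1)"] conjI ballI impI)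
        show "0 < e / (M + 1)" using \<open>0 < e\<close> M0 by simp
        fix x' assume "dist x' x < e / (M + 1)"
        then have d: "norm (x' - x) * (M + 1) < e" using M0 by (simp add: pos_less_divide_eq dist_norm)
        have "norm (?A k x' - ?A k x) \<le> norm (x' - x) * (M + 1)"
          by (rule order_trans[OF lip]) (intro mult_left_mono, auto)
        then show "dist (?A k x') (?A k x) \<le> e" using d by (simp add: dist_norm)
      qed
    qed
    have point: "ennreal (V * \<bar>?f x - ?h x\<bar>) \<le> ennreal \<bar>?A (\<sigma> i) x - V * ?f x\<bar> + ennreal \<bar>?A (\<sigma> j) x - V * ?h x\<bar>
        + ennreal (V * \<epsilon> / (W + 1)) * indicator ?S x" for x
    proof (cases "x \<in> ?S")
      case True
      have half: "y / (2 * w) + y / (2 * w) = y / w" for y w :: real by simp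
      have "V * \<bar>?f x - ?h x\<bar> = \<bar>V * ?f x - V * ?h x\<bar>" using V by (simp add: right_diff_distrib[symmetric] abs_mult)
      also have "\<dots> \<le> \<bar>?A (\<sigma> i) x - V * ?f x\<bar> + \<bar>?A (\<sigma> j) x - V * ?h x\<bar> + V * \<epsilon> / (W + 1)"
      proof -
        have tri: "\<bar>F - H\<bar> \<le> \<bar>a - F\<bar> + \<bar>b - H\<bar> + (e + e)" if "\<bar>a - c\<bar> < e" "\<bar>b - c\<bar> < e" for F H a b c e :: real
          using that by linarith
        show ?thesis unfolding half[of "V * \<epsilon>" "W + 1", symmetric]
          by (rule tri[OF N[OF ij(1) True, unfolded real_norm_def] N[OF ij(2) True, unfolded real_norm_def]])
      qed
      finally have "ennreal (V * \<bar>?f x - ?h x\<bar>) \<le> ennreal (\<bar>?A (\<sigma> i) x - V * ?f x\<bar> + \<bar>?A (\<sigma> j) x - V * ?h x\<bar> + V * \<epsilon> / (W + 1))"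
        by (rule ennreal_leI)
      then show ?thesis using True V \<epsilon> W0 by (simp add: ennreal_plus)
    next
      case False
      then have "x \<notin> \<Omega>" using R by blast
      then have "?f x = 0" "?h x = 0" using test_functions_D(6)[OF \<phi>] by auto
      then show ?thesis by simp
    qed
    have close: "(\<integral>\<^sup>+x. ennreal \<bar>?A k x - V * \<phi> k x\<bar> \<partial>lborel) \<le> ennreal (V * (\<epsilon> * M))" for k
      unfolding V_def by (rule order_trans[OF ball_integral_close[OF \<phi> \<epsilon>]])
        (intro ennreal_leI mult_left_mono M(1), use \<epsilon> in auto)
    have "ennreal (V * (\<integral>x. \<bar>?f x - ?h x\<bar> \<partial>lborel)) = (\<integral>\<^sup>+x. ennreal (V * \<bar>?f x - ?h x\<bar>) \<partial>lborel)"
      using int V by (subst nn_integral_eq_integral) auto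
    also have "\<dots> \<le> (\<integral>\<^sup>+x. ennreal \<bar>?A (\<sigma> i) x - V * ?f x\<bar> + ennreal \<bar>?A (\<sigma> j) x - V * ?h x\<bar>
        + ennreal (V * \<epsilon> / (W + 1)) * indicator ?S x \<partial>lborel)"
      by (intro nn_integral_mono point)
    also have "\<dots> = (\<integral>\<^sup>+x. ennreal \<bar>?A (\<sigma> i) x - V * ?f x\<bar> \<partial>lborel) + (\<integral>\<^sup>+x. ennreal \<bar>?A (\<sigma> j) x - V * ?h x\<bar> \<partial>lborel)
        + (\<integral>\<^sup>+x. ennreal (V * \<epsilon> / (W + 1)) * indicator ?S x \<partial>lborel)"
    proof -
      have "(\<lambda>x. ennreal \<bar>?A (\<sigma> i) x - V * ?f x\<bar>) \<in> borel_measurable lborel" "(\<lambda>x. ennreal \<bar>?A (\<sigma> j) x - V * ?h x\<bar>) \<in> borel_measurable lborel"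
        "(\<lambda>x. ennreal (V * \<epsilon> / (W + 1)) * indicator ?S x) \<in> borel_measurable lborel"
        using borel_closed[OF closed_cball, of "0 :: real^'n" R] by measurable
      then show ?thesis by (simp add: nn_integral_add)
    qed
    also have "(\<integral>\<^sup>+x. ennreal (V * \<epsilon> / (W + 1)) * indicator ?S x \<partial>lborel) = ennreal (V * \<epsilon> / (W + 1) * W)"
      using fin V \<epsilon> W0 by (simp add: nn_integral_cmult_indicator emeasure_eq_ennreal_measure ennreal_mult'[symmetric] W_def)
    also have "(\<integral>\<^sup>+x. ennreal \<bar>?A (\<sigma> i) x - V * ?f x\<bar> \<partial>lborel) + (\<integral>\<^sup>+x. ennreal \<bar>?A (\<sigma> j) x - V * ?h x\<bar> \<partial>lborel)
        + ennreal (V * \<epsilon> / (W + 1) * W) \<le> ennreal (V * (\<epsilon> * M)) + ennreal (V * (\<epsilon> * M)) + ennreal (V * \<epsilon> / (W + 1) * W)"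
      by (intro add_mono close order_refl)
    also have "\<dots> = ennreal (V * (\<epsilon> * M) + V * (\<epsilon> * M) + V * \<epsilon> / (W + 1) * W)"
    proof -
      have "ennreal x + ennreal x + ennreal y = ennreal (x + x + y)" if "0 \<le> x" "0 \<le> y" for x y
        using that by (simp only: ennreal_plus add_nonneg_nonneg)
      then show ?thesis using V \<epsilon> M0 W0 by simp
    qed
    finally have "V * (\<integral>x. \<bar>?f x - ?h x\<bar> \<partial>lborel) \<le> V * (\<epsilon> * M) + V * (\<epsilon> * M) + V * \<epsilon> / (W + 1) * W"
      using V \<epsilon> M0 W0 by (subst (asm) ennreal_le_iff) (auto intro!: add_nonneg_nonneg)
    also have "V * \<epsilon> / (W + 1) * W \<le> V * \<epsilon>"
      using V \<epsilon> W0 by (simp add: divide_le_eq mult_left_mono)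
    finally have "V * (\<integral>x. \<bar>?f x - ?h x\<bar> \<partial>lborel) \<le> V * (\<epsilon> * (2 * M + 1))" by (simp add: algebra_simps)
    then show ?thesis using V by simp
  qed
  then show ?thesis using \<sigma> by blast
qed

text \<open>A diagonal sequence over the radii \<open>1 / real (Suc n)\<close>: each radius alone
  only gives a subsequence that is Cauchy up to an error proportional to it.\<close>

theorem Rellich_L1:
  fixes \<phi> :: "nat \<Rightarrow> real^'n \<Rightarrow> real"
  assumes \<phi>: "\<And>k. \<phi> k \<in> test_functions \<Omega>" and \<Omega>: "bounded \<Omega>"
    and M: "\<And>k. (\<integral>x. norm (grad (\<phi> k) x) \<partial>lborel) \<le> M" "\<And>k. (\<integral>x. \<bar>\<phi> k x\<bar> \<partial>lborel) \<le> M"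
  shows "\<exists>\<sigma>::nat \<Rightarrow> nat. strict_mono \<sigma> \<and>
    (\<forall>\<epsilon>>0. \<exists>K. \<forall>i\<ge>K. \<forall>j\<ge>K. (\<integral>x. \<bar>\<phi> (\<sigma> i) x - \<phi> (\<sigma> j) x\<bar> \<partial>lborel) < \<epsilon>)"
proof -
  have M0: "0 \<le> M" using M(2)[of 0] by (rule order_trans[rotated]) simp
  define P where "P n s \<longleftrightarrow> (\<exists>K::nat. \<forall>i\<ge>K. \<forall>j\<ge>K. (\<integral>x. \<bar>\<phi> (s i) x - \<phi> (s j) x\<bar> \<partial>lborel) \<le> 1 / real (Suc n) * (2 * M + 1))"
    for n and s :: "nat \<Rightarrow> nat"
  interpret subseqs P
  proof
    fix n and s :: "nat \<Rightarrow> nat" assume "strict_mono s"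
    show "\<exists>r'. strict_mono r' \<and> P n (s \<circ> r')"
      using Rellich_L1_step[of "\<lambda>k. \<phi> (s k)" \<Omega> M "1 / real (Suc n)"] \<phi> \<Omega> M unfolding P_def by simp
  qed
  \<comment> \<open>The tail of the diagonal sequence from \<open>Suc k\<close> on is a subsequence
    of the one arranged for radius index \<open>k\<close>, and \<open>P\<close> passes to
    subsequences.\<close>
  have hold: "P k (diagseq \<circ> ((+) (Suc k)))" for k
  proof (rule diagseq_holds)
    fix r s :: "nat \<Rightarrow> nat" and n assume r: "strict_mono r" and "P n s"
    then obtain K where K: "\<And>i j. i \<ge> K \<Longrightarrow> j \<ge> K \<Longrightarrow> (\<integral>x. \<bar>\<phi> (s i) x - \<phi> (s j) x\<bar> \<partial>lborel) \<le> 1 / real (Suc n) * (2 * M + 1)"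
      unfolding P_def by blast
    have "K \<le> r i" if "K \<le> i" for i using seq_suble[OF r, of i] that by linarith
    then show "P n (s \<circ> r)" unfolding P_def using K by (auto intro!: exI[of _ K])
  qed
  have "\<exists>K. \<forall>i\<ge>K. \<forall>j\<ge>K. (\<integral>x. \<bar>\<phi> (diagseq i) x - \<phi> (diagseq j) x\<bar> \<partial>lborel) < \<epsilon>" if \<epsilon>: "0 < \<epsilon>" for \<epsilon>
  proof -
    obtain n where n: "1 / real (Suc n) < \<epsilon> / (2 * M + 1)" using nat_approx_posE[of "\<epsilon> / (2 * M + 1)"] \<epsilon> M0 by auto
    then have n': "1 / real (Suc n) * (2 * M + 1) < \<epsilon>" using M0 by (simp add: pos_less_divide_eq)
    obtain K where K: "\<And>i j. i \<ge> K \<Longrightarrow> j \<ge> K \<Longrightarrow>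
        (\<integral>x. \<bar>\<phi> (diagseq (Suc n + i)) x - \<phi> (diagseq (Suc n + j)) x\<bar> \<partial>lborel) \<le> 1 / real (Suc n) * (2 * M + 1)"
      using hold[of n] unfolding P_def by auto
    have "(\<integral>x. \<bar>\<phi> (diagseq i) x - \<phi> (diagseq j) x\<bar> \<partial>lborel) < \<epsilon>" if "Suc n + K \<le> i" "Suc n + K \<le> j" for i j
    proof -
      have "K \<le> i - Suc n" "K \<le> j - Suc n" "Suc n + (i - Suc n) = i" "Suc n + (j - Suc n) = j" using that by linarith+
      then show ?thesis using K[of "i - Suc n" "j - Suc n"] n' by simp
    qed
    then show ?thesis by blast
  qed
  then show ?thesis using subseq_diagseq by blast
qed

section \<open>Minimisation on the Nehari set\<close>

text \<open>Below, \<open>m q\<close> stands for the norm of the Lebesgue space with exponent \<open>q\<close> and \<open>T q u\<close> for the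
  derivative of its \<open>q\<close>-th power at \<open>u\<close>; \<open>g lam u\<close> is the derivative of the energy at \<open>u\<close> in
  direction \<open>u\<close>.\<close>

locale nehari =
  fixes V :: "'v::real_vector set" and ip :: "'v \<Rightarrow> 'v \<Rightarrow> real"
    and m :: "real \<Rightarrow> 'v \<Rightarrow> real" and T :: "real \<Rightarrow> 'v \<Rightarrow> 'v \<Rightarrow> real"
    and K p s a b :: real
  assumes V: "subspace V"
    and ip_add_left: "\<And>u v w. u \<in> V \<Longrightarrow> v \<in> V \<Longrightarrow> w \<in> V \<Longrightarrow> ip (u + v) w = ip u w + ip v w"
    and ip_scale_left: "\<And>u v c. u \<in> V \<Longrightarrow> v \<in> V \<Longrightarrow> ip (c *\<^sub>R u) v = c * ip u v"
    and ip_commute: "\<And>u v. u \<in> V \<Longrightarrow> v \<in> V \<Longrightarrow> ip u v = ip v u"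
    and ip_nonneg: "\<And>u. u \<in> V \<Longrightarrow> 0 \<le> ip u u"
    and m_nonneg: "\<And>q u. 0 \<le> m q u"
    and m_scale: "\<And>q u c. q \<in> {p, s} \<Longrightarrow> u \<in> V \<Longrightarrow> m q (c *\<^sub>R u) = \<bar>c\<bar> * m q u"
    and m_bound: "\<And>q u. q \<in> {p, s} \<Longrightarrow> u \<in> V \<Longrightarrow> m q u \<le> K * sqrt (ip u u)"
    and T_scale: "\<And>q u h c. q \<in> {p, s} \<Longrightarrow> u \<in> V \<Longrightarrow> h \<in> V \<Longrightarrow> T q u (c *\<^sub>R h) = c * T q u h"
    and T_scale_left: "\<And>q u h c. q \<in> {p, s} \<Longrightarrow> u \<in> V \<Longrightarrow> h \<in> V \<Longrightarrow> 0 < c \<Longrightarrow>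
          T q (c *\<^sub>R u) h = c powr (q - 1) * T q u h"
    and T_bound: "\<And>q u h. q \<in> {p, s} \<Longrightarrow> u \<in> V \<Longrightarrow> h \<in> V \<Longrightarrow>
          \<bar>T q u h\<bar> \<le> K * (m q u powr (q - 1) * m q h)"
    and taylor: "\<And>q u h. q \<in> {p, s} \<Longrightarrow> u \<in> V \<Longrightarrow> h \<in> V \<Longrightarrow>
          \<bar>m q (u + h) powr q - m q u powr q - T q u h\<bar>
            \<le> K * (m q u powr (q - 2) * (m q h)\<^sup>2 + m q h powr q)"
    and complete: "\<And>x. (\<And>k::nat. x k \<in> V) \<Longrightarrow>
          (\<And>\<epsilon>. 0 < \<epsilon> \<Longrightarrow> \<exists>M. \<forall>i\<ge>M. \<forall>j\<ge>M. sqrt (ip (x i - x j) (x i - x j)) < \<epsilon>) \<Longrightarrow>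
          \<exists>v\<in>V. (\<lambda>k. sqrt (ip (x k - v) (x k - v))) \<longlonglongrightarrow> 0"
    and compact: "\<And>x R. (\<And>k::nat. x k \<in> V) \<Longrightarrow> (\<And>k. sqrt (ip (x k) (x k)) \<le> R) \<Longrightarrow>
          \<exists>\<sigma>::nat \<Rightarrow> nat. strict_mono \<sigma> \<and>
            (\<forall>\<epsilon>>0. \<exists>M. \<forall>i\<ge>M. \<forall>j\<ge>M. m p (x (\<sigma> i) - x (\<sigma> j)) < \<epsilon>)"
    and nontrivial: "\<exists>w\<in>V. m p w > 0"
    and K: "1 \<le> K" and ps: "2 < p" "p < s" and ab: "a > 0" "b > 0"
begin

definition n :: "'v \<Rightarrow> real" where "n u = sqrt (ip u u)"
definition J :: "real \<Rightarrow> 'v \<Rightarrow> real" where "J q u = m q u powr q"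
definition E :: "real \<Rightarrow> 'v \<Rightarrow> real" where
  "E lam u = a / 2 * n u ^ 2 + b / 4 * n u ^ 4 - J s u / s - lam * J p u / p"
definition g :: "real \<Rightarrow> 'v \<Rightarrow> real" where
  "g lam u = a * n u ^ 2 + b * n u ^ 4 - J s u - lam * J p u"
definition dE :: "real \<Rightarrow> 'v \<Rightarrow> 'v \<Rightarrow> real" where
  "dE lam u h = (a + b * n u ^ 2) * ip u h - T s u h / s - lam * T p u h / p"

lemma V_closed [simp, intro]:
  "u \<in> V \<Longrightarrow> v \<in> V \<Longrightarrow> u + v \<in> V" "u \<in> V \<Longrightarrow> c *\<^sub>R u \<in> V" "u \<in> V \<Longrightarrow> v \<in> V \<Longrightarrow> u - v \<in> V"
  using V by (auto simp: subspace_add subspace_scale subspace_diff)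

lemma n_nonneg [simp]: "0 \<le> n u" if "u \<in> V"
  using ip_nonneg that by (simp add: n_def)

lemma n_square: "u \<in> V \<Longrightarrow> n u ^ 2 = ip u u"
  using ip_nonneg by (simp add: n_def)

lemma ip_scale_right: "u \<in> V \<Longrightarrow> v \<in> V \<Longrightarrow> ip u (c *\<^sub>R v) = c * ip u v"
  using ip_commute ip_scale_left by (metis V_closed(2))

lemma ip_add_right: "u \<in> V \<Longrightarrow> v \<in> V \<Longrightarrow> w \<in> V \<Longrightarrow> ip w (u + v) = ip w u + ip w v"
  using ip_commute ip_add_left by (metis V_closed(1))

lemma n_scale: "u \<in> V \<Longrightarrow> n (c *\<^sub>R u) = \<bar>c\<bar> * n u"
  by (simp add: n_def ip_scale_left ip_scale_right real_sqrt_mult flip: mult.assoc power2_eq_square)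

lemma n_add_square:
  assumes "u \<in> V" "v \<in> V"
  shows "n (u + v) ^ 2 = n u ^ 2 + 2 * ip u v + n v ^ 2"
  using assms by (simp add: n_square ip_add_left ip_add_right ip_commute[of v u])

lemma n_diff_square:
  assumes "u \<in> V" "v \<in> V"
  shows "n (u - v) ^ 2 = n u ^ 2 - 2 * ip u v + n v ^ 2"
  using n_add_square[of u "(- 1) *\<^sub>R v"] assms n_scale[of v "-1"] V_closed(2)[of v "-1"] ip_scale_right[of u v "-1"] by simp

lemma ip_Cauchy_Schwarz:
  assumes "u \<in> V" "v \<in> V"
  shows "\<bar>ip u v\<bar> \<le> n u * n v"
proof -
  have pos: "0 \<le> ip u u - 2 * t * ip u v + t\<^sup>2 * ip v v" for t
  proof -
    have "0 \<le> ip u u - 2 * (t * ip u v) + t * (t * ip v v)"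
      using n_diff_square[of u "t *\<^sub>R v"] assms zero_le_power2[of "n (u - t *\<^sub>R v)"]
      by (simp add: n_square ip_scale_left ip_scale_right)
    then show ?thesis by (simp add: power2_eq_square mult.assoc)
  qed
  have "(ip u v)\<^sup>2 \<le> ip u u * ip v v"
    by (rule quadratic_nonneg_imp_discriminant[OF pos ip_nonneg[OF assms(2)]])
  then have "sqrt ((ip u v)\<^sup>2) \<le> sqrt (ip u u * ip v v)" by (rule real_sqrt_le_mono)
  then show ?thesis unfolding n_def real_sqrt_mult by simp
qed

lemma n_triangle:
  assumes "u \<in> V" "v \<in> V"
  shows "n (u + v) \<le> n u + n v"
proof (rule power2_le_imp_le)
  show "n (u + v) ^ 2 \<le> (n u + n v) ^ 2"
    using n_add_square[OF assms] ip_Cauchy_Schwarz[OF assms] by (simp add: power2_sum)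
qed (use assms in auto)

lemma n_tendsto:
  assumes x: "\<And>k. x k \<in> V" and v: "v \<in> V" and lim: "((\<lambda>k. n (x k - v)) \<longlongrightarrow> 0) F"
  shows "((\<lambda>k. n (x k)) \<longlongrightarrow> n v) F"
proof -
  have "\<bar>n (x k) - n v\<bar> \<le> n (x k - v)" for k
    using n_triangle[of v "x k - v"] n_triangle[of "x k" "v - x k"] n_scale[of "x k - v" "-1"] x[of k] v
    by simp
  then show ?thesis
    by (intro LIM_zero_cancel[OF Lim_null_comparison[OF _ lim]]) auto
qed

lemma m_bound_n: "q \<in> {p, s} \<Longrightarrow> u \<in> V \<Longrightarrow> m q u \<le> K * n u"
  using m_bound by (simp add: n_def)

lemma m_tendsto_0:
  assumes "q \<in> {p, s}" "\<And>k. x k \<in> V" "((\<lambda>k. n (x k)) \<longlongrightarrow> 0) F"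
  shows "((\<lambda>k. m q (x k)) \<longlongrightarrow> 0) F"
proof (rule Lim_null_comparison)
  show "\<forall>\<^sub>F k in F. norm (m q (x k)) \<le> K * n (x k)" using m_bound_n assms m_nonneg by simp
  show "((\<lambda>k. K * n (x k)) \<longlongrightarrow> 0) F" using tendsto_mult_left[OF assms(3), of K] by simp
qed

text \<open>Continuity is read off the Taylor bound at \<open>v\<close>: both the linear term and
  the remainder are controlled by \<open>m q\<close> of the increment, which is dominated by the
  norm.\<close>

lemma J_tendsto:
  assumes q: "q \<in> {p, s}" and x: "\<And>k. x k \<in> V" and v: "v \<in> V" and lim: "((\<lambda>k. n (x k - v)) \<longlongrightarrow> 0) F"
  shows "((\<lambda>k. J q (x k)) \<longlongrightarrow> J q v) F"
proof -
  let ?e = "\<lambda>h. K * (m q v powr (q - 1) * m q h) + K * (m q v powr (q - 2) * (m q h)\<^sup>2 + m q h powr q)"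
  have m0: "((\<lambda>k. m q (x k - v)) \<longlongrightarrow> 0) F" using q x v lim by (intro m_tendsto_0) auto
  have le: "\<bar>J q (x k) - J q v\<bar> \<le> ?e (x k - v)" for k
    using taylor[OF q v, of "x k - v"] T_bound[OF q v, of "x k - v"] x[of k] v by (simp add: J_def)
  have lim0: "((\<lambda>k. ?e (x k - v)) \<longlongrightarrow> 0) F"
  proof -
    have "q > 0" using q ps by auto
    then have pw: "((\<lambda>k. m q (x k - v) powr q) \<longlongrightarrow> 0) F"
      using tendsto_powr'[OF m0 tendsto_const, of q] m_nonneg by simp
    have "((\<lambda>k. ?e (x k - v)) \<longlongrightarrow> K * (m q v powr (q - 1) * 0) + K * (m q v powr (q - 2) * 0\<^sup>2 + 0)) F"
      by (intro tendsto_intros m0 pw)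
    then show ?thesis by simp
  qed
  have "((\<lambda>k. J q (x k) - J q v) \<longlongrightarrow> 0) F"
    by (rule Lim_null_comparison[OF always_eventually lim0]) (simp only: real_norm_def le simp_thms)
  then show ?thesis by (rule LIM_zero_cancel)
qed

lemma E_tendsto:
  assumes "\<And>k. x k \<in> V" "v \<in> V" "((\<lambda>k. n (x k - v)) \<longlongrightarrow> 0) F"
  shows "((\<lambda>k. E lam (x k)) \<longlongrightarrow> E lam v) F"
  unfolding E_def using ps by (intro tendsto_intros n_tendsto J_tendsto assms) auto

lemma g_tendsto:
  assumes "\<And>k. x k \<in> V" "v \<in> V" "((\<lambda>k. n (x k - v)) \<longlongrightarrow> 0) F"
  shows "((\<lambda>k. g lam (x k)) \<longlongrightarrow> g lam v) F"
  unfolding g_def using ps by (intro tendsto_intros n_tendsto J_tendsto assms) auto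

lemma J_nonneg [simp]: "0 \<le> J q u" by (simp add: J_def)

lemma J_scale: "q \<in> {p, s} \<Longrightarrow> u \<in> V \<Longrightarrow> 0 \<le> t \<Longrightarrow> J q (t *\<^sub>R u) = t powr q * J q u"
  using m_nonneg by (auto simp: J_def m_scale powr_mult)

lemma J_le: "q \<in> {p, s} \<Longrightarrow> u \<in> V \<Longrightarrow> J q u \<le> (K * n u) powr q"
  using m_nonneg m_bound_n ps unfolding J_def by (intro powr_mono2) auto

text \<open>The constant is uniform over a ball because the expansion is used at the moving points
  \<open>t *\<^sub>R v\<close> close to the minimiser. The restriction \<open>n h \<le> 1\<close>
  lets the square of \<open>n h\<close> absorb all higher powers.\<close>

lemma E_taylor:
  assumes lam: "0 \<le> lam" and R: "0 \<le> R"
  shows "\<exists>C\<ge>0. \<forall>u\<in>V. \<forall>h\<in>V. n u \<le> R \<longrightarrow> n h \<le> 1 \<longrightarrow> \<bar>E lam (u + h) - E lam u - dE lam u h\<bar> \<le> C * n h ^ 2"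
proof -
  define c where "c q = K * ((K * R) powr (q - 2) * K\<^sup>2 + K powr q)" for q
  define C where "C = a / 2 + b / 4 * (4 * R\<^sup>2 + 1 + 2 * R\<^sup>2 + 4 * R) + c s / s + lam * c p / p"
  have c0: "0 \<le> c q" for q using K by (simp add: c_def)
  have "C \<ge> 0" using ab R c0[of s] c0[of p] ps lam by (simp add: C_def)
  moreover have "\<bar>E lam (u + h) - E lam u - dE lam u h\<bar> \<le> C * n h ^ 2"
    if u: "u \<in> V" and h: "h \<in> V" and nu: "n u \<le> R" and nh: "n h \<le> 1" for u h
  proof -
    define A where "A = n u ^ 2"
    define \<beta> where "\<beta> = ip u h"
    define \<delta> where "\<delta> = n h"
    have \<delta>: "0 \<le> \<delta>" "\<delta> \<le> 1" using h nh by (auto simp: \<delta>_def)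
    have A: "0 \<le> A" "A \<le> R\<^sup>2" using u nu by (auto simp: A_def intro!: power_mono)
    have \<beta>: "\<bar>\<beta>\<bar> \<le> R * \<delta>"
      using ip_Cauchy_Schwarz[OF u h] mult_right_mono[OF nu, of "n h"] h by (simp add: \<beta>_def \<delta>_def)
    have Jt: "\<bar>J q (u + h) - J q u - T q u h\<bar> \<le> c q * \<delta>\<^sup>2" if q: "q \<in> {p, s}" for q
    proof -
      have q2: "q > 2" using q ps by auto
      have "m q u powr (q - 2) * (m q h)\<^sup>2 \<le> (K * R) powr (q - 2) * (K * \<delta>)\<^sup>2"
        using m_bound_n[OF q u] m_bound_n[OF q h] nu K m_nonneg q2 R
        by (intro mult_mono powr_mono2 power_mono) (auto simp: \<delta>_def intro: order_trans mult_left_mono)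
      moreover have "m q h powr q \<le> K powr q * \<delta>\<^sup>2"
      proof -
        have "m q h powr q \<le> (K * \<delta>) powr q"
          using m_bound_n[OF q h] m_nonneg q2 by (intro powr_mono2) (auto simp: \<delta>_def)
        also have "\<dots> = K powr q * \<delta> powr q" using K \<delta> by (simp add: powr_mult)
        also have "\<delta> powr q \<le> \<delta> powr 2" using \<delta> q2 by (intro powr_mono') auto
        finally show ?thesis using \<delta> by (simp add: mult_left_mono)
      qed
      ultimately have "K * (m q u powr (q - 2) * (m q h)\<^sup>2 + m q h powr q) \<le> c q * \<delta>\<^sup>2"
        using K by (simp add: c_def power_mult_distrib distrib_right mult.assoc distrib_left add_mono)
      then show ?thesis using taylor[OF q u h] unfolding J_def by linarith
    qed
    have n2: "n (u + h) ^ 2 = A + 2 * \<beta> + \<delta>\<^sup>2" using n_add_square[OF u h] by (simp add: A_def \<beta>_def \<delta>_def)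
    have p4: "x ^ 4 = (x\<^sup>2)\<^sup>2" for x :: real by (simp flip: power_mult)
    \<comment> \<open>What remains of \<open>n (u + h) ^ 4\<close>, the square of
      \<open>A + 2 * \<beta> + \<delta>\<^sup>2\<close>, after removing the constant
      \<open>A\<^sup>2\<close> and the linear part \<open>4 * A * \<beta>\<close>.\<close>
    define q4 where "q4 = 4 * \<beta>\<^sup>2 + \<delta> ^ 4 + 2 * A * \<delta>\<^sup>2 + 4 * \<beta> * \<delta>\<^sup>2"
    have eq: "E lam (u + h) - E lam u - dE lam u h = a / 2 * \<delta>\<^sup>2 + b / 4 * q4
        - (J s (u + h) - J s u - T s u h) / s - lam * (J p (u + h) - J p u - T p u h) / p"
      unfolding E_def dE_def p4 n2 q4_def A_def[symmetric] \<beta>_def[symmetric]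
      by (simp add: algebra_simps power2_eq_square diff_divide_distrib add_divide_distrib)
    have \<beta>2: "\<beta>\<^sup>2 \<le> R\<^sup>2 * \<delta>\<^sup>2" using power_mono[OF \<beta>, of 2] by (simp add: power_mult_distrib)
    have \<delta>4: "\<delta> ^ 4 \<le> \<delta>\<^sup>2" using \<delta> by (intro power_decreasing) auto
    have A\<delta>: "A * \<delta>\<^sup>2 \<le> R\<^sup>2 * \<delta>\<^sup>2" using A by (intro mult_right_mono) auto
    have "\<bar>\<beta>\<bar> * \<delta>\<^sup>2 \<le> R * 1 * \<delta>\<^sup>2" using order_trans[OF \<beta> mult_left_mono[OF \<delta>(2) R]] by (intro mult_right_mono) auto
    then have "\<bar>q4\<bar> \<le> (4 * R\<^sup>2 + 1 + 2 * R\<^sup>2 + 4 * R) * \<delta>\<^sup>2"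
    proof -
      have "\<bar>q4\<bar> \<le> 4 * \<beta>\<^sup>2 + \<delta> ^ 4 + 2 * (A * \<delta>\<^sup>2) + 4 * (\<bar>\<beta>\<bar> * \<delta>\<^sup>2)"
        unfolding q4_def using A \<delta> by (intro order_trans[OF abs_triangle_ineq] add_mono) (auto simp: abs_mult)
      then show ?thesis using \<beta>2 \<delta>4 A\<delta> \<open>\<bar>\<beta>\<bar> * \<delta>\<^sup>2 \<le> R * 1 * \<delta>\<^sup>2\<close> by (simp add: algebra_simps)
    qed
    then have "b / 4 * \<bar>q4\<bar> \<le> b / 4 * ((4 * R\<^sup>2 + 1 + 2 * R\<^sup>2 + 4 * R) * \<delta>\<^sup>2)"
      using ab by (intro mult_left_mono) auto
    moreover have "\<bar>J s (u + h) - J s u - T s u h\<bar> / s \<le> c s * \<delta>\<^sup>2 / s"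
      using Jt[of s] ps by (intro divide_right_mono) auto
    moreover have "lam * \<bar>J p (u + h) - J p u - T p u h\<bar> / p \<le> lam * (c p * \<delta>\<^sup>2) / p"
      using Jt[of p] ps lam by (intro divide_right_mono mult_left_mono) auto
    moreover have "\<bar>E lam (u + h) - E lam u - dE lam u h\<bar> \<le> a / 2 * \<delta>\<^sup>2 + b / 4 * \<bar>q4\<bar>
        + \<bar>J s (u + h) - J s u - T s u h\<bar> / s + lam * \<bar>J p (u + h) - J p u - T p u h\<bar> / p"
    proof -
      have t4: "\<bar>x + y - z - w\<bar> \<le> \<bar>x\<bar> + \<bar>y\<bar> + \<bar>z\<bar> + \<bar>w\<bar>" for x y z w :: real by linarith
      show ?thesis unfolding eq by (rule order_trans[OF t4]) (use ab ps lam in \<open>simp add: abs_mult\<close>)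
    qed
    ultimately have "\<bar>E lam (u + h) - E lam u - dE lam u h\<bar> \<le> a / 2 * \<delta>\<^sup>2
        + b / 4 * ((4 * R\<^sup>2 + 1 + 2 * R\<^sup>2 + 4 * R) * \<delta>\<^sup>2) + c s * \<delta>\<^sup>2 / s + lam * (c p * \<delta>\<^sup>2) / p" by linarith
    also have "\<dots> = C * n h ^ 2" by (simp add: C_def \<delta>_def algebra_simps)
    finally show ?thesis .
  qed
  ultimately show ?thesis by blast
qed


lemma fibering_ray:
  assumes "u \<in> V" "0 < n u"
  shows "fibering a b p s (n u ^ 2) (J s u)"
  using assms ab ps by unfold_locales auto

lemma g_ray:
  assumes "u \<in> V" "0 < n u" "0 < t"
  shows "g lam (t *\<^sub>R u) = fibering.G a b p s (n u ^ 2) (J s u) (lam * J p u) t"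
  using assms by (simp add: g_def fibering.G_def[OF fibering_ray] n_scale J_scale power_mult_distrib
      flip: power_mult)

lemma E_ray:
  assumes "u \<in> V" "0 < n u" "0 < t"
  shows "E lam (t *\<^sub>R u) = fibering.E a b p s (n u ^ 2) (J s u) (lam * J p u) t"
  using assms by (simp add: E_def fibering.E_def[OF fibering_ray] n_scale J_scale power_mult_distrib
      mult.commute mult.left_commute flip: power_mult)

end

text \<open>\<open>r_concave\<close> is the condition of the locale \<open>fibering\<close> for all
  rays inside the ball, and \<open>r_kirchhoff\<close> bounds the quartic term by the quadratic one.
  \<open>r_critical\<close> has its form from \<open>E_midpoint\<close>: the Taylor constant
  contributes one factor \<open>K\<close>, the embedding \<open>s\<close> further ones. The
  conditions are free of \<open>lam\<close>.\<close>

locale nehari_ball = nehari V ip m T K p s a b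
  for V :: "'v::real_vector set" and ip m T K p s a b +
  fixes r lam :: real
  assumes r: "r > 0" and lam: "lam > 0"
    and r_concave: "8 * b * r\<^sup>2 \<le> a * (p - 2)" and r_kirchhoff: "b * r\<^sup>2 \<le> a"
    and r_critical: "8 * K powr (s + 1) * r powr (s - 2) \<le> a"
begin

definition N :: "'v set" where "N = {u \<in> V. 0 < n u \<and> n u \<le> r \<and> g lam u = 0}"

lemma N_D: "u \<in> N \<Longrightarrow> u \<in> V" "u \<in> N \<Longrightarrow> 0 < n u" "u \<in> N \<Longrightarrow> n u \<le> r" "u \<in> N \<Longrightarrow> g lam u = 0"
  by (auto simp: N_def)

text \<open>Half of the coefficient \<open>a * (1 / 2 - 1 / p)\<close> that remains when the
  subcritical term is eliminated; the other half absorbs the quartic term.\<close>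

definition \<delta> :: real where "\<delta> = a * (p - 2) / (4 * p)"

lemma \<delta>_pos: "\<delta> > 0" using ab ps by (simp add: \<delta>_def)

lemma r_concave_ray:
  assumes "u \<in> V" "n (t *\<^sub>R u) \<le> r"
  shows "8 * b * n u ^ 2 * t\<^sup>2 \<le> a * (p - 2)"
proof -
  have "(\<bar>t\<bar> * n u)\<^sup>2 \<le> r\<^sup>2" using assms by (intro power_mono) (auto simp: n_scale)
  then have "8 * b * (n u ^ 2 * t\<^sup>2) \<le> 8 * b * r\<^sup>2"
    using ab by (intro mult_left_mono) (auto simp: power_mult_distrib mult.commute)
  then show ?thesis using r_concave by (simp add: mult.assoc)
qed

text \<open>Subtracting \<open>g lam u / p\<close>, which is zero, cancels the subcritical term. The
  critical term is left with a positive coefficient, and \<open>r_concave\<close> makes the quartic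
  term small against the quadratic one.\<close>

lemma E_ge_on_N:
  assumes "u \<in> N"
  shows "\<delta> * n u ^ 2 \<le> E lam u"
proof -
  note u = N_D[OF assms]
  define A where "A = n u ^ 2"
  have p4: "n u ^ 4 = A\<^sup>2" by (simp add: A_def flip: power_mult)
  have A: "0 \<le> A" "8 * b * A \<le> a * (p - 2)"
    using r_concave_ray[of u 1] u by (auto simp: A_def)
  have "E lam u = E lam u - g lam u / p" using u by simp
  also have "\<dots> = a * (1 / 2 - 1 / p) * A + b * (1 / 4 - 1 / p) * A\<^sup>2 + (1 / p - 1 / s) * J s u"
    by (simp add: E_def g_def p4 A_def[symmetric] algebra_simps diff_divide_distrib add_divide_distrib)
  finally have eq: "E lam u = a * (1 / 2 - 1 / p) * A + b * (1 / 4 - 1 / p) * A\<^sup>2 + (1 / p - 1 / s) * J s u" .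
  have "(1 / p - 1 / s) * J s u \<ge> 0" using ps by (intro mult_nonneg_nonneg) (auto simp: field_simps)
  moreover have "b * (1 / 4 - 1 / p) * A\<^sup>2 \<ge> - (b * A * A / p)"
    using ab A by (simp add: power2_eq_square algebra_simps)
  moreover have "b * A * A / p \<le> a * (p - 2) / 8 * A / p"
    using A ps by (intro divide_right_mono mult_right_mono) auto
  moreover have "a * (1 / 2 - 1 / p) * A - a * (p - 2) / 8 * A / p = \<delta> * A + a * (p - 2) / (8 * p) * A"
    using ps by (simp add: \<delta>_def field_simps)
  moreover have "a * (p - 2) / (8 * p) * A \<ge> 0" using A ab ps by simp
  ultimately show ?thesis unfolding eq A_def[symmetric] by linarith
qed

text \<open>The embedding gives order \<open>s\<close>, and since \<open>s > 2\<close> the surplus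
  power of the norm is at most \<open>r powr (s - 2)\<close>, which \<open>r_critical\<close> makes
  small.\<close>

lemma J_s_le:
  assumes "u \<in> V" "n u \<le> r"
  shows "8 * J s u \<le> a * n u ^ 2"
proof (cases "n u = 0")
  case True
  then have "J s u \<le> 0" using J_le[of s u] assms by simp
  then show ?thesis using True by simp
next
  case False
  then have nu: "0 < n u" using n_nonneg[OF assms(1)] by linarith
  have "J s u \<le> (K * n u) powr s" using J_le assms by auto
  also have "\<dots> = K powr s * (n u powr (s - 2) * n u ^ 2)"
    using nu K by (simp add: powr_mult powr_diff)
  also have "\<dots> \<le> K powr (s + 1) * (r powr (s - 2) * n u ^ 2)"
    using assms nu K ps by (intro mult_mono powr_mono powr_mono2 mult_right_mono) auto
  finally have "8 * J s u \<le> (8 * K powr (s + 1) * r powr (s - 2)) * n u ^ 2" by simp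
  also have "\<dots> \<le> a * n u ^ 2" using r_critical by (intro mult_right_mono) auto
  finally show ?thesis .
qed

text \<open>Near zero both powers are of higher order than the quadratic term. This separates the
  Nehari set from 0, so that the limit of a minimising sequence cannot degenerate. In contrast to
  \<open>r\<close>, the radius depends on \<open>lam\<close>.\<close>

lemma g_pos_near_0: "\<exists>\<rho>>0. \<rho> \<le> r \<and> (\<forall>u\<in>V. 0 < n u \<longrightarrow> n u < \<rho> \<longrightarrow> 0 < g lam u)"
proof -
  \<comment> \<open>The second entry solves
    \<open>lam * K powr p * \<rho> powr (p - 2) = a / 2\<close>.\<close>
  define \<rho> where "\<rho> = min r ((a / (2 * lam * K powr p)) powr (1 / (p - 2)))"
  have "\<rho> > 0" using r ab lam K by (simp add: \<rho>_def)
  moreover have "0 < g lam u" if u: "u \<in> V" "0 < n u" "n u < \<rho>" for u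
  proof -
    have "n u powr (p - 2) < ((a / (2 * lam * K powr p)) powr (1 / (p - 2))) powr (p - 2)"
      using u ps by (intro powr_less_mono2) (auto simp: \<rho>_def)
    also have "\<dots> = a / (2 * lam * K powr p)" using ps ab lam K by (simp add: powr_powr)
    finally have 1: "lam * K powr p * n u powr (p - 2) < a / 2" using lam K by (simp add: field_simps)
    have "lam * J p u \<le> lam * (K * n u) powr p" using J_le[of p u] u lam by (intro mult_left_mono) auto
    also have "\<dots> = (lam * K powr p * n u powr (p - 2)) * n u ^ 2" using u K by (simp add: powr_mult powr_diff)
    also have "\<dots> \<le> a / 2 * n u ^ 2" using 1 by (intro mult_right_mono) auto
    finally have "lam * J p u \<le> a / 2 * n u ^ 2" .
    moreover have "8 * J s u \<le> a * n u ^ 2" using J_s_le[of u] u by (simp add: \<rho>_def)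
    moreover have "0 < a * n u ^ 2" "0 \<le> b * n u ^ 4" using ab u by auto
    ultimately show ?thesis unfolding g_def by linarith
  qed
  ultimately show ?thesis by (intro exI[of _ \<rho>]) (auto simp: \<rho>_def)
qed

definition \<rho> :: real where "\<rho> = (SOME \<rho>. 0 < \<rho> \<and> \<rho> \<le> r \<and> (\<forall>u\<in>V. 0 < n u \<longrightarrow> n u < \<rho> \<longrightarrow> 0 < g lam u))"

lemma \<rho>: "0 < \<rho>" "\<rho> \<le> r" "u \<in> V \<Longrightarrow> 0 < n u \<Longrightarrow> n u < \<rho> \<Longrightarrow> 0 < g lam u"
  using someI_ex[OF g_pos_near_0] unfolding \<rho>_def[symmetric] by auto

lemma N_ge_\<rho>: "u \<in> N \<Longrightarrow> \<rho> \<le> n u"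
  using \<rho>(3)[of u] by (force simp: N_def)

text \<open>On the Nehari set the subcritical term has to balance the quadratic one, of which the
  critical term covers at most an eighth. This keeps midpoints of close points away from zero and
  makes the minimiser nonzero in the \<open>p\<close>-norm.\<close>

lemma J_p_ge_on_N:
  assumes "u \<in> N"
  shows "a / 2 * n u ^ 2 \<le> lam * J p u"
proof -
  note u = N_D[OF assms]
  have "0 \<le> b * n u ^ 4" "0 \<le> a * n u ^ 2" using ab by auto
  then show ?thesis using J_s_le[of u] u unfolding g_def by linarith
qed

lemma N_meets_ray:
  assumes u: "u \<in> V" "0 < n u" and t: "0 < t0" "t0 \<le> t1" "n (t1 *\<^sub>R u) \<le> r"
    and g: "0 \<le> g lam (t0 *\<^sub>R u)" "g lam (t1 *\<^sub>R u) \<le> 0"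
  shows "\<exists>t. t0 \<le> t \<and> t \<le> t1 \<and> t *\<^sub>R u \<in> N"
proof -
  let ?G = "fibering.G a b p s (n u ^ 2) (J s u) (lam * J p u)"
  have "\<exists>t. t0 \<le> t \<and> t \<le> t1 \<and> ?G t = 0"
  proof (rule IVT2)
    show "?G t1 \<le> 0" "0 \<le> ?G t0" using g g_ray u t by auto
    show "\<forall>t. t0 \<le> t \<and> t \<le> t1 \<longrightarrow> isCont ?G t"
      using t unfolding fibering.G_def[OF fibering_ray[OF u], abs_def] by (auto intro!: continuous_intros)
  qed fact
  then obtain t where t': "t0 \<le> t" "t \<le> t1" "?G t = 0" by blast
  have "n (t *\<^sub>R u) \<le> n (t1 *\<^sub>R u)" using t t' u by (simp add: n_scale mult_right_mono)
  moreover have "0 < n (t *\<^sub>R u)" using t t' u by (simp add: n_scale)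
  ultimately have "t *\<^sub>R u \<in> N" using t t' u g_ray[OF u, of t lam] by (auto simp: N_def)
  then show ?thesis using t' by blast
qed

lemma N_meets_ray_from_0:
  assumes u: "u \<in> V" "0 < n u" and t: "0 < t1" "n (t1 *\<^sub>R u) \<le> r" and g: "g lam (t1 *\<^sub>R u) \<le> 0"
  shows "\<exists>t. 0 < t \<and> t \<le> t1 \<and> t *\<^sub>R u \<in> N"
proof -
  define t0 where "t0 = min t1 (\<rho> / (2 * n u))"
  have t0: "0 < t0" "t0 \<le> t1" using t u \<rho>(1) by (auto simp: t0_def)
  have "t0 * n u \<le> \<rho> / (2 * n u) * n u" using u by (intro mult_right_mono) (auto simp: t0_def)
  then have "t0 * n u < \<rho>" using u \<rho>(1) by simp
  then have "0 \<le> g lam (t0 *\<^sub>R u)" using \<rho>(3)[of "t0 *\<^sub>R u"] u t0 by (simp add: n_scale less_imp_le)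
  from N_meets_ray[OF u t0 t(2) this g] t0 show ?thesis by (meson less_le_trans)
qed

lemma E_max_on_ray:
  assumes u: "u \<in> N" and t: "0 < t" "n (t *\<^sub>R u) \<le> r"
  shows "E lam (t *\<^sub>R u) \<le> E lam u"
proof -
  note u' = N_D[OF u]
  have "fibering.E a b p s (n u ^ 2) (J s u) (lam * J p u) t \<le> fibering.E a b p s (n u ^ 2) (J s u) (lam * J p u) 1"
    using r_concave_ray[of u t] r_concave_ray[of u 1] u' t g_ray[of u 1 lam]
    by (intro fibering.E_le_max[OF fibering_ray]) auto
  then show ?thesis using E_ray[of u t lam] E_ray[of u 1 lam] u' t by simp
qed

lemma g_ray_sign:
  assumes u: "u \<in> N" and t: "0 < t" "n (t *\<^sub>R u) \<le> r"
  shows "t < 1 \<Longrightarrow> 0 < g lam (t *\<^sub>R u)" "1 < t \<Longrightarrow> g lam (t *\<^sub>R u) < 0"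
  using r_concave_ray[of u t] r_concave_ray[of u 1] N_D[OF u] t g_ray[of u 1 lam] g_ray[of u t lam]
    fibering.G_neg_after[OF fibering_ray, of u 1 t "lam * J p u"]
    fibering.G_pos_before[OF fibering_ray, of u t 1 "lam * J p u"] by auto

text \<open>A bound, linear in \<open>m p d\<close>, for the effect of an increment \<open>d\<close>
  on the subcritical power: the three summands come from the linear, the mixed and the pure power
  term of the Taylor bound, with higher powers of \<open>m p d \<le> 1\<close> estimated by the
  first.\<close>

definition D :: "'v \<Rightarrow> real" where "D d = K * ((K * r) powr (p - 1) + (K * r) powr (p - 2) + 1) * m p d"

lemma J_p_increment:
  assumes u: "u \<in> V" "n u \<le> r" and d: "d \<in> V" "m p d \<le> 1"
  shows "\<bar>J p (u + d) - J p u - T p u d\<bar> \<le> D d" "\<bar>J p (u + d) - J p u\<bar> \<le> D d"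
proof -
  have mu: "m p u \<le> K * r" using order_trans[OF m_bound_n[of p u] mult_left_mono[of "n u" r K]] u K by simp
  have md: "0 \<le> m p d" by (rule m_nonneg)
  have 1: "m p u powr (p - 1) * m p d \<le> (K * r) powr (p - 1) * m p d"
    using mu m_nonneg ps by (intro mult_right_mono powr_mono2) auto
  have "(m p d)\<^sup>2 \<le> m p d" using md d by (simp add: power2_eq_square mult_left_le)
  then have 2: "m p u powr (p - 2) * (m p d)\<^sup>2 \<le> (K * r) powr (p - 2) * m p d"
    using mu m_nonneg ps by (intro mult_mono powr_mono2) auto
  have 3: "m p d powr p \<le> m p d" using powr_mono'[of 1 p "m p d"] md d ps by simp
  have D: "D d = K * ((K * r) powr (p - 1) * m p d) + K * ((K * r) powr (p - 2) * m p d + m p d)"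
    by (simp add: D_def algebra_simps)
  have e: "\<bar>J p (u + d) - J p u - T p u d\<bar> \<le> K * ((K * r) powr (p - 2) * m p d + m p d)"
    unfolding J_def using u d K by (intro order_trans[OF taylor mult_left_mono[OF add_mono[OF 2 3]]]) auto
  moreover have "0 \<le> K * ((K * r) powr (p - 1) * m p d)" using K md by simp
  ultimately show "\<bar>J p (u + d) - J p u - T p u d\<bar> \<le> D d"
    unfolding D by linarith
  have "\<bar>T p u d\<bar> \<le> K * ((K * r) powr (p - 1) * m p d)"
    using u d K by (intro order_trans[OF T_bound mult_left_mono[OF 1]]) auto
  with e show "\<bar>J p (u + d) - J p u\<bar> \<le> D d" unfolding D by linarith
qed

text \<open>The parallelogram law yields a gain of \<open>a / 2 * n d ^ 2\<close>, the quartic term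
  is convex, and the second difference of the critical power costs at most half of the gain. The
  subcritical difference is kept explicitly, since compactness will make it small.\<close>

lemma E_midpoint:
  assumes z: "z \<in> V" "d \<in> V" "n (z + d) \<le> r" "n (z - d) \<le> r"
  shows "E lam z + a / 4 * n d ^ 2 \<le> (E lam (z + d) + E lam (z - d)) / 2
           + lam / p * ((J p (z + d) + J p (z - d)) / 2 - J p z)"
proof -
  have pl: "n (z + d) ^ 2 + n (z - d) ^ 2 = 2 * n z ^ 2 + 2 * n d ^ 2"
    using n_add_square[of z d] n_diff_square[of z d] z by simp
  have nz: "n z \<le> r" "n d \<le> r"
  proof -
    have "n (2 *\<^sub>R z) \<le> n (z + d) + n (z - d)" using n_triangle[of "z + d" "z - d"] z
      by (simp add: scaleR_2)
    then show "n z \<le> r" using z by (simp add: n_scale)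
    have "n (2 *\<^sub>R d) \<le> n (z + d) + n ((-1) *\<^sub>R (z - d))" using n_triangle[of "z + d" "(-1) *\<^sub>R (z - d)"] z
      by (simp add: scaleR_2 algebra_simps)
    then show "n d \<le> r" using z n_scale[of "z - d" "-1"] by (simp add: n_scale)
  qed
  have J: "(J s (z + d) + J s (z - d)) / 2 - J s z \<le> a / 4 * n d ^ 2"
  proof -
    have sm: "m s (- d) = m s d" using m_scale[of s d "-1"] z by simp
    have T: "T s z (- d) = - T s z d" using T_scale[of s z d "-1"] z by simp
    have md: "- d \<in> V" using V_closed(2)[of d "-1"] z by simp
    let ?B = "m s z powr (s - 2) * (m s d)\<^sup>2 + m s d powr s"
    have "(J s (z + d) + J s (z - d)) / 2 - J s z \<le> K * ?B"
    proof -
      have mid: "(x + y) / 2 - w \<le> B" if "\<bar>x - w - t\<bar> \<le> B" "\<bar>y - w + t\<bar> \<le> B" for x y w t B :: real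
      proof -
        have "x - w - t \<le> B" "y - w + t \<le> B" using that by (simp_all add: abs_le_iff)
        then have "(x - w - t) + (y - w + t) \<le> B + B" by (rule add_mono)
        then show ?thesis by (simp add: field_simps)
      qed
      \<comment> \<open>The linear terms of the expansions in the directions \<open>d\<close> and
        \<open>- d\<close> cancel.\<close>
      show ?thesis using taylor[of s z d] taylor[of s z "- d"] z md by (intro mid) (auto simp: J_def T sm)
    qed
    \<comment> \<open>Each of the two remainder terms is at most
      \<open>K powr s * r powr (s - 2) * n d ^ 2\<close>: for the pure power, \<open>s - 2\<close>
      factors are estimated through \<open>n d \<le> r\<close>.\<close>
    also have "\<dots> \<le> K * (2 * (K powr s * r powr (s - 2) * n d ^ 2))"
    proof -
      have md: "m s d \<le> K * n d" and mz: "m s z \<le> K * r"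
        using m_bound_n[of s d] order_trans[OF m_bound_n[of s z] mult_left_mono[of "n z" r K]] z K nz by auto
      have pow: "(K * r) powr (s - 2) * (K * n d)\<^sup>2 = K powr s * r powr (s - 2) * n d ^ 2"
        using K r by (simp add: powr_mult power_mult_distrib powr_diff)
      have "m s z powr (s - 2) * (m s d)\<^sup>2 \<le> (K * r) powr (s - 2) * (K * n d)\<^sup>2"
        using md mz m_nonneg ps z by (intro mult_mono powr_mono2 power_mono) auto
      moreover have "m s d powr s \<le> (K * r) powr (s - 2) * (K * n d)\<^sup>2"
      proof (cases "m s d = 0")
        case False
        then have "m s d powr s = m s d powr (s - 2) * (m s d)\<^sup>2"
          using m_nonneg[of s d] by (simp add: powr_diff)
        also have "\<dots> \<le> (K * r) powr (s - 2) * (K * n d)\<^sup>2"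
          using md m_nonneg ps z nz K order_trans[OF md mult_left_mono[of "n d" r K]]
          by (intro mult_mono powr_mono2 power_mono) auto
        finally show ?thesis .
      qed simp
      ultimately show ?thesis unfolding pow using K by (intro mult_left_mono) auto
    qed
    also have "\<dots> = (8 * K powr (s + 1) * r powr (s - 2)) / 4 * n d ^ 2"
      using K by (simp add: powr_add)
    also have "\<dots> \<le> a / 4 * n d ^ 2" using r_critical by (intro mult_right_mono) auto
    finally show ?thesis .
  qed
  have J': "((J s (z + d) + J s (z - d)) / 2 - J s z) / s \<le> a / 4 * n d ^ 2"
  proof -
    have "((J s (z + d) + J s (z - d)) / 2 - J s z) / s \<le> (a / 4 * n d ^ 2) / s"
      using J ps by (intro divide_right_mono) auto
    also have "\<dots> \<le> a / 4 * n d ^ 2" using ps ab mult_right_mono[of 1 s "a * n d ^ 2"] by (simp add: divide_le_eq mult.commute)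
    finally show ?thesis .
  qed
  define x y w e where "x = n (z + d) ^ 2" "y = n (z - d) ^ 2" "w = n z ^ 2" "e = n d ^ 2"
  have p4: "x ^ 4 = (x\<^sup>2)\<^sup>2" for x :: real by (simp flip: power_mult)
  have xy: "x + y = 2 * w + 2 * e" and we: "0 \<le> w" "0 \<le> e" using pl by (simp_all add: x_y_w_e_def)
  \<comment> \<open>Convexity of the square: \<open>w\<close> is at most the mean of
    \<open>x\<close> and \<open>y\<close>, by the parallelogram law.\<close>
  have "w\<^sup>2 \<le> ((x + y) / 2)\<^sup>2" using xy we by (intro power_mono) auto
  also have "\<dots> \<le> (x\<^sup>2 + y\<^sup>2) / 2" using zero_le_power2[of "x - y"]
    by (simp add: power2_eq_square algebra_simps)
  finally have "b / 4 * w\<^sup>2 \<le> b / 4 * ((x\<^sup>2 + y\<^sup>2) / 2)" using ab by (intro mult_left_mono) auto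
  moreover have "a / 2 * w + a / 2 * e = (a / 2 * x + a / 2 * y) / 2"
  proof -
    have "(a / 2 * x + a / 2 * y) / 2 = a / 4 * (x + y)" by (simp add: algebra_simps)
    then show ?thesis unfolding xy by (simp add: algebra_simps)
  qed
  ultimately show ?thesis using J'
    unfolding E_def p4 x_y_w_e_def[symmetric] by (simp add: diff_divide_distrib add_divide_distrib algebra_simps)
qed

text \<open>The value 8 makes \<open>g\<close> nonpositive at \<open>\<tau>\<close> times a midpoint of two points of \<open>N\<close>.\<close>

definition \<tau> :: real where "\<tau> = 8 powr (1 / (p - 2))"

lemma \<tau>: "1 \<le> \<tau>" "\<tau> powr (p - 2) = 8"
  using ps by (simp_all add: \<tau>_def powr_powr ge_one_powr_ge_zero)

text \<open>The midpoint \<open>z\<close> is rescaled by \<open>t\<close> to the Nehari set, and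
  \<open>u\<close> and \<open>w\<close> are rescaled by the same \<open>t\<close>, which does not
  raise their energies because points of \<open>N\<close> are maxima on their rays.
  \<open>E_midpoint\<close> at the rescaled points then bounds the distance by the energy excess
  \<open>e\<close> and the subcritical increment.\<close>

lemma N_pair:
  assumes u: "u \<in> N" and w: "w \<in> N" and le: "n w \<le> n u" "n u \<le> r / \<tau>"
    and c: "\<And>x. x \<in> N \<Longrightarrow> c \<le> E lam x" "E lam u \<le> c + e" "E lam w \<le> c + e"
    and d: "d = (1 / 2) *\<^sub>R (u - w)" and md: "m p d \<le> 1" and Dd: "lam * D d \<le> a / 4 * \<rho>\<^sup>2"
  shows "(\<rho> / r)\<^sup>2 * (a / 4) * n d ^ 2 \<le> e + lam / p * \<tau> powr p * D d"
proof -
  note u' = N_D[OF u] and w' = N_D[OF w]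
  define z where "z = (1 / 2) *\<^sub>R (u + w)"
  have zd: "z + d = u" "z - d = w"
    by (simp_all add: z_def d scaleR_diff_right scaleR_add_right flip: scaleR_left.add)
  have z: "z \<in> V" and dV: "d \<in> V" using u' w' by (simp_all add: z_def d)
  have nz: "n z \<le> n u" using n_triangle[of u w] u' w' le by (simp add: z_def n_scale)
  have nzr: "n z \<le> r" using nz u' by simp
  have Ju: "\<bar>J p u - J p z\<bar> \<le> D d" using J_p_increment(2)[of z d] z dV nzr md zd by simp
  have "lam * J p u - lam * J p z \<le> lam * D d" using Ju lam mult_left_mono[of "J p u - J p z" "D d" lam]
    by (simp add: right_diff_distrib abs_le_iff)
  moreover have "a / 4 * \<rho>\<^sup>2 \<le> a / 4 * n u ^ 2"
    using N_ge_\<rho>[OF u] \<rho>(1) ab by (intro mult_left_mono power_mono) auto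
  ultimately have Jz: "a / 4 * n u ^ 2 \<le> lam * J p z" using J_p_ge_on_N[OF u] Dd by linarith
  \<comment> \<open>Nearly opposite points would have a midpoint close to zero; closeness in the
    \<open>p\<close>-norm excludes this, because the subcritical power of \<open>u\<close> is
    bounded below.\<close>
  have "n z \<noteq> 0"
  proof
    assume "n z = 0"
    then have "J p z \<le> 0" using J_le[of p z] z by simp
    then show False using Jz u' ab lam by (smt (verit) J_nonneg mult_eq_0_iff mult_pos_pos divide_pos_pos zero_less_power)
  qed
  then have nz0: "0 < n z" using n_nonneg[OF z] by linarith
  have n\<tau>: "n (t *\<^sub>R x) \<le> r" if "0 < t" "t \<le> \<tau>" "x \<in> V" "n x \<le> n u" for t x
  proof -
    have "t * n x \<le> \<tau> * (r / \<tau>)" using that le n_nonneg[of x] by (intro mult_mono) auto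
    then show ?thesis using that \<tau> by (simp add: n_scale)
  qed
  \<comment> \<open>At \<open>\<tau> *\<^sub>R z\<close> the quadratic and quartic terms are
    together at most \<open>2 * a * \<tau>\<^sup>2 * n u ^ 2\<close>. Since
    \<open>\<tau> powr (p - 2) = 8\<close>, this equals \<open>\<tau> powr p\<close> times the lower
    bound for \<open>lam * J p z\<close>.\<close>
  have g\<tau>: "g lam (\<tau> *\<^sub>R z) \<le> 0"
  proof -
    have "n (\<tau> *\<^sub>R z) \<le> r" using n\<tau>[of \<tau> z] z nz \<tau> by simp
    then have "b * n (\<tau> *\<^sub>R z) ^ 2 \<le> b * r\<^sup>2" using ab z by (intro mult_left_mono power_mono) auto
    then have "b * n (\<tau> *\<^sub>R z) ^ 2 \<le> a" using r_kirchhoff by linarith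
    from mult_right_mono[OF this, of "n (\<tau> *\<^sub>R z) ^ 2"]
    have "a * n (\<tau> *\<^sub>R z) ^ 2 + b * n (\<tau> *\<^sub>R z) ^ 4 \<le> 2 * a * n (\<tau> *\<^sub>R z) ^ 2"
      by (simp add: power2_eq_square power4_eq_xxxx mult.assoc)
    also have "\<dots> = 2 * a * \<tau>\<^sup>2 * n z ^ 2" using z \<tau> by (simp add: n_scale power_mult_distrib)
    also have "\<dots> \<le> 2 * a * \<tau>\<^sup>2 * n u ^ 2" using ab nz z by (intro mult_left_mono power_mono) auto
    also have "\<dots> = \<tau> powr p * (a / 4 * n u ^ 2)"
    proof -
      have "\<tau> powr p = \<tau> powr (p - 2) * \<tau>\<^sup>2" using \<tau>(1) by (simp add: powr_diff)
      then show ?thesis unfolding \<tau>(2) by simp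
    qed
    also have "\<dots> \<le> \<tau> powr p * (lam * J p z)" using Jz by (intro mult_left_mono) auto
    also have "\<dots> = lam * J p (\<tau> *\<^sub>R z)" using z \<tau> by (simp add: J_scale)
    finally show ?thesis unfolding g_def using J_nonneg[of s "\<tau> *\<^sub>R z"] by linarith
  qed
  obtain t where t: "0 < t" "t \<le> \<tau>" "t *\<^sub>R z \<in> N"
    using N_meets_ray_from_0[OF z nz0, of \<tau>] n\<tau>[of \<tau> z] \<tau> g\<tau> z nz by auto
  have nt: "n (t *\<^sub>R u) \<le> r" "n (t *\<^sub>R w) \<le> r" using n\<tau> t u' w' le by auto
  have tz: "t *\<^sub>R z + t *\<^sub>R d = t *\<^sub>R u" "t *\<^sub>R z - t *\<^sub>R d = t *\<^sub>R w"
    using zd by (simp_all flip: scaleR_add_right scaleR_diff_right)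
  have "E lam (t *\<^sub>R z) + a / 4 * n (t *\<^sub>R d) ^ 2 \<le> (E lam (t *\<^sub>R u) + E lam (t *\<^sub>R w)) / 2
           + lam / p * ((J p (t *\<^sub>R u) + J p (t *\<^sub>R w)) / 2 - J p (t *\<^sub>R z))"
    using E_midpoint[of "t *\<^sub>R z" "t *\<^sub>R d"] z dV nt by (simp add: tz)
  moreover have "E lam (t *\<^sub>R u) \<le> c + e" "E lam (t *\<^sub>R w) \<le> c + e"
    using E_max_on_ray[OF u t(1) nt(1)] E_max_on_ray[OF w t(1) nt(2)] c by linarith+
  moreover have "c \<le> E lam (t *\<^sub>R z)" using c t by blast
  moreover have "lam / p * ((J p (t *\<^sub>R u) + J p (t *\<^sub>R w)) / 2 - J p (t *\<^sub>R z)) \<le> lam / p * \<tau> powr p * D d"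
  proof -
    have "\<bar>J p w - J p z\<bar> \<le> D d"
      using J_p_increment(2)[of z "(-1) *\<^sub>R d"] z dV nzr md zd m_scale[of p d "-1"] V_closed(2)[OF dV, of "-1"]
      by (simp add: D_def)
    then have "(J p u + J p w) / 2 - J p z \<le> D d" using Ju by (simp add: abs_le_iff field_simps)
    then have "t powr p * ((J p u + J p w) / 2 - J p z) \<le> \<tau> powr p * D d"
      using t ps Ju by (intro order_trans[OF mult_left_mono mult_right_mono[OF powr_mono2]]) auto
    then have "lam / p * (t powr p * ((J p u + J p w) / 2 - J p z)) \<le> lam / p * (\<tau> powr p * D d)"
      using lam ps by (intro mult_left_mono) auto
    then show ?thesis using u' w' z t by (simp add: J_scale algebra_simps)
  qed
  \<comment> \<open>The rescaled midpoint has norm at least \<open>\<rho>\<close>, being in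
    \<open>N\<close>, while \<open>n z \<le> r\<close>; hence \<open>t\<close> is at least
    \<open>\<rho> / r\<close>, and the distance is not lost by rescaling.\<close>
  moreover have "(\<rho> / r)\<^sup>2 * (a / 4) * n d ^ 2 \<le> a / 4 * n (t *\<^sub>R d) ^ 2"
  proof -
    have "\<rho> \<le> t * n z" using N_ge_\<rho>[OF t(3)] z t by (simp add: n_scale)
    also have "\<dots> \<le> t * r" using nzr t by (intro mult_left_mono) auto
    finally have "\<rho> / r \<le> t" using r by (simp add: field_simps)
    then have "(\<rho> / r)\<^sup>2 \<le> t\<^sup>2" using \<rho>(1) r by (intro power_mono) auto
    then have "(\<rho> / r)\<^sup>2 * (a / 4 * n d ^ 2) \<le> t\<^sup>2 * (a / 4 * n d ^ 2)" using ab by (intro mult_right_mono) auto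
    then show ?thesis using dV t by (simp add: n_scale power_mult_distrib mult_ac)
  qed
  ultimately show ?thesis by argo
qed

text \<open>By \<open>E_ge_on_N\<close> an energy below
  \<open>\<delta> * (r / \<tau>)\<^sup>2\<close> confines a minimising sequence to norms up to
  \<open>r / \<tau>\<close>, the room that \<open>N_pair\<close> requires. Compactness in the
  \<open>p\<close>-norm along a subsequence then makes the sequence Cauchy.\<close>

lemma minimizer_exists:
  assumes "u0 \<in> N" "E lam u0 < \<delta> * (r / \<tau>)\<^sup>2"
  shows "\<exists>v\<in>N. n v \<le> r / \<tau> \<and> (\<forall>u\<in>N. E lam v \<le> E lam u)"
proof -
  define c where "c = Inf (E lam ` N)"
  have E0: "0 \<le> E lam u" if "u \<in> N" for u using E_ge_on_N[OF that] \<delta>_pos by (smt (verit) mult_nonneg_nonneg zero_le_power2)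
  have bdd: "bdd_below (E lam ` N)" using E0 by (auto intro!: bdd_belowI)
  have c: "c \<le> E lam u" if "u \<in> N" for u unfolding c_def using bdd that by (intro cInf_lower) auto
  have ex: "\<exists>u\<in>N. E lam u < y" if "c < y" for y
    using that assms(1) cInf_less_iff[OF _ bdd, of y] unfolding c_def by auto
  have c0: "c < \<delta> * (r / \<tau>)\<^sup>2" using c[OF assms(1)] assms(2) by linarith
  have "\<forall>k. \<exists>u\<in>N. E lam u < c + 1 / real (Suc k) \<and> E lam u < \<delta> * (r / \<tau>)\<^sup>2"
    using ex[of "min (c + 1 / real (Suc k)) (\<delta> * (r / \<tau>)\<^sup>2)" for k] c0 by auto
  then obtain x where x: "\<And>k. x k \<in> N" "\<And>k. E lam (x k) < c + 1 / real (Suc k)"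
    "\<And>k. E lam (x k) < \<delta> * (r / \<tau>)\<^sup>2" by metis
  have nx: "n (x k) \<le> r / \<tau>" for k
  proof -
    have "\<delta> * n (x k) ^ 2 < \<delta> * (r / \<tau>)\<^sup>2" using E_ge_on_N[OF x(1)] x(3) by (rule le_less_trans)
    then have "n (x k) ^ 2 < (r / \<tau>)\<^sup>2" using \<delta>_pos mult_less_cancel_left_pos by blast
    moreover have "0 \<le> r / \<tau>" using r \<tau>(1) by simp
    ultimately show ?thesis using power2_less_imp_less by (metis less_imp_le)
  qed
  obtain \<sigma> :: "nat \<Rightarrow> nat" where \<sigma>: "strict_mono \<sigma>"
    and comp: "\<forall>\<epsilon>>0. \<exists>M. \<forall>i\<ge>M. \<forall>j\<ge>M. m p (x (\<sigma> i) - x (\<sigma> j)) < \<epsilon>"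
    using compact[of x "r / \<tau>", OF N_D(1)[OF x(1)] nx[unfolded n_def]] by blast
  define y where "y = x \<circ> \<sigma>"
  have y: "y k \<in> N" "y k \<in> V" "n (y k) \<le> r / \<tau>" "E lam (y k) < c + 1 / real (Suc k)" for k
  proof -
    show "y k \<in> N" "y k \<in> V" "n (y k) \<le> r / \<tau>" using x N_D nx by (auto simp: y_def)
    have "1 / real (Suc (\<sigma> k)) \<le> 1 / real (Suc k)" using seq_suble[OF \<sigma>, of k] by (intro divide_left_mono) auto
    then show "E lam (y k) < c + 1 / real (Suc k)" using x(2)[of "\<sigma> k"] by (simp add: y_def)
  qed
  define C where "C = K * ((K * r) powr (p - 1) + (K * r) powr (p - 2) + 1)"
  have C: "C > 0" using K by (simp add: C_def add_nonneg_pos)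
  have DC: "D d = C * m p d" for d by (simp add: D_def C_def)
  have Cauchy: "\<exists>M. \<forall>i\<ge>M. \<forall>j\<ge>M. n (y i - y j) < \<epsilon>" if \<epsilon>: "\<epsilon> > 0" for \<epsilon>
  proof -
    define \<kappa> where "\<kappa> = (\<rho> / r)\<^sup>2 * (a / 4) * (\<epsilon> / 2)\<^sup>2"
    have \<kappa>: "\<kappa> > 0" using \<rho>(1) r ab \<epsilon> by (simp add: \<kappa>_def)
    \<comment> \<open>The three entries guarantee, in turn, \<open>m p d \<le> 1\<close>, the
      hypothesis of \<open>N_pair\<close> on \<open>lam * D d\<close>, and a subcritical error below
      \<open>\<kappa> / 2\<close>.\<close>
    define \<eta> where "\<eta> = Min {1, a / 4 * \<rho>\<^sup>2 / (lam * C), \<kappa> / 2 / (lam / p * \<tau> powr p * C)}"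
    have \<eta>: "\<eta> > 0" using \<rho>(1) ab C lam ps \<kappa> \<tau> by (simp add: \<eta>_def)
    obtain M1 where M1: "\<And>i j. i \<ge> M1 \<Longrightarrow> j \<ge> M1 \<Longrightarrow> m p (y i - y j) < \<eta>"
      using comp \<eta> unfolding y_def comp_def by blast
    obtain M2 where M2: "1 / real (Suc M2) < \<kappa> / 2" using \<kappa> by (metis half_gt_zero nat_approx_posE)
    have small: "n (y i - y j) < \<epsilon>" if ij: "max M1 M2 \<le> i" "max M1 M2 \<le> j" "n (y j) \<le> n (y i)" for i j
    proof -
      define d where "d = (1 / 2) *\<^sub>R (y i - y j)"
      have dV: "d \<in> V" using y by (simp add: d_def)
      have "m p d \<le> m p (y i - y j)" using m_scale[of p "y i - y j" "1/2"] y m_nonneg[of p "y i - y j"] by (simp add: d_def)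
      then have md: "m p d < \<eta>" using M1[of i j] ij by linarith
      have e: "1 / real (Suc k) \<le> 1 / real (Suc M2)" if "M2 \<le> k" for k using that by (intro divide_left_mono) auto
      have "lam * D d \<le> a / 4 * \<rho>\<^sup>2" "lam / p * \<tau> powr p * D d < \<kappa> / 2"
        using md C lam ps \<tau> by (auto simp: DC \<eta>_def field_simps)
      moreover have "E lam (y i) \<le> c + 1 / real (Suc M2)" "E lam (y j) \<le> c + 1 / real (Suc M2)"
        using y(4)[of i] y(4)[of j] e[of i] e[of j] ij by auto
      moreover have "m p d \<le> 1" using md by (simp add: \<eta>_def)
      ultimately have "(\<rho> / r)\<^sup>2 * (a / 4) * n d ^ 2 \<le> 1 / real (Suc M2) + lam / p * \<tau> powr p * D d"
        using y ij c by (intro N_pair[OF _ _ _ _ _ _ _ d_def]) auto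
      also have "\<dots> < (\<rho> / r)\<^sup>2 * (a / 4) * (\<epsilon> / 2)\<^sup>2"
        using add_strict_mono[OF M2 \<open>lam / p * \<tau> powr p * D d < \<kappa> / 2\<close>]
        unfolding \<kappa>_def[symmetric] by simp
      finally have "n d ^ 2 < (\<epsilon> / 2)\<^sup>2" using \<rho>(1) r ab by simp
      then have "n d < \<epsilon> / 2" by (rule power2_less_imp_less) (use \<epsilon> in simp)
      then show ?thesis using y by (simp add: d_def n_scale)
    qed
    \<comment> \<open>\<open>N_pair\<close> expects the point of larger norm first; symmetry of the
      distance removes the ordering.\<close>
    have sym: "n (y i - y j) = n (y j - y i)" for i j using n_scale[of "y i - y j" "-1"] y by simp
    have "n (y i - y j) < \<epsilon>" if "max M1 M2 \<le> i" "max M1 M2 \<le> j" for i j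
      using small[of i j] small[of j i] that sym[of i j] by linarith
    then show ?thesis by blast
  qed
  obtain v where v: "v \<in> V" and lim: "(\<lambda>k. n (y k - v)) \<longlonglongrightarrow> 0"
    using complete[of y] y(2) Cauchy unfolding n_def by blast
  have nv: "(\<lambda>k. n (y k)) \<longlonglongrightarrow> n v" by (rule n_tendsto[OF y(2) v lim])
  have "n v \<le> r / \<tau>" by (rule LIMSEQ_le_const2[OF nv]) (use y in auto)
  \<comment> \<open>The uniform lower bound on \<open>N\<close> survives the limit, so
    \<open>v\<close> is nonzero and belongs to \<open>N\<close>.\<close>
  moreover have "\<rho> \<le> n v" by (rule LIMSEQ_le_const[OF nv]) (use y N_ge_\<rho> in auto)
  moreover have "g lam v = 0" using g_tendsto[OF y(2) v lim, of lam] N_D(4)[OF y(1)] by (simp add: LIMSEQ_const_iff)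
  moreover have "r / \<tau> \<le> r" using r \<tau> by (simp add: divide_le_eq)
  ultimately have vN: "v \<in> N" "n v \<le> r / \<tau>" using v \<rho>(1) by (auto simp: N_def)
  have "E lam v \<le> c + 0"
  proof (rule LIMSEQ_le[OF E_tendsto[OF y(2) v lim]])
    show "(\<lambda>k. c + 1 / real (Suc k)) \<longlonglongrightarrow> c + 0"
      by (intro tendsto_intros LIMSEQ_Suc[OF lim_1_over_n])
  qed (use y(4) less_imp_le in blast)
  then show ?thesis using vN c by (intro bexI[of _ v]) (auto intro: order_trans)
qed

text \<open>A descent direction \<open>h\<close> would give points of \<open>N\<close> near
  \<open>v\<close> with lower energy. The rescaling \<open>t\<close> that brings
  \<open>v + k h\<close> back to \<open>N\<close> is known only to lie in a short interval around 1,
  so the descent is established uniformly for all \<open>t\<close> in it, and the passage from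
  \<open>v\<close> to \<open>t *\<^sub>R v\<close> is paid for by maximality along the ray.\<close>

lemma minimizer_dE_nonneg:
  assumes v: "v \<in> N" "n v < r" and min: "\<And>u. u \<in> N \<Longrightarrow> E lam v \<le> E lam u" and h: "h \<in> V"
  shows "0 \<le> dE lam v h"
proof (rule ccontr)
  note v' = N_D[OF v(1)]
  define \<eta> where "\<eta> = - dE lam v h"
  assume "\<not> 0 \<le> dE lam v h"
  then have \<eta>: "0 < \<eta>" by (simp add: \<eta>_def)
  \<comment> \<open>The derivative at \<open>t *\<^sub>R v\<close> in direction \<open>h\<close>,
    written out so that its continuity in \<open>t\<close> is visible.\<close>
  define \<psi> where "\<psi> t = (a + b * (t\<^sup>2 * n v ^ 2)) * (t * ip v h) - t powr (s - 1) * T s v h / s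
      - lam * (t powr (p - 1) * T p v h) / p" for t
  have dE\<psi>: "dE lam (t *\<^sub>R v) h = \<psi> t" if "0 < t" for t
    using v' h that by (simp add: dE_def \<psi>_def n_scale ip_scale_left T_scale_left power_mult_distrib)
  have "isCont \<psi> 1" unfolding \<psi>_def using ps by (intro continuous_intros) auto
  then have "\<psi> \<midarrow>1\<rightarrow> \<psi> 1" by (simp add: isCont_def)
  moreover have "\<psi> 1 < - \<eta> / 2" using dE\<psi>[of 1] \<eta> by (simp add: \<eta>_def)
  ultimately have "\<forall>\<^sub>F t in at 1. \<psi> t < - \<eta> / 2" by (rule order_tendstoD)
  then obtain d where d: "0 < d" "\<And>t. t \<noteq> 1 \<Longrightarrow> dist t 1 < d \<Longrightarrow> \<psi> t < - \<eta> / 2"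
    unfolding eventually_at by auto
  \<comment> \<open>The entries keep the rescaling between 1/2 and 3/2, keep \<open>\<psi>\<close>
    below \<open>- \<eta> / 2\<close>, and keep the stretched point inside the ball, which uses
    \<open>n v < r\<close>.\<close>
  define \<sigma> where "\<sigma> = Min {1 / 2, d / 2, (r / n v - 1) / 2}"
  have \<sigma>0: "0 < \<sigma>" "\<sigma> \<le> 1 / 2" "\<sigma> < d" using d v v' by (auto simp: \<sigma>_def field_simps)
  have \<psi>\<sigma>: "\<psi> t < - \<eta> / 2" if "1 - \<sigma> \<le> t" "t \<le> 1 + \<sigma>" for t
    using d(2)[of t] that \<sigma>0 \<open>\<psi> 1 < - \<eta> / 2\<close> by (cases "t = 1") (auto simp: dist_real_def abs_real_def)
  have "\<sigma> \<le> (r / n v - 1) / 2" unfolding \<sigma>_def by (intro Min_le) auto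
  also have "\<dots> < r / n v - 1"
  proof -
    have half: "y / 2 < y" if "0 < y" for y :: real using that by simp
    show ?thesis using v v' by (intro half) simp
  qed
  finally have "\<sigma> < r / n v - 1" .
  then have \<sigma>r: "(1 + \<sigma>) * n v < r" using v' by (simp add: field_simps)
  have \<sigma>r': "(1 - \<sigma>) * n v \<le> r" using \<sigma>r \<sigma>0 v' mult_right_mono[of "1 - \<sigma>" "1 + \<sigma>" "n v"] by linarith
  obtain C where C: "C \<ge> 0" "\<And>u h. u \<in> V \<Longrightarrow> h \<in> V \<Longrightarrow> n u \<le> r \<Longrightarrow> n h \<le> 1 \<Longrightarrow>
      \<bar>E lam (u + h) - E lam u - dE lam u h\<bar> \<le> C * n h ^ 2"
    using E_taylor[of lam r] lam r by auto
  let ?F = "at_right (0::real)"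
  have conv: "((\<lambda>k. n (t *\<^sub>R (v + k *\<^sub>R h) - t *\<^sub>R v)) \<longlongrightarrow> 0) ?F" for t
  proof -
    have "n (t *\<^sub>R (v + k *\<^sub>R h) - t *\<^sub>R v) = \<bar>t * k\<bar> * n h" for k
      using n_scale[of h "t * k"] h by (simp add: scaleR_add_right)
    moreover have "((\<lambda>k. \<bar>t * k\<bar> * n h) \<longlongrightarrow> \<bar>t * 0\<bar> * n h) ?F" by (intro tendsto_intros)
    ultimately show ?thesis by simp
  qed
  have inV: "t *\<^sub>R (v + k *\<^sub>R h) \<in> V" "t *\<^sub>R v \<in> V" for t k using v' h by auto
  have lims: "((\<lambda>k. g lam (t *\<^sub>R (v + k *\<^sub>R h))) \<longlongrightarrow> g lam (t *\<^sub>R v)) ?F"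
    "((\<lambda>k. n (t *\<^sub>R (v + k *\<^sub>R h))) \<longlongrightarrow> n (t *\<^sub>R v)) ?F" for t
    by (rule g_tendsto n_tendsto, rule inV, rule inV, rule conv)+
  have "\<forall>\<^sub>F k in ?F. 0 < g lam ((1 - \<sigma>) *\<^sub>R (v + k *\<^sub>R h))"
    using g_ray_sign(1)[OF v(1), of "1 - \<sigma>"] \<sigma>0 \<sigma>r' v' by (intro order_tendstoD(1)[OF lims(1)]) (simp add: n_scale)
  moreover have "\<forall>\<^sub>F k in ?F. g lam ((1 + \<sigma>) *\<^sub>R (v + k *\<^sub>R h)) < 0"
    using g_ray_sign(2)[OF v(1), of "1 + \<sigma>"] \<sigma>0 \<sigma>r v' by (intro order_tendstoD(2)[OF lims(1)]) (simp add: n_scale)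
  moreover have "\<forall>\<^sub>F k in ?F. n ((1 + \<sigma>) *\<^sub>R (v + k *\<^sub>R h)) < r"
    using \<sigma>r \<sigma>0 v' by (intro order_tendstoD(2)[OF lims(2)]) (simp add: n_scale)
  moreover have "\<forall>\<^sub>F k in ?F. 0 < n (1 *\<^sub>R (v + k *\<^sub>R h))"
    using v' by (intro order_tendstoD(1)[OF lims(2)]) simp
  \<comment> \<open>In this condition and the next the factor 2 stands for an upper bound of
    \<open>t\<close>, which is determined only after \<open>k\<close>.\<close>
  moreover have "\<forall>\<^sub>F k in ?F. 2 * k * n h < 1"
    by (rule order_tendstoD(2)[of _ "2 * 0 * n h"], intro tendsto_intros) simp
  moreover have "\<forall>\<^sub>F k in ?F. 2 * C * k * n h ^ 2 < \<eta> / 2"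
    by (rule order_tendstoD(2)[of _ "2 * C * 0 * n h ^ 2"], intro tendsto_intros) (simp add: \<eta>)
  moreover have "\<forall>\<^sub>F k in ?F. 0 < k" by (rule eventually_at_right_less)
  ultimately have "\<forall>\<^sub>F k in ?F. 0 < g lam ((1 - \<sigma>) *\<^sub>R (v + k *\<^sub>R h)) \<and> g lam ((1 + \<sigma>) *\<^sub>R (v + k *\<^sub>R h)) < 0 \<and>
      n ((1 + \<sigma>) *\<^sub>R (v + k *\<^sub>R h)) < r \<and> 0 < n (v + k *\<^sub>R h) \<and> 2 * k * n h < 1 \<and> 2 * C * k * n h ^ 2 < \<eta> / 2 \<and> 0 < k"
    by eventually_elim simp
  then obtain k where k: "0 < g lam ((1 - \<sigma>) *\<^sub>R (v + k *\<^sub>R h))" "g lam ((1 + \<sigma>) *\<^sub>R (v + k *\<^sub>R h)) < 0"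
      "n ((1 + \<sigma>) *\<^sub>R (v + k *\<^sub>R h)) < r" "0 < n (v + k *\<^sub>R h)" "2 * k * n h < 1" "2 * C * k * n h ^ 2 < \<eta> / 2" "0 < k"
    using eventually_happens'[OF trivial_limit_at_right_real] by blast
  obtain t where t: "1 - \<sigma> \<le> t" "t \<le> 1 + \<sigma>" "t *\<^sub>R (v + k *\<^sub>R h) \<in> N"
    using N_meets_ray[of "v + k *\<^sub>R h" "1 - \<sigma>" "1 + \<sigma>"] k \<sigma>0 v' h by auto
  have t0: "0 < t" "t \<le> 2" using t \<sigma>0 by auto
  have "t * n v \<le> (1 + \<sigma>) * n v" using t v' by (intro mult_right_mono) auto
  then have "t * n v \<le> r" using \<sigma>r by linarith
  then have ntv: "n (t *\<^sub>R v) \<le> r" using t0 v' by (simp add: n_scale)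
  have "t * k * n h \<le> 2 * k * n h" using t0 k h by (intro mult_right_mono) auto
  then have "t * k * n h \<le> 1" using k(5) by linarith
  then have nth: "n ((t * k) *\<^sub>R h) \<le> 1" using k t0 h by (simp add: n_scale)
  have "E lam v \<le> E lam (t *\<^sub>R v + (t * k) *\<^sub>R h)" using min[OF t(3)] by (simp add: scaleR_add_right)
  \<comment> \<open>The expansion is taken at \<open>t *\<^sub>R v\<close>, whose energy is at most
    that of \<open>v\<close>; only a descent of first order in \<open>k\<close> and an error of
    second order remain.\<close>
  also have "\<dots> \<le> E lam (t *\<^sub>R v) + dE lam (t *\<^sub>R v) ((t * k) *\<^sub>R h) + C * n ((t * k) *\<^sub>R h) ^ 2"
    using C(2)[of "t *\<^sub>R v" "(t * k) *\<^sub>R h"] v' h ntv nth by (simp add: abs_le_iff)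
  finally have ge: "0 \<le> dE lam (t *\<^sub>R v) ((t * k) *\<^sub>R h) + C * n ((t * k) *\<^sub>R h) ^ 2"
    using E_max_on_ray[OF v(1) t0(1) ntv] by simp
  have "dE lam (t *\<^sub>R v) ((t * k) *\<^sub>R h) = (t * k) * \<psi> t"
    using v' h by (simp add: dE\<psi>[OF t0(1), symmetric] dE_def ip_scale_right T_scale algebra_simps)
  also have "\<dots> \<le> (t * k) * (- \<eta> / 2)" using \<psi>\<sigma>[OF t(1,2)] t0 k by (intro mult_left_mono) auto
  finally have "dE lam (t *\<^sub>R v) ((t * k) *\<^sub>R h) \<le> (t * k) * (- \<eta> / 2)" .
  moreover have "C * n ((t * k) *\<^sub>R h) ^ 2 = (t * k) * (t * C * k * n h ^ 2)"
    using h by (simp add: n_scale power_mult_distrib power2_eq_square)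
  moreover have "(t * k) * (t * (C * k * n h ^ 2) - \<eta> / 2) = (t * k) * (- \<eta> / 2) + (t * k) * (t * C * k * n h ^ 2)"
    by (simp add: algebra_simps)
  ultimately have "0 \<le> (t * k) * (t * (C * k * n h ^ 2) - \<eta> / 2)" using ge by linarith
  moreover have "0 < t * k" using t0 k by simp
  ultimately have "0 \<le> t * (C * k * n h ^ 2) - \<eta> / 2" using zero_le_mult_iff by (metis not_less)
  moreover have "t * (C * k * n h ^ 2) \<le> 2 * (C * k * n h ^ 2)" using t0 k C by (intro mult_right_mono) auto
  ultimately show False using k by simp
qed

end

text \<open>Criticality is stated as a quadratic bound on the energy increment, which contains the
  vanishing of the derivative. The radius is fixed first, from \<open>a\<close>, \<open>b\<close>,
  \<open>p\<close>, \<open>s\<close> and \<open>K\<close>; a multiple \<open>w'\<close> of a fixed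
  vector then determines how large \<open>lam\<close> must be.\<close>

lemma (in nehari) critical_point_exists:
  "\<exists>lam0>0. \<forall>lam>lam0. \<exists>v\<in>V. 0 < m p v \<and> 0 < E lam v \<and>
     (\<exists>C. \<forall>h\<in>V. n h \<le> 1 \<longrightarrow> \<bar>E lam (v + h) - E lam v\<bar> \<le> C * n h ^ 2)"
proof -
  let ?F = "at_right (0::real)"
  have "\<forall>\<^sub>F r in ?F. 8 * b * r\<^sup>2 < a * (p - 2)"
    using ab ps by (intro order_tendstoD(2)[of _ "8 * b * 0\<^sup>2"] tendsto_intros) auto
  moreover have "\<forall>\<^sub>F r in ?F. b * r\<^sup>2 < a"
    using ab by (intro order_tendstoD(2)[of _ "b * 0\<^sup>2"] tendsto_intros) auto
  moreover have "\<forall>\<^sub>F r in ?F. 8 * K powr (s + 1) * r powr (s - 2) < a"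
  proof (rule order_tendstoD(2))
    have "((\<lambda>r. r powr (s - 2)) \<longlongrightarrow> 0 powr (s - 2)) ?F"
      using ps eventually_mono[OF eventually_at_right_less[of "0::real"] less_imp_le]
      by (intro tendsto_powr'[OF tendsto_ident_at tendsto_const]) auto
    then show "((\<lambda>r. 8 * K powr (s + 1) * r powr (s - 2)) \<longlongrightarrow> 8 * K powr (s + 1) * 0 powr (s - 2)) ?F"
      by (rule tendsto_mult_left)
  qed (use ab in simp)
  moreover have "\<forall>\<^sub>F r in ?F. 0 < r" by (rule eventually_at_right_less)
  ultimately have "\<forall>\<^sub>F r in ?F. 8 * b * r\<^sup>2 < a * (p - 2) \<and> b * r\<^sup>2 < a \<and>
      8 * K powr (s + 1) * r powr (s - 2) < a \<and> 0 < r" by eventually_elim simp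
  then obtain r where r: "8 * b * r\<^sup>2 < a * (p - 2)" "b * r\<^sup>2 < a"
      "8 * K powr (s + 1) * r powr (s - 2) < a" "0 < r"
    using eventually_happens'[OF trivial_limit_at_right_real] by blast
  have ball: "nehari_ball V ip m T K p s a b r lam" if "0 < lam" for lam
    using r that by unfold_locales auto
  obtain w where w: "w \<in> V" "0 < m p w" using nontrivial by blast
  have nw: "0 < n w"
  proof -
    have "0 < K * n w" using m_bound_n[of p w] w by auto
    then show ?thesis using K by (simp add: zero_less_mult_iff)
  qed
  define \<theta> where "\<theta> = (8::real) powr (1 / (p - 2))"
  have \<theta>1: "1 \<le> \<theta>" using ps by (simp add: \<theta>_def ge_one_powr_ge_zero)
  \<comment> \<open>Chosen so that \<open>a * \<epsilon>\<^sup>2\<close> is half of the energy level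
    \<open>\<delta> * (r / \<tau>)\<^sup>2\<close>; points of \<open>N\<close> of norm at most
    \<open>\<epsilon>\<close> then satisfy the hypothesis of
    \<open>minimizer_exists\<close>.\<close>
  define \<epsilon> where "\<epsilon> = sqrt ((p - 2) / (8 * p)) * (r / \<theta>)"
  have \<epsilon>0: "0 < \<epsilon>" using ps r \<theta>1 by (simp add: \<epsilon>_def)
  have "sqrt ((p - 2) / (8 * p)) \<le> 1" using ps by (simp add: field_simps)
  moreover have "r / \<theta> \<le> r" using r \<theta>1 by (simp add: divide_le_eq)
  ultimately have \<epsilon>r: "\<epsilon> \<le> r" using r \<theta>1 mult_mono[of "sqrt ((p - 2) / (8 * p))" 1 "r / \<theta>" r]
    by (simp add: \<epsilon>_def)
  have \<epsilon>2: "\<epsilon>\<^sup>2 = (p - 2) / (8 * p) * (r / \<theta>)\<^sup>2" unfolding \<epsilon>_def power_mult_distrib using ps by simp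
  define w' where "w' = (\<epsilon> / n w) *\<^sub>R w"
  have w': "w' \<in> V" "n w' = \<epsilon>" using w nw \<epsilon>0 by (simp_all add: w'_def n_scale)
  have Jw: "0 < J p w'" using w nw \<epsilon>0 by (simp add: w'_def J_def m_scale)
  \<comment> \<open>Above this value the subcritical term at \<open>w'\<close> exceeds the quadratic
    and quartic ones, so \<open>g\<close> is negative there and the ray meets \<open>N\<close>
    before \<open>w'\<close>.\<close>
  define lam0 where "lam0 = (a * \<epsilon>\<^sup>2 + b * \<epsilon> ^ 4) / J p w'"
  have "0 < lam0" using ab \<epsilon>0 Jw by (simp add: lam0_def add_pos_pos)
  moreover have "\<exists>v\<in>V. 0 < m p v \<and> 0 < E lam v \<and> (\<exists>C. \<forall>h\<in>V. n h \<le> 1 \<longrightarrow> \<bar>E lam (v + h) - E lam v\<bar> \<le> C * n h ^ 2)"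
    if lam_gt: "lam0 < lam" for lam
  proof -
    have lam': "0 < lam" using lam_gt \<open>0 < lam0\<close> by linarith
    interpret nehari_ball V ip m T K p s a b r lam by (rule ball[OF lam'])
    have \<theta>: "\<theta> = \<tau>" unfolding \<theta>_def \<tau>_def ..
    have "a * \<epsilon>\<^sup>2 + b * \<epsilon> ^ 4 < lam * J p w'" using lam_gt Jw by (simp add: lam0_def divide_less_eq)
    then have "g lam (1 *\<^sub>R w') \<le> 0"
      using J_nonneg[of s w'] unfolding g_def scaleR_one w'(2) by linarith
    then obtain t where t: "0 < t" "t \<le> 1" "t *\<^sub>R w' \<in> N"
      using N_meets_ray_from_0[of w' 1] w' \<epsilon>0 \<epsilon>r by auto
    define u where "u = t *\<^sub>R w'"
    have u: "u \<in> N" using t by (simp add: u_def)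
    have nu: "n u \<le> \<epsilon>" using t w' \<epsilon>0 by (simp add: u_def n_scale)
    have "b * n u ^ 2 * n u ^ 2 \<le> a * n u ^ 2"
    proof (rule mult_right_mono)
      have "b * n u ^ 2 \<le> b * r\<^sup>2" using N_D[OF u] ab by (intro mult_left_mono power_mono) auto
      then show "b * n u ^ 2 \<le> a" using r_kirchhoff by linarith
    qed simp
    then have "E lam u \<le> a * n u ^ 2 - a / 4 * n u ^ 2 - J s u / s - lam * J p u / p"
      unfolding E_def by (simp add: power2_eq_square power4_eq_xxxx)
    also have "\<dots> \<le> a * n u ^ 2 - a / 4 * n u ^ 2"
    proof -
      have "0 \<le> J s u / s" "0 \<le> lam * J p u / p" using ps lam' by simp_all
      then show ?thesis by linarith
    qed
    also have "\<dots> < a * n u ^ 2" using ab N_D[OF u] by simp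
    also have "\<dots> \<le> a * \<epsilon>\<^sup>2" using nu ab N_D[OF u] by (intro mult_left_mono power_mono) auto
    also have "\<dots> = \<delta> * (r / \<theta>)\<^sup>2 / 2" unfolding \<epsilon>2 \<delta>_def by simp
    also have "\<dots> \<le> \<delta> * (r / \<theta>)\<^sup>2" using \<delta>_pos by simp
    finally obtain v where v: "v \<in> N" "n v \<le> r / \<theta>" and min: "\<And>u. u \<in> N \<Longrightarrow> E lam v \<le> E lam u"
      using minimizer_exists[OF u] unfolding \<theta> by blast
    note v' = N_D[OF v(1)]
    have "1 < \<theta>" using ps by (simp add: \<theta>_def)
    then have "r / \<theta> < r" using r by (simp add: divide_less_eq)
    then have nvr: "n v < r" using v by simp
    have "0 < \<delta> * n v ^ 2" using \<delta>_pos v' by simp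
    then have Ev: "0 < E lam v" using E_ge_on_N[OF v(1)] by linarith
    have "J p v \<noteq> 0"
    proof
      assume "J p v = 0"
      then have "a / 2 * n v ^ 2 \<le> 0" using J_p_ge_on_N[OF v(1)] by simp
      then show False using ab v' by (simp add: mult_le_0_iff)
    qed
    then have mv: "0 < m p v" using m_nonneg[of p v] by (cases "m p v = 0") (auto simp: J_def)
    have crit: "dE lam v h = 0" if h: "h \<in> V" for h
    proof -
      \<comment> \<open>The one-sided inequality for \<open>h\<close> and for its negative gives
        equality.\<close>
      have "0 \<le> dE lam v h" "0 \<le> dE lam v ((-1) *\<^sub>R h)"
        using minimizer_dE_nonneg[OF v(1) nvr min] h V_closed(2)[OF h, of "-1"] by blast+
      moreover have "dE lam v ((-1) *\<^sub>R h) = - dE lam v h"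
        using ip_scale_right[of v h "-1"] T_scale[of s v h "-1"] T_scale[of p v h "-1"] v' h
        by (simp add: dE_def)
      ultimately show ?thesis by simp
    qed
    obtain C where "\<forall>u\<in>V. \<forall>h\<in>V. n u \<le> r \<longrightarrow> n h \<le> 1 \<longrightarrow> \<bar>E lam (u + h) - E lam u - dE lam u h\<bar> \<le> C * n h ^ 2"
      using E_taylor[of lam r] lam' r by auto
    then have "\<forall>h\<in>V. n h \<le> 1 \<longrightarrow> \<bar>E lam (v + h) - E lam v\<bar> \<le> C * n h ^ 2" using v' crit by force
    then show ?thesis using v' mv Ev by blast
  qed
  ultimately show ?thesis by blast
qed

section \<open>The Dirichlet space\<close>

lemma powr_2_eq: "0 \<le> x \<Longrightarrow> x powr 2 = (x::real)\<^sup>2"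
  by (cases "x = 0") auto

lemma Lspace_eq_L2: "Lspace \<Omega> 2 = (L2 (lebesgue_on \<Omega>) :: (real^'n \<Rightarrow> 'b::euclidean_space) set)"
  by (simp add: Lspace_def L2_def powr_2_eq)

lemma Lnorm_eq_N2: "Lnorm \<Omega> 2 f = sqrt (N2 (lebesgue_on \<Omega>) f)"
  by (simp add: Lnorm_def N2_def powr_2_eq powr_half_sqrt)

lemma Lnorm_eq_Lqn: "Lnorm \<Omega> q u = Lqn (lebesgue_on \<Omega>) q u"
  by (simp add: Lnorm_def Lqn_def)

lemma LIMSEQ_squeeze_0:
  fixes f c :: "nat \<Rightarrow> real"
  assumes "\<And>k. 0 \<le> f k" "\<And>k. f k \<le> c k" "c \<longlonglongrightarrow> 0"
  shows "f \<longlonglongrightarrow> 0"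
  by (rule tendsto_sandwich[OF _ _ tendsto_const assms(3)]) (use assms in auto)

locale dirichlet =
  fixes \<Omega> :: "(real^'n) set" and s :: real
  assumes s_eq: "s = critical_exponent CARD('n)" and open_\<Omega>: "open \<Omega>" and bounded_\<Omega>: "bounded \<Omega>" and dim: "CARD('n) > 2"
begin

abbreviation M where "M \<equiv> lebesgue_on \<Omega>"

lemma sets_\<Omega>: "\<Omega> \<in> sets lebesgue" using open_\<Omega> by auto

sublocale finite_measure M
  using open_\<Omega> bounded_\<Omega> by (intro finite_measure_lebesgue_on lmeasurable_open)

lemma s_gt_2: "s > 2"
proof -
  have "real CARD('n) > 2" using dim by simp
  then show ?thesis unfolding s_eq critical_exponent_def by (simp add: less_divide_eq)
qed

lemma borel_measurable_M: "f \<in> borel_measurable borel \<Longrightarrow> f \<in> borel_measurable M"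
  by (intro measurable_restrict_space1 measurable_completion) simp

lemma test_L2:
  assumes "\<phi> \<in> test_functions \<Omega>"
  shows "\<phi> \<in> L2 M"
proof -
  have "integrable lborel (\<lambda>x. (norm (\<phi> x))\<^sup>2)"
    using test_functions_integrable[OF test_functions_mult[OF assms assms]] by (simp add: power2_eq_square)
  moreover have "(\<lambda>x. (norm (\<phi> x))\<^sup>2) \<in> borel_measurable borel" using test_functions_D(4)[OF assms] by measurable
  ultimately have "integrable M (\<lambda>x. (norm (\<phi> x))\<^sup>2)"
    using test_functions_D(6)[OF assms] sets_\<Omega> by (subst lebesgue_on_lborel(2)) auto
  then show ?thesis using borel_measurable_M[OF test_functions_D(4)[OF assms]] by (simp add: L2_def)
qed

lemma grad_outside:
  assumes "\<phi> \<in> test_functions \<Omega>" "x \<notin> \<Omega>"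
  shows "grad \<phi> x = 0"
  using assms grad_support[of \<phi> x] by (auto simp: test_functions_def)

lemma grad_L2:
  assumes \<phi>: "\<phi> \<in> test_functions \<Omega>"
  shows "grad \<phi> \<in> L2 M" "N2 M (grad \<phi>) = (\<integral>x. (norm (grad \<phi> x))\<^sup>2 \<partial>lborel)"
    "(\<integral>x. norm (grad \<phi> x) \<partial>M) = (\<integral>x. norm (grad \<phi> x) \<partial>lborel)"
proof -
  note [measurable] = grad_measurable[OF \<phi>]
  have "integrable lborel (\<lambda>x. (norm (grad \<phi> x))\<^sup>2)"
  proof (rule compact_support_integrable)
    show "bounded {x. (norm (grad \<phi> x))\<^sup>2 \<noteq> 0}"
      by (rule bounded_subset[OF bounded_closure[OF test_functions_bounded_support[OF \<phi>]]])
        (auto dest: grad_support)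
  qed (intro continuous_intros continuous_grad[OF \<phi>])
  then have "integrable M (\<lambda>x. (norm (grad \<phi> x))\<^sup>2)"
    using grad_outside[OF \<phi>] sets_\<Omega> by (subst lebesgue_on_lborel(2)) auto
  then show "grad \<phi> \<in> L2 M" using borel_measurable_M[OF grad_measurable[OF \<phi>]] by (simp add: L2_def)
  show "N2 M (grad \<phi>) = (\<integral>x. (norm (grad \<phi> x))\<^sup>2 \<partial>lborel)"
    unfolding N2_def using grad_outside[OF \<phi>] sets_\<Omega> by (intro lebesgue_on_lborel(1)) auto
  show "(\<integral>x. norm (grad \<phi> x) \<partial>M) = (\<integral>x. norm (grad \<phi> x) \<partial>lborel)"
    using grad_outside[OF \<phi>] sets_\<Omega> by (intro lebesgue_on_lborel(1)) auto
qed

lemma L2_real_mult: "f \<in> L2 M \<Longrightarrow> g \<in> L2 M \<Longrightarrow> integrable M (\<lambda>x. f x * (g x :: real))"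
  using L2_inner_integrable[of f M g] by simp

lemma L2_component: "g \<in> L2 M \<Longrightarrow> (\<lambda>x. (g x :: real^'n) $ i) \<in> L2 M"
proof -
  assume g: "g \<in> L2 M"
  note [measurable] = L2_D(1)[OF g]
  have e: "g x $ i = g x \<bullet> axis i 1" for x by (simp add: inner_axis)
  have m [measurable]: "(\<lambda>x. g x $ i) \<in> borel_measurable M" unfolding e by measurable
  have "integrable M (\<lambda>x. (norm (g x $ i))\<^sup>2)"
    by (rule Bochner_Integration.integrable_bound[OF L2_D(2)[OF g]])
      (simp_all add: abs_le_square_iff[symmetric] component_le_norm_cart)
  then show ?thesis using m by (simp add: L2_def)
qed

text \<open>A relation is easier to handle than \<open>weak_gradient\<close>, whose values are a
  choice determined only almost everywhere: sums and limits of gradients are again gradients in this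
  sense, without computing the choice.\<close>

definition WG :: "(real^'n \<Rightarrow> real) \<Rightarrow> (real^'n \<Rightarrow> real^'n) \<Rightarrow> bool" where
  "WG u g \<longleftrightarrow> g \<in> L2 M \<and> has_weak_gradient \<Omega> u g"

lemma WG_L2: "WG u g \<Longrightarrow> g \<in> L2 M" by (simp add: WG_def)

text \<open>Each component of the difference is orthogonal to all test functions, so the fundamental
  lemma of the calculus of variations applies.\<close>

lemma WG_unique:
  assumes "WG u g" "WG u h"
  shows "AE x in M. g x = h x"
proof -
  note L = WG_L2[OF assms(1)] WG_L2[OF assms(2)]
  have "AE x in M. g x $ i - h x $ i = 0" for i
  proof (rule fundamental_lemma_variations[OF open_\<Omega>])
    show "integrable M (\<lambda>x. g x $ i - h x $ i)"
      by (intro Bochner_Integration.integrable_diff L2_imp_integrable(1) L2_component L)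
    fix \<phi> assume \<phi>: "\<phi> \<in> test_functions \<Omega>"
    have "(\<integral>x. (g x $ i - h x $ i) * \<phi> x \<partial>M) = (\<integral>x. g x $ i * \<phi> x \<partial>M) - (\<integral>x. h x $ i * \<phi> x \<partial>M)"
      using L2_real_mult[OF L2_component[OF L(1)] test_L2[OF \<phi>]] L2_real_mult[OF L2_component[OF L(2)] test_L2[OF \<phi>]]
      by (simp add: left_diff_distrib)
    also have "\<dots> = 0"
    proof -
      have "(\<integral>x. u x * partial_deriv i \<phi> x \<partial>M) = - (\<integral>x. g x $ i * \<phi> x \<partial>M)"
        "(\<integral>x. u x * partial_deriv i \<phi> x \<partial>M) = - (\<integral>x. h x $ i * \<phi> x \<partial>M)"
        using assms \<phi> by (auto simp: WG_def has_weak_gradient_def)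
      then show ?thesis by simp
    qed
    finally show "(\<integral>x. (g x $ i - h x $ i) * \<phi> x \<partial>M) = 0" .
  qed
  then have "AE x in M. \<forall>i\<in>UNIV. g x $ i - h x $ i = 0"
    by (intro eventually_ball_finite) auto
  then show ?thesis by eventually_elim (simp add: vec_eq_iff)
qed

lemma WG_add:
  assumes u: "u \<in> L2 M" "WG u g" and v: "v \<in> L2 M" "WG v h"
  shows "WG (\<lambda>x. u x + v x) (\<lambda>x. g x + h x)"
proof -
  have "(\<integral>x. (u x + v x) * partial_deriv i \<phi> x \<partial>M) = - (\<integral>x. (g x + h x) $ i * \<phi> x \<partial>M)"
    if \<phi>: "\<phi> \<in> test_functions \<Omega>" for \<phi> i
  proof -
    have "(\<integral>x. (u x + v x) * partial_deriv i \<phi> x \<partial>M) = (\<integral>x. u x * partial_deriv i \<phi> x \<partial>M) + (\<integral>x. v x * partial_deriv i \<phi> x \<partial>M)"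
      using L2_real_mult[OF u(1) test_L2[OF test_functions_partial_deriv[OF \<phi>]]]
        L2_real_mult[OF v(1) test_L2[OF test_functions_partial_deriv[OF \<phi>]]] by (simp add: distrib_right)
    also have "\<dots> = - (\<integral>x. g x $ i * \<phi> x \<partial>M) - (\<integral>x. h x $ i * \<phi> x \<partial>M)"
      using u v \<phi> by (simp add: WG_def has_weak_gradient_def)
    also have "\<dots> = - (\<integral>x. (g x + h x) $ i * \<phi> x \<partial>M)"
      using L2_real_mult[OF L2_component[OF WG_L2[OF u(2)]] test_L2[OF \<phi>]]
        L2_real_mult[OF L2_component[OF WG_L2[OF v(2)]] test_L2[OF \<phi>]] by (simp add: distrib_right)
    finally show ?thesis .
  qed
  then show ?thesis using L2_add[OF WG_L2[OF u(2)] WG_L2[OF v(2)]] by (simp add: WG_def has_weak_gradient_def)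
qed

lemma WG_scale:
  assumes "WG u g"
  shows "WG (\<lambda>x. c * u x) (\<lambda>x. c *\<^sub>R g x)"
  using assms L2_scale[of g M c] by (simp add: WG_def has_weak_gradient_def mult.assoc)

lemma WG_diff:
  assumes "u \<in> L2 M" "WG u g" "v \<in> L2 M" "WG v h"
  shows "WG (\<lambda>x. u x - v x) (\<lambda>x. g x - h x)"
  using WG_add[OF assms(1,2) L2_scale[OF assms(3), of "-1"], of "\<lambda>x. (-1) *\<^sub>R h x"] WG_scale[OF assms(4), of "-1"] by simp

lemma WG_grad:
  assumes \<phi>: "\<phi> \<in> test_functions \<Omega>"
  shows "WG \<phi> (grad \<phi>)"
proof -
  have "(\<integral>x. \<phi> x * partial_deriv i \<psi> x \<partial>M) = - (\<integral>x. grad \<phi> x $ i * \<psi> x \<partial>M)"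
    if \<psi>: "\<psi> \<in> test_functions \<Omega>" for \<psi> i
  proof -
    note [measurable] = test_functions_D(4)[OF \<phi>] test_functions_D(4)[OF \<psi>]
      test_functions_D(4)[OF test_functions_partial_deriv[OF \<phi>]] test_functions_D(4)[OF test_functions_partial_deriv[OF \<psi>]]
    have "(\<integral>x. \<phi> x * partial_deriv i \<psi> x \<partial>M) = (\<integral>x. \<phi> x * partial_deriv i \<psi> x \<partial>lborel)"
      using test_functions_D(6)[OF \<phi>] sets_\<Omega> by (intro lebesgue_on_lborel(1)) auto
    also have "\<dots> = - (\<integral>x. partial_deriv i \<phi> x * \<psi> x \<partial>lborel)" by (rule integration_by_parts[OF \<phi> \<psi>])
    also have "(\<integral>x. partial_deriv i \<phi> x * \<psi> x \<partial>lborel) = (\<integral>x. partial_deriv i \<phi> x * \<psi> x \<partial>M)"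
      using test_functions_D(6)[OF \<psi>] sets_\<Omega> by (intro lebesgue_on_lborel(1)[symmetric]) auto
    finally show ?thesis by (simp add: grad_def)
  qed
  then show ?thesis using grad_L2[OF \<phi>] by (simp add: WG_def has_weak_gradient_def)
qed

lemma H1_iff: "u \<in> H1 \<Omega> \<longleftrightarrow> u \<in> L2 M \<and> (\<exists>g. WG u g)"
  by (auto simp: H1_def WG_def Lspace_eq_L2)

lemma WG_weak_gradient: "WG u g \<Longrightarrow> WG u (weak_gradient \<Omega> u)"
  unfolding weak_gradient_def WG_def Lspace_eq_L2 by (rule someI[of "\<lambda>g. g \<in> L2 M \<and> has_weak_gradient \<Omega> u g"])

lemma weak_gradient_AE: "WG u g \<Longrightarrow> AE x in M. weak_gradient \<Omega> u x = g x"
  using WG_unique WG_weak_gradient by blast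

lemma N2_weak_gradient: "WG u g \<Longrightarrow> N2 M (weak_gradient \<Omega> u) = N2 M g"
  using weak_gradient_AE WG_weak_gradient WG_L2 L2_D(1) by (intro N2_cong_AE) blast+

text \<open>The closure of the graph of the gradient on test functions. It describes
  \<open>H01 \<Omega>\<close> (see \<open>H01_iff\<close>) with the gradient as an explicit second
  argument.\<close>

definition H0 :: "(real^'n \<Rightarrow> real) \<Rightarrow> (real^'n \<Rightarrow> real^'n) \<Rightarrow> bool" where
  "H0 u g \<longleftrightarrow> u \<in> L2 M \<and> WG u g \<and> (\<exists>\<phi> :: nat \<Rightarrow> real^'n \<Rightarrow> real. (\<forall>k. \<phi> k \<in> test_functions \<Omega>) \<and>
     (\<lambda>k. N2 M (\<lambda>x. \<phi> k x - u x)) \<longlonglongrightarrow> 0 \<and> (\<lambda>k. N2 M (\<lambda>x. grad (\<phi> k) x - g x)) \<longlonglongrightarrow> 0)"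

lemma H0_D: "H0 u g \<Longrightarrow> u \<in> L2 M" "H0 u g \<Longrightarrow> WG u g" "H0 u g \<Longrightarrow> g \<in> L2 M"
  by (auto simp: H0_def WG_def)

lemma H0_approx:
  assumes "H0 u g" "0 < \<epsilon>"
  shows "\<exists>\<phi>\<in>test_functions \<Omega>. N2 M (\<lambda>x. \<phi> x - u x) < \<epsilon> \<and> N2 M (\<lambda>x. grad \<phi> x - g x) < \<epsilon>"
proof -
  obtain \<phi> where \<phi>: "\<And>k. \<phi> k \<in> test_functions \<Omega>" "(\<lambda>k. N2 M (\<lambda>x. \<phi> k x - u x)) \<longlonglongrightarrow> 0"
    "(\<lambda>k. N2 M (\<lambda>x. grad (\<phi> k) x - g x)) \<longlonglongrightarrow> 0" using assms(1) by (auto simp: H0_def)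
  have "\<forall>\<^sub>F k in sequentially. N2 M (\<lambda>x. \<phi> k x - u x) < \<epsilon> \<and> N2 M (\<lambda>x. grad (\<phi> k) x - g x) < \<epsilon>"
    using order_tendstoD(2)[OF \<phi>(2) assms(2)] order_tendstoD(2)[OF \<phi>(3) assms(2)] by eventually_elim simp
  then show ?thesis using \<phi>(1) by (auto simp: eventually_sequentially)
qed

lemma H0_I:
  assumes "u \<in> L2 M" "WG u g"
    and approx: "\<And>k::nat. \<exists>\<phi>\<in>test_functions \<Omega>. N2 M (\<lambda>x. \<phi> x - u x) \<le> c k \<and> N2 M (\<lambda>x. grad \<phi> x - g x) \<le> c k" and c: "c \<longlonglongrightarrow> 0"
  shows "H0 u g"
proof -
  have "\<exists>\<phi>. \<forall>k. \<phi> k \<in> test_functions \<Omega> \<and> N2 M (\<lambda>x. \<phi> k x - u x) \<le> c k \<and> N2 M (\<lambda>x. grad (\<phi> k) x - g x) \<le> c k"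
    by (rule choice) (use approx in blast)
  then obtain \<phi> where \<phi>: "\<And>k. \<phi> k \<in> test_functions \<Omega>" "\<And>k. N2 M (\<lambda>x. \<phi> k x - u x) \<le> c k"
    "\<And>k. N2 M (\<lambda>x. grad (\<phi> k) x - g x) \<le> c k" by blast
  have "(\<lambda>k. N2 M (\<lambda>x. \<phi> k x - u x)) \<longlonglongrightarrow> 0" "(\<lambda>k. N2 M (\<lambda>x. grad (\<phi> k) x - g x)) \<longlonglongrightarrow> 0"
    by (rule LIMSEQ_squeeze_0[OF N2_nonneg _ c], rule \<phi>)+
  then show ?thesis using \<phi>(1) assms(1,2) unfolding H0_def by (intro conjI exI[of _ \<phi>] allI)
qed

lemma H0_test: "\<phi> \<in> test_functions \<Omega> \<Longrightarrow> H0 \<phi> (grad \<phi>)"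
  by (rule H0_I[of _ _ "\<lambda>_. 0"]) (auto simp: test_L2 WG_grad N2_def intro!: bexI[of _ \<phi>])

lemma grad_add:
  assumes "\<phi> \<in> test_functions \<Omega>" "\<psi> \<in> test_functions \<Omega>"
  shows "grad (\<lambda>x. \<phi> x + \<psi> x) x = grad \<phi> x + grad \<psi> x"
  by (simp add: grad_def vec_eq_iff partial_deriv_def partial_deriv_eq[OF has_derivative_add[OF
        has_derivative_frechet[OF test_functions_D(2)[OF assms(1)]] has_derivative_frechet[OF test_functions_D(2)[OF assms(2)]]],
      unfolded partial_deriv_def])

lemma grad_cmult:
  assumes "\<phi> \<in> test_functions \<Omega>"
  shows "grad (\<lambda>x. c * \<phi> x) x = c *\<^sub>R grad \<phi> x"
  by (simp add: grad_def vec_eq_iff partial_deriv_def partial_deriv_eq[OF has_derivative_mult_right[OF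
        has_derivative_frechet[OF test_functions_D(2)[OF assms]]], unfolded partial_deriv_def])

lemma H0_add:
  assumes u: "H0 u g" and v: "H0 v h"
  shows "H0 (\<lambda>x. u x + v x) (\<lambda>x. g x + h x)"
proof (rule H0_I)
  show "(\<lambda>x. u x + v x) \<in> L2 M" "WG (\<lambda>x. u x + v x) (\<lambda>x. g x + h x)"
    using u v by (auto intro: L2_add WG_add dest: H0_D)
  show "(\<lambda>k. 4 * (1 / real (Suc k))) \<longlonglongrightarrow> 0"
    using tendsto_mult_left[OF LIMSEQ_Suc[OF lim_1_over_n], of 4] by simp
  fix k :: nat
  have e: "0 < 1 / real (Suc k)" by simp
  obtain \<phi> where \<phi>: "\<phi> \<in> test_functions \<Omega>" "N2 M (\<lambda>x. \<phi> x - u x) < 1 / real (Suc k)" "N2 M (\<lambda>x. grad \<phi> x - g x) < 1 / real (Suc k)"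
    using H0_approx[OF u e] by blast
  obtain \<psi> where \<psi>: "\<psi> \<in> test_functions \<Omega>" "N2 M (\<lambda>x. \<psi> x - v x) < 1 / real (Suc k)" "N2 M (\<lambda>x. grad \<psi> x - h x) < 1 / real (Suc k)"
    using H0_approx[OF v e] by blast
  have 1: "(\<lambda>x. \<phi> x + \<psi> x - (u x + v x)) = (\<lambda>x. (\<phi> x - u x) + (\<psi> x - v x))"
    and 2: "(\<lambda>x. grad (\<lambda>x. \<phi> x + \<psi> x) x - (g x + h x)) = (\<lambda>x. (grad \<phi> x - g x) + (grad \<psi> x - h x))"
    by (auto simp: grad_add[OF \<phi>(1) \<psi>(1)])
  have "N2 M (\<lambda>x. \<phi> x + \<psi> x - (u x + v x)) \<le> 4 * (1 / real (Suc k))"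
    unfolding 1 using N2_add_le[OF L2_diff[OF test_L2[OF \<phi>(1)] H0_D(1)[OF u]] L2_diff[OF test_L2[OF \<psi>(1)] H0_D(1)[OF v]]] \<phi>(2) \<psi>(2)
    by linarith
  moreover have "N2 M (\<lambda>x. grad (\<lambda>x. \<phi> x + \<psi> x) x - (g x + h x)) \<le> 4 * (1 / real (Suc k))"
    unfolding 2 using N2_add_le[OF L2_diff[OF grad_L2(1)[OF \<phi>(1)] H0_D(3)[OF u]] L2_diff[OF grad_L2(1)[OF \<psi>(1)] H0_D(3)[OF v]]] \<phi>(3) \<psi>(3)
    by linarith
  ultimately show "\<exists>\<phi>\<in>test_functions \<Omega>. N2 M (\<lambda>x. \<phi> x - (u x + v x)) \<le> 4 * (1 / real (Suc k)) \<and>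
      N2 M (\<lambda>x. grad \<phi> x - (g x + h x)) \<le> 4 * (1 / real (Suc k))"
    using test_functions_add[OF \<phi>(1) \<psi>(1)] by (intro bexI[of _ "\<lambda>x. \<phi> x + \<psi> x"] conjI)
qed

lemma H0_scale:
  assumes u: "H0 u g"
  shows "H0 (\<lambda>x. c * u x) (\<lambda>x. c *\<^sub>R g x)"
proof (rule H0_I)
  show "(\<lambda>x. c * u x) \<in> L2 M" "WG (\<lambda>x. c * u x) (\<lambda>x. c *\<^sub>R g x)"
    using u L2_scale[of u M c] by (auto intro: WG_scale dest: H0_D)
  show "(\<lambda>k. c\<^sup>2 * (1 / real (Suc k))) \<longlonglongrightarrow> 0"
    using tendsto_mult_left[OF LIMSEQ_Suc[OF lim_1_over_n], of "c\<^sup>2"] by simp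
  fix k :: nat
  have e: "0 < 1 / real (Suc k)" by simp
  obtain \<phi> where \<phi>: "\<phi> \<in> test_functions \<Omega>" "N2 M (\<lambda>x. \<phi> x - u x) < 1 / real (Suc k)" "N2 M (\<lambda>x. grad \<phi> x - g x) < 1 / real (Suc k)"
    using H0_approx[OF u e] by blast
  have 1: "(\<lambda>x. c * \<phi> x - c * u x) = (\<lambda>x. c *\<^sub>R (\<phi> x - u x))"
    and 2: "(\<lambda>x. grad (\<lambda>x. c * \<phi> x) x - c *\<^sub>R g x) = (\<lambda>x. c *\<^sub>R (grad \<phi> x - g x))"
    by (auto simp: grad_cmult[OF \<phi>(1)] algebra_simps)
  have "N2 M (\<lambda>x. c * \<phi> x - c * u x) \<le> c\<^sup>2 * (1 / real (Suc k))" "N2 M (\<lambda>x. grad (\<lambda>x. c * \<phi> x) x - c *\<^sub>R g x) \<le> c\<^sup>2 * (1 / real (Suc k))"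
    unfolding 1 2 N2_scale using \<phi> by (intro mult_left_mono; simp)+
  then show "\<exists>\<phi>\<in>test_functions \<Omega>. N2 M (\<lambda>x. \<phi> x - c * u x) \<le> c\<^sup>2 * (1 / real (Suc k)) \<and>
      N2 M (\<lambda>x. grad \<phi> x - c *\<^sub>R g x) \<le> c\<^sup>2 * (1 / real (Suc k))"
    using test_functions_cmult[OF \<phi>(1)] by (intro bexI[of _ "\<lambda>x. c * \<phi> x"] conjI)
qed

lemma H0_diff: "H0 u g \<Longrightarrow> H0 v h \<Longrightarrow> H0 (\<lambda>x. u x - v x) (\<lambda>x. g x - h x)"
  using H0_add[of u g "\<lambda>x. (-1) * v x" "\<lambda>x. (-1) *\<^sub>R h x"] H0_scale[of v h "-1"] by simp

lemma H0_cong_AE: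
  assumes "H0 u g" "WG u h"
  shows "H0 u h"
proof -
  have "N2 M (\<lambda>x. f x - g x) = N2 M (\<lambda>x. f x - h x)" if "f \<in> L2 M" for f
  proof (rule N2_cong_AE)
    show "AE x in M. f x - g x = f x - h x"
      using WG_unique[OF H0_D(2)[OF assms(1)] assms(2)] by eventually_elim simp
  qed (intro borel_measurable_diff L2_D(1)[OF that] L2_D(1)[OF H0_D(3)[OF assms(1)]] L2_D(1)[OF WG_L2[OF assms(2)]])+
  then have "(\<lambda>k. N2 M (\<lambda>x. grad (\<phi> k) x - g x)) = (\<lambda>k. N2 M (\<lambda>x. grad (\<phi> k) x - h x))"
    if "\<And>k. \<phi> k \<in> test_functions \<Omega>" for \<phi> :: "nat \<Rightarrow> real^'n \<Rightarrow> real"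
    using grad_L2(1)[OF that] by simp
  then show ?thesis using assms unfolding H0_def by (metis (no_types, lifting))
qed

text \<open>The norm in \<open>H1\<close> is the square root of the sum of the two squared L2
  distances, so it tends to zero exactly when both do. The choice made by
  \<open>weak_gradient\<close> does not matter, because weak gradients agree almost
  everywhere.\<close>

lemma H01_iff: "u \<in> H01 \<Omega> \<longleftrightarrow> H0 u (weak_gradient \<Omega> u)"
proof -
  have norm_eq: "H1_norm \<Omega> (\<lambda>x. \<phi> x - u x) = sqrt (N2 M (\<lambda>x. \<phi> x - u x) + N2 M (\<lambda>x. grad \<phi> x - weak_gradient \<Omega> u x))"
    if "\<phi> \<in> test_functions \<Omega>" "u \<in> L2 M" "WG u (weak_gradient \<Omega> u)" for \<phi>
    using N2_weak_gradient[OF WG_diff[OF test_L2[OF that(1)] WG_grad[OF that(1)] that(2,3)]]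
    by (simp add: H1_norm_def Lnorm_eq_N2)
  have lim: "(\<lambda>k. sqrt (a k + b k)) \<longlonglongrightarrow> 0 \<longleftrightarrow> a \<longlonglongrightarrow> 0 \<and> b \<longlonglongrightarrow> 0"
    if pos: "\<And>k. 0 \<le> a k" "\<And>k. 0 \<le> b k" for a b :: "nat \<Rightarrow> real"
  proof
    assume "(\<lambda>k. sqrt (a k + b k)) \<longlonglongrightarrow> 0"
    then have "(\<lambda>k. (sqrt (a k + b k))\<^sup>2) \<longlonglongrightarrow> 0\<^sup>2" by (intro tendsto_intros)
    then have ab: "(\<lambda>k. a k + b k) \<longlonglongrightarrow> 0" using pos by simp
    show "a \<longlonglongrightarrow> 0 \<and> b \<longlonglongrightarrow> 0"
      by (intro conjI; rule LIMSEQ_squeeze_0[OF pos(1) _ ab] LIMSEQ_squeeze_0[OF pos(2) _ ab]; simp add: pos)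
  next
    assume "a \<longlonglongrightarrow> 0 \<and> b \<longlonglongrightarrow> 0"
    then have "(\<lambda>k. sqrt (a k + b k)) \<longlonglongrightarrow> sqrt (0 + 0)" by (intro tendsto_intros) auto
    then show "(\<lambda>k. sqrt (a k + b k)) \<longlonglongrightarrow> 0" by simp
  qed
  show ?thesis
  proof
    assume u: "u \<in> H01 \<Omega>"
    then obtain g where g: "u \<in> L2 M" "WG u g" by (auto simp: H01_def H1_iff)
    note wg = WG_weak_gradient[OF g(2)]
    from u obtain \<phi> where \<phi>: "\<And>k. \<phi> k \<in> test_functions \<Omega>" "(\<lambda>k. H1_norm \<Omega> (\<lambda>x. \<phi> k x - u x)) \<longlonglongrightarrow> 0"
      by (auto simp: H01_def)
    show "H0 u (weak_gradient \<Omega> u)"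
      using \<phi> g(1) wg unfolding H0_def norm_eq[OF \<phi>(1) g(1) wg] lim[OF N2_nonneg N2_nonneg] by blast
  next
    assume u: "H0 u (weak_gradient \<Omega> u)"
    note u' = H0_D[OF u]
    obtain \<phi> where \<phi>: "\<And>k. \<phi> k \<in> test_functions \<Omega>" "(\<lambda>k. N2 M (\<lambda>x. \<phi> k x - u x)) \<longlonglongrightarrow> 0"
      "(\<lambda>k. N2 M (\<lambda>x. grad (\<phi> k) x - weak_gradient \<Omega> u x)) \<longlonglongrightarrow> 0" using u by (auto simp: H0_def)
    have "(\<lambda>k. H1_norm \<Omega> (\<lambda>x. \<phi> k x - u x)) \<longlonglongrightarrow> 0"
      using \<phi> unfolding norm_eq[OF \<phi>(1) u'(1,2)] lim[OF N2_nonneg N2_nonneg] by blast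
    then show "u \<in> H01 \<Omega>" using \<phi>(1) u' by (auto simp: H01_def H1_iff)
  qed
qed

lemma H01_I: "H0 u g \<Longrightarrow> u \<in> H01 \<Omega>"
  using H01_iff H0_cong_AE WG_weak_gradient H0_D(2) by blast

lemma H01_norm_eq: "H01_norm \<Omega> u = sqrt (N2 M (weak_gradient \<Omega> u))"
  by (simp add: H01_norm_def Lnorm_eq_N2)

end

text \<open>The abstract minimisation is stated for a subspace of a real vector space. Functions
  equal almost everywhere remain distinct vectors here, so the inner product is only semidefinite,
  which is all that \<open>ip_nonneg\<close> requires.\<close>

instantiation "fun" :: (type, real_vector) real_vector
begin

definition scaleR_fun :: "real \<Rightarrow> ('a \<Rightarrow> 'b) \<Rightarrow> 'a \<Rightarrow> 'b" where
  "scaleR_fun c f = (\<lambda>x. c *\<^sub>R f x)"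

instance
  by standard (auto simp: scaleR_fun_def plus_fun_def algebra_simps)

end

lemma N2_triangle:
  assumes "f \<in> L2 M" "g \<in> L2 M"
  shows "sqrt (N2 M (\<lambda>x. f x + g x)) \<le> sqrt (N2 M f) + sqrt (N2 M g)"
proof -
  have "N2 M (\<lambda>x. f x + g x) \<le> (\<integral>x. (norm (f x))\<^sup>2 + 2 * (norm (f x) * norm (g x)) + (norm (g x))\<^sup>2 \<partial>M)"
    unfolding N2_def
  proof (rule integral_mono)
    show "(norm (f x + g x))\<^sup>2 \<le> (norm (f x))\<^sup>2 + 2 * (norm (f x) * norm (g x)) + (norm (g x))\<^sup>2" for x
      using power_mono[OF norm_triangle_ineq[of "f x" "g x"], of 2] by (simp add: power2_sum)
  qed (use assms L2_D(2)[OF L2_add[OF assms]] L2_norm_mult_integrable[OF assms] in \<open>auto simp: L2_D\<close>)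
  also have "\<dots> = N2 M f + 2 * (\<integral>x. norm (f x) * norm (g x) \<partial>M) + N2 M g"
    unfolding N2_def using assms L2_norm_mult_integrable[OF assms] by (simp add: L2_D)
  also have "\<dots> \<le> N2 M f + 2 * (sqrt (N2 M f) * sqrt (N2 M g)) + N2 M g" using L2_mult_le[OF assms] by simp
  also have "\<dots> = (sqrt (N2 M f) + sqrt (N2 M g))\<^sup>2" by (simp add: power2_sum)
  finally show ?thesis by (intro real_le_lsqrt) auto
qed

definition powr_derivative :: "'a measure \<Rightarrow> real \<Rightarrow> ('a \<Rightarrow> real) \<Rightarrow> ('a \<Rightarrow> real) \<Rightarrow> real" where
  "powr_derivative M q u h = (\<integral>x. q * (sgn (u x) * \<bar>u x\<bar> powr (q - 1)) * h x \<partial>M)"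

lemma powr_derivative_integrable:
  assumes q: "2 < q" and u: "u \<in> Lq M q" and h: "h \<in> Lq M q"
  shows "integrable M (\<lambda>x. q * (sgn (u x) * \<bar>u x\<bar> powr (q - 1)) * h x)"
    and "\<bar>powr_derivative M q u h\<bar> \<le> 2 * q * (Lqn M q u powr (q - 1) * Lqn M q h)"
proof -
  note [measurable] = Lq_D(1)[OF u] Lq_D(1)[OF h]
  have i: "integrable M (\<lambda>x. \<bar>u x\<bar> powr (q - 1) * \<bar>h x\<bar> powr 1)"
    and le: "(\<integral>x. \<bar>u x\<bar> powr (q - 1) * \<bar>h x\<bar> powr 1 \<partial>M) \<le> 2 * (Lqn M q u powr (q - 1) * Lqn M q h powr 1)"
    using Lq_Hoelder[OF u h, of "q - 1" 1] q by auto
  have i': "integrable M (\<lambda>x. q * (\<bar>u x\<bar> powr (q - 1) * \<bar>h x\<bar> powr 1))" using i by simp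
  have b: "\<bar>q * (sgn (u x) * \<bar>u x\<bar> powr (q - 1)) * h x\<bar> \<le> q * (\<bar>u x\<bar> powr (q - 1) * \<bar>h x\<bar> powr 1)" for x
    using q by (simp add: abs_mult abs_sgn_eq)
  show int: "integrable M (\<lambda>x. q * (sgn (u x) * \<bar>u x\<bar> powr (q - 1)) * h x)"
  proof (rule Bochner_Integration.integrable_bound[OF i'])
    show "AE x in M. norm (q * (sgn (u x) * \<bar>u x\<bar> powr (q - 1)) * h x) \<le> norm (q * (\<bar>u x\<bar> powr (q - 1) * \<bar>h x\<bar> powr 1))"
      using b q by (intro AE_I2) (simp add: abs_mult)
  qed measurable
  have "\<bar>powr_derivative M q u h\<bar> \<le> (\<integral>x. q * (\<bar>u x\<bar> powr (q - 1) * \<bar>h x\<bar> powr 1) \<partial>M)"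
    unfolding powr_derivative_def
    by (rule order_trans[OF integral_abs_bound integral_mono[OF integrable_abs[OF int] i' b]])
  also have "\<dots> = q * (\<integral>x. \<bar>u x\<bar> powr (q - 1) * \<bar>h x\<bar> powr 1 \<partial>M)" by simp
  also have "\<dots> \<le> q * (2 * (Lqn M q u powr (q - 1) * Lqn M q h powr 1))" using le q by (intro mult_left_mono) auto
  finally show "\<bar>powr_derivative M q u h\<bar> \<le> 2 * q * (Lqn M q u powr (q - 1) * Lqn M q h)" by simp
qed

text \<open>The pointwise expansion is integrated, and the mixed term is bounded by Hoelder's
  inequality with exponents \<open>q - 2\<close> and 2.\<close>

lemma Lqn_taylor:
  assumes q: "2 < q" and u: "u \<in> Lq M q" and h: "h \<in> Lq M q"
  shows "\<bar>Lqn M q (\<lambda>x. u x + h x) powr q - Lqn M q u powr q - powr_derivative M q u h\<bar>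
    \<le> 2 * taylor_const q * (Lqn M q u powr (q - 2) * (Lqn M q h)\<^sup>2 + Lqn M q h powr q)"
proof -
  have q0: "0 < q" using q by simp
  note int = powr_derivative_integrable(1)[OF q u h] and uh = Lq_add[OF q0 u h]
  have p2: "\<bar>x\<bar> powr 2 = x\<^sup>2" for x :: real by (subst powr_2_eq) auto
  have hoe: "integrable M (\<lambda>x. \<bar>u x\<bar> powr (q - 2) * (h x)\<^sup>2)"
    "(\<integral>x. \<bar>u x\<bar> powr (q - 2) * (h x)\<^sup>2 \<partial>M) \<le> 2 * (Lqn M q u powr (q - 2) * (Lqn M q h)\<^sup>2)"
    using Lq_Hoelder[OF u h, of "q - 2" 2] q by (auto simp: p2 powr_2_eq)
  have "\<bar>Lqn M q (\<lambda>x. u x + h x) powr q - Lqn M q u powr q - powr_derivative M q u h\<bar>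
      = \<bar>\<integral>x. \<bar>u x + h x\<bar> powr q - \<bar>u x\<bar> powr q - q * (sgn (u x) * \<bar>u x\<bar> powr (q - 1)) * h x \<partial>M\<bar>"
    unfolding powr_derivative_def Lqn_powr[OF q0] using int Lq_D(2)[OF uh] Lq_D(2)[OF u] by simp
  also have "\<dots> \<le> (\<integral>x. taylor_const q * (\<bar>u x\<bar> powr (q - 2) * (h x)\<^sup>2 + \<bar>h x\<bar> powr q) \<partial>M)"
    using int Lq_D(2)[OF uh] Lq_D(2)[OF u] Lq_D(2)[OF h] hoe(1) abs_powr_taylor[OF q]
    by (intro order_trans[OF integral_abs_bound integral_mono]) auto
  also have "\<dots> = taylor_const q * ((\<integral>x. \<bar>u x\<bar> powr (q - 2) * (h x)\<^sup>2 \<partial>M) + Lqn M q h powr q)"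
    unfolding Lqn_powr[OF q0] using hoe(1) Lq_D(2)[OF h] by simp
  also have "\<dots> \<le> taylor_const q * (2 * (Lqn M q u powr (q - 2) * (Lqn M q h)\<^sup>2) + 2 * Lqn M q h powr q)"
    using hoe(2) taylor_const_pos[OF q] by (intro mult_left_mono add_mono) auto
  finally show ?thesis by (simp add: algebra_simps)
qed

context dirichlet
begin

section \<open>Sobolev, Poincare and Rellich for the Dirichlet space\<close>

definition S :: real where "S = 2 * (real CARD('n) - 1) / (real CARD('n) - 2)"

lemma S_pos: "S > 0"
proof -
  have "real CARD('n) > 2" using dim by simp
  then show ?thesis by (simp add: S_def)
qed

lemma Sobolev_test:
  assumes \<phi>: "\<phi> \<in> test_functions \<Omega>"
  shows "\<phi> \<in> Lq M s" "Lqn M s \<phi> \<le> S * sqrt (N2 M (grad \<phi>))"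
proof -
  note [measurable] = test_functions_D(4)[OF \<phi>]
  have s0: "0 < s" using s_gt_2 by simp
  have "integrable lborel (\<lambda>x. \<bar>\<phi> x\<bar> powr s)"
  proof (rule compact_support_integrable)
    show "bounded {x. \<bar>\<phi> x\<bar> powr s \<noteq> 0}" using test_functions_bounded_support[OF \<phi>] by simp
  qed (intro continuous_abs_powr test_functions_D(3)[OF \<phi>] s0)
  then have "integrable M (\<lambda>x. \<bar>\<phi> x\<bar> powr s)"
    using test_functions_D(6)[OF \<phi>] sets_\<Omega> by (subst lebesgue_on_lborel(2)) auto
  then show "\<phi> \<in> Lq M s" using borel_measurable_M[OF test_functions_D(4)[OF \<phi>]] by (simp add: Lq_def)
  have "(\<integral>x. \<bar>\<phi> x\<bar> powr s \<partial>M) = (\<integral>x. \<bar>\<phi> x\<bar> powr s \<partial>lborel)"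
    using test_functions_D(6)[OF \<phi>] sets_\<Omega> by (intro lebesgue_on_lborel(1)) auto
  then show "Lqn M s \<phi> \<le> S * sqrt (N2 M (grad \<phi>))"
    using Sobolev_test_function[OF dim \<phi>] by (simp add: Lqn_def grad_L2(2)[OF \<phi>] S_def s_eq)
qed

text \<open>Approximating test functions converge almost everywhere along a subsequence, so Fatou's
  lemma transfers the inequality. The slack \<open>\<eta>\<close> absorbs the distance of the
  gradients and is finally sent to 0.\<close>

theorem Sobolev_H0:
  assumes u: "H0 u g"
  shows "u \<in> Lq M s" "Lqn M s u \<le> S * sqrt (N2 M g)"
proof -
  have s0: "0 < s" using s_gt_2 by simp
  obtain \<phi> where \<phi>: "\<And>k. \<phi> k \<in> test_functions \<Omega>" "(\<lambda>k. N2 M (\<lambda>x. \<phi> k x - u x)) \<longlonglongrightarrow> 0"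
    "(\<lambda>k. N2 M (\<lambda>x. grad (\<phi> k) x - g x)) \<longlonglongrightarrow> 0" using u by (auto simp: H0_def)
  obtain r :: "nat \<Rightarrow> nat" where r: "strict_mono r" "AE x in M. (\<lambda>k. \<phi> (r k) x) \<longlonglongrightarrow> u x"
    using L2_tendsto_AE_subseq[of \<phi> u] test_L2[OF \<phi>(1)] H0_D(1)[OF u] \<phi>(2) by blast
  note um [measurable] = L2_D(1)[OF H0_D(1)[OF u]]
  have lim: "AE x in M. (\<lambda>k. \<bar>\<phi> (r k) x\<bar> powr s) \<longlonglongrightarrow> \<bar>u x\<bar> powr s"
    using r(2) by eventually_elim (intro tendsto_powr' tendsto_intros, use s0 in auto)
  have main: "integrable M (\<lambda>x. \<bar>u x\<bar> powr s) \<and> (\<integral>x. \<bar>u x\<bar> powr s \<partial>M) \<le> (S * (sqrt (N2 M g) + \<eta>)) powr s" if \<eta>: "0 < \<eta>" for \<eta>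
  proof -
    have "(\<lambda>k. sqrt (N2 M (\<lambda>x. grad (\<phi> k) x - g x))) \<longlonglongrightarrow> sqrt 0" by (intro tendsto_intros \<phi>)
    then have "(\<lambda>k. sqrt (N2 M (\<lambda>x. grad (\<phi> (r k)) x - g x))) \<longlonglongrightarrow> 0"
      using LIMSEQ_subseq_LIMSEQ[OF _ r(1)] by (auto simp: o_def)
    then have ev: "\<forall>\<^sub>F k in sequentially. sqrt (N2 M (\<lambda>x. grad (\<phi> (r k)) x - g x)) < \<eta>" using \<eta> by (rule order_tendstoD(2))
    have "\<forall>\<^sub>F k in sequentially. (\<integral>x. \<bar>\<phi> (r k) x\<bar> powr s \<partial>M) \<le> (S * (sqrt (N2 M g) + \<eta>)) powr s"
      using ev
    proof eventually_elim
      case (elim k)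
      have "sqrt (N2 M (grad (\<phi> (r k)))) \<le> sqrt (N2 M g) + sqrt (N2 M (\<lambda>x. grad (\<phi> (r k)) x - g x))"
        using N2_triangle[OF H0_D(3)[OF u] L2_diff[OF grad_L2(1)[OF \<phi>(1)] H0_D(3)[OF u]], of "r k"] by simp
      then have "sqrt (N2 M (grad (\<phi> (r k)))) \<le> sqrt (N2 M g) + \<eta>" using elim by linarith
      then have "Lqn M s (\<phi> (r k)) \<le> S * (sqrt (N2 M g) + \<eta>)"
        using order_trans[OF Sobolev_test(2)[OF \<phi>(1)] mult_left_mono] S_pos by simp
      then have "Lqn M s (\<phi> (r k)) powr s \<le> (S * (sqrt (N2 M g) + \<eta>)) powr s" using s0 by (intro powr_mono2) auto
      then show ?case unfolding Lqn_powr[OF s0] .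
    qed
    then show ?thesis
      using integral_Fatou[of M "\<lambda>k x. \<bar>\<phi> (r k) x\<bar> powr s" "\<lambda>x. \<bar>u x\<bar> powr s"] lim Lq_D(2)[OF Sobolev_test(1)[OF \<phi>(1)]] by auto
  qed
  show "u \<in> Lq M s" using main[of 1] um by (auto simp: Lq_def)
  have "Lqn M s u \<le> S * sqrt (N2 M g) + e" if e: "0 < e" for e
  proof -
    have pos: "0 \<le> S * (sqrt (N2 M g) + e / S)" using S_pos e by simp
    have "Lqn M s u \<le> ((S * (sqrt (N2 M g) + e / S)) powr s) powr (1 / s)"
      unfolding Lqn_def using main[of "e / S"] S_pos e s0 by (intro powr_mono2) auto
    also have "\<dots> = S * (sqrt (N2 M g) + e / S)" using s0 pos by (simp add: powr_powr)
    also have "\<dots> = S * sqrt (N2 M g) + e" using S_pos by (simp add: distrib_left)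
    finally show ?thesis .
  qed
  then show "Lqn M s u \<le> S * sqrt (N2 M g)" by (rule field_le_epsilon)
qed

lemma Lqn_H0_le:
  assumes u: "H0 u g" and q: "0 < q" "q \<le> s"
  shows "u \<in> Lq M q" "Lqn M q u \<le> (measure M (space M) + 1) powr (1 / q) * S * sqrt (N2 M g)"
proof -
  show "u \<in> Lq M q" by (rule Lq_mono(1)[OF Sobolev_H0(1)[OF u] q])
  have "Lqn M q u \<le> (measure M (space M) + 1) powr (1 / q) * Lqn M s u"
    by (rule Lq_mono(2)[OF Sobolev_H0(1)[OF u] q])
  also have "\<dots> \<le> (measure M (space M) + 1) powr (1 / q) * (S * sqrt (N2 M g))"
    using Sobolev_H0(2)[OF u] by (intro mult_left_mono) auto
  finally show "Lqn M q u \<le> (measure M (space M) + 1) powr (1 / q) * S * sqrt (N2 M g)" by simp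
qed

definition P :: real where "P = (measure M (space M) + 1) * S\<^sup>2"

lemma P_pos: "P > 0" using S_pos by (simp add: P_def add_nonneg_pos)

text \<open>Sobolev's inequality followed by the inclusion of the critical space into L2 on a set of
  finite measure.\<close>

lemma Poincare_H0:
  assumes u: "H0 u g"
  shows "N2 M u \<le> P * N2 M g"
proof -
  have e: "Lqn M 2 u = sqrt (N2 M u)" by (simp add: Lqn_def N2_def powr_2_eq powr_half_sqrt)
  have m: "0 \<le> measure M (space M) + 1" by (simp add: add_nonneg_nonneg)
  have "sqrt (N2 M u) \<le> sqrt (measure M (space M) + 1) * S * sqrt (N2 M g)"
    using Lqn_H0_le(2)[OF u, of 2] s_gt_2 m by (simp add: e powr_half_sqrt)
  then have "(sqrt (N2 M u))\<^sup>2 \<le> (sqrt (measure M (space M) + 1) * S * sqrt (N2 M g))\<^sup>2" by (intro power_mono) auto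
  then show ?thesis using m by (simp add: power_mult_distrib P_def)
qed

text \<open>Only the gradients are assumed Cauchy; the Poincare inequality makes the functions
  Cauchy as well. The defining identity of the weak gradient passes to the L2 limits, and test
  functions close to the terms of the sequence approximate the limit.\<close>

theorem H0_complete:
  fixes x :: "nat \<Rightarrow> real^'n \<Rightarrow> real"
  assumes x: "\<And>k. H0 (x k) (g k)"
    and Cauchy: "\<And>\<epsilon>. 0 < \<epsilon> \<Longrightarrow> \<exists>K. \<forall>i\<ge>K. \<forall>j\<ge>K. N2 M (\<lambda>y. g i y - g j y) < \<epsilon>"
  shows "\<exists>u G. H0 u G \<and> (\<lambda>k. N2 M (\<lambda>y. g k y - G y)) \<longlonglongrightarrow> 0"
proof -
  obtain G where G: "G \<in> L2 M" "(\<lambda>k. N2 M (\<lambda>y. g k y - G y)) \<longlonglongrightarrow> 0"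
    using L2_complete[of g] H0_D(3)[OF x] Cauchy by blast
  have "\<exists>K. \<forall>i\<ge>K. \<forall>j\<ge>K. N2 M (\<lambda>y. x i y - x j y) < \<epsilon>" if \<epsilon>: "0 < \<epsilon>" for \<epsilon>
  proof -
    obtain K where K: "\<And>i j. i \<ge> K \<Longrightarrow> j \<ge> K \<Longrightarrow> N2 M (\<lambda>y. g i y - g j y) < \<epsilon> / P"
      using Cauchy[of "\<epsilon> / P"] \<epsilon> P_pos by auto
    have "N2 M (\<lambda>y. x i y - x j y) < \<epsilon>" if "i \<ge> K" "j \<ge> K" for i j
    proof -
      have "N2 M (\<lambda>y. x i y - x j y) \<le> P * N2 M (\<lambda>y. g i y - g j y)" by (rule Poincare_H0[OF H0_diff[OF x x]])
      also have "\<dots> < P * (\<epsilon> / P)" using K[OF that] P_pos by (intro mult_strict_left_mono) auto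
      finally show ?thesis using P_pos by simp
    qed
    then show ?thesis by blast
  qed
  then obtain u where u: "u \<in> L2 M" "(\<lambda>k. N2 M (\<lambda>y. x k y - u y)) \<longlonglongrightarrow> 0"
    using L2_complete[of x] H0_D(1)[OF x] by blast
  \<comment> \<open>L2 convergence implies convergence of the integrals against a fixed L2 function;
    this is used for the functions and for the components of the gradients.\<close>
  have pair: "(\<lambda>k. \<integral>y. f k y * \<psi> y \<partial>M) \<longlonglongrightarrow> (\<integral>y. F y * \<psi> y \<partial>M)"
    if f: "\<And>k. f k \<in> L2 M" "F \<in> L2 M" "(\<lambda>k. N2 M (\<lambda>y. f k y - F y)) \<longlonglongrightarrow> 0" and \<psi>: "\<psi> \<in> L2 M"
    for f F and \<psi> :: "real^'n \<Rightarrow> real"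
  proof -
    have "(\<lambda>k. (\<integral>y. f k y * \<psi> y \<partial>M) - (\<integral>y. F y * \<psi> y \<partial>M)) \<longlonglongrightarrow> 0"
    proof (rule Lim_null_comparison[OF always_eventually])
      show "\<forall>k. norm ((\<integral>y. f k y * \<psi> y \<partial>M) - (\<integral>y. F y * \<psi> y \<partial>M)) \<le> sqrt (N2 M (\<lambda>y. f k y - F y)) * sqrt (N2 M \<psi>)"
      proof
        fix k
        have "(\<integral>y. f k y * \<psi> y \<partial>M) - (\<integral>y. F y * \<psi> y \<partial>M) = (\<integral>y. (f k y - F y) * \<psi> y \<partial>M)"
          using L2_real_mult[OF f(1) \<psi>] L2_real_mult[OF f(2) \<psi>] by (simp add: left_diff_distrib)
        also have "norm \<dots> \<le> (\<integral>y. norm (f k y - F y) * norm (\<psi> y) \<partial>M)"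
          by (rule order_trans[OF integral_norm_bound]) (simp add: abs_mult)
        also have "\<dots> \<le> sqrt (N2 M (\<lambda>y. f k y - F y)) * sqrt (N2 M \<psi>)" by (rule L2_mult_le[OF L2_diff[OF f(1,2)] \<psi>])
        finally show "norm ((\<integral>y. f k y * \<psi> y \<partial>M) - (\<integral>y. F y * \<psi> y \<partial>M)) \<le> sqrt (N2 M (\<lambda>y. f k y - F y)) * sqrt (N2 M \<psi>)" .
      qed
      have "(\<lambda>k. sqrt (N2 M (\<lambda>y. f k y - F y)) * sqrt (N2 M \<psi>)) \<longlonglongrightarrow> sqrt 0 * sqrt (N2 M \<psi>)" by (intro tendsto_intros f)
      then show "(\<lambda>k. sqrt (N2 M (\<lambda>y. f k y - F y)) * sqrt (N2 M \<psi>)) \<longlonglongrightarrow> 0" by simp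
    qed
    then show ?thesis by (rule LIM_zero_cancel)
  qed
  have wg: "WG u G"
    unfolding WG_def has_weak_gradient_def
  proof (intro conjI ballI allI)
    fix \<psi> i assume \<psi>: "\<psi> \<in> test_functions \<Omega>"
    have comp: "(\<lambda>k. N2 M (\<lambda>y. g k y $ i - G y $ i)) \<longlonglongrightarrow> 0"
    proof (rule LIMSEQ_squeeze_0[OF N2_nonneg _ G(2)])
      fix k
      show "N2 M (\<lambda>y. g k y $ i - G y $ i) \<le> N2 M (\<lambda>y. g k y - G y)"
        unfolding N2_def
      proof (rule integral_mono)
        show "integrable M (\<lambda>y. (norm (g k y $ i - G y $ i))\<^sup>2)"
          by (rule L2_D(2)[OF L2_diff[OF L2_component[OF H0_D(3)[OF x]] L2_component[OF G(1)]]])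
        show "integrable M (\<lambda>y. (norm (g k y - G y))\<^sup>2)" by (rule L2_D(2)[OF L2_diff[OF H0_D(3)[OF x] G(1)]])
        show "(norm (g k y $ i - G y $ i))\<^sup>2 \<le> (norm (g k y - G y))\<^sup>2" for y
          using component_le_norm_cart[of "g k y - G y" i] by (intro power_mono) auto
      qed
    qed
    have "(\<lambda>k. \<integral>y. x k y * partial_deriv i \<psi> y \<partial>M) \<longlonglongrightarrow> (\<integral>y. u y * partial_deriv i \<psi> y \<partial>M)"
      by (rule pair[OF H0_D(1)[OF x] u test_L2[OF test_functions_partial_deriv[OF \<psi>]]])
    moreover have "(\<lambda>k. - (\<integral>y. g k y $ i * \<psi> y \<partial>M)) \<longlonglongrightarrow> - (\<integral>y. G y $ i * \<psi> y \<partial>M)"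
      by (intro tendsto_minus pair[OF L2_component[OF H0_D(3)[OF x]] L2_component[OF G(1)] comp test_L2[OF \<psi>]])
    moreover have "(\<integral>y. x k y * partial_deriv i \<psi> y \<partial>M) = - (\<integral>y. g k y $ i * \<psi> y \<partial>M)" for k
      using H0_D(2)[OF x] \<psi> by (simp add: WG_def has_weak_gradient_def)
    ultimately show "(\<integral>y. u y * partial_deriv i \<psi> y \<partial>M) = - (\<integral>y. G y $ i * \<psi> y \<partial>M)"
      by (simp add: LIMSEQ_unique)
  qed (rule G(1))
  have "H0 u G"
  proof (rule H0_I[OF u(1) wg])
    fix k :: nat
    obtain \<phi> where \<phi>: "\<phi> \<in> test_functions \<Omega>" "N2 M (\<lambda>y. \<phi> y - x k y) < 1 / real (Suc k)" "N2 M (\<lambda>y. grad \<phi> y - g k y) < 1 / real (Suc k)"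
      using H0_approx[OF x, of "1 / real (Suc k)"] by auto
    let ?c = "2 * (1 / real (Suc k)) + 2 * N2 M (\<lambda>y. x k y - u y) + 2 * N2 M (\<lambda>y. g k y - G y)"
    have "N2 M (\<lambda>y. \<phi> y - u y) \<le> ?c"
      using N2_diff_triangle[OF test_L2[OF \<phi>(1)] H0_D(1)[OF x[of k]] u(1)] \<phi>(2) N2_nonneg[of M "\<lambda>y. g k y - G y"] by linarith
    moreover have "N2 M (\<lambda>y. grad \<phi> y - G y) \<le> ?c"
      using N2_diff_triangle[OF grad_L2(1)[OF \<phi>(1)] H0_D(3)[OF x[of k]] G(1)] \<phi>(3) N2_nonneg[of M "\<lambda>y. x k y - u y"] by linarith
    ultimately show "\<exists>\<phi>\<in>test_functions \<Omega>. N2 M (\<lambda>y. \<phi> y - u y) \<le> ?c \<and> N2 M (\<lambda>y. grad \<phi> y - G y) \<le> ?c"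
      using \<phi>(1) by blast
  next
    have "(\<lambda>k. 2 * (1 / real (Suc k)) + 2 * N2 M (\<lambda>y. x k y - u y) + 2 * N2 M (\<lambda>y. g k y - G y)) \<longlonglongrightarrow> 2 * 0 + 2 * 0 + 2 * 0"
      by (intro tendsto_intros LIMSEQ_Suc[OF lim_1_over_n] u(2) G(2))
    then show "(\<lambda>k. 2 * (1 / real (Suc k)) + 2 * N2 M (\<lambda>y. x k y - u y) + 2 * N2 M (\<lambda>y. g k y - G y)) \<longlonglongrightarrow> 0" by simp
  qed
  then show ?thesis using G(2) by blast
qed

end

context dirichlet
begin

text \<open>Each \<open>x k\<close> is replaced by a test function within
  \<open>1 / real (Suc k)\<close> in the squared norms; the replacement changes neither the
  boundedness nor, for large indices, the Cauchy property.\<close>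

lemma Rellich_H0_L1:
  fixes x :: "nat \<Rightarrow> real^'n \<Rightarrow> real"
  assumes x: "\<And>k. H0 (x k) (g k)" and R: "\<And>k. N2 M (g k) \<le> R"
  shows "\<exists>\<sigma>::nat \<Rightarrow> nat. strict_mono \<sigma> \<and>
    (\<forall>\<epsilon>>0. \<exists>K. \<forall>i\<ge>K. \<forall>j\<ge>K. (\<integral>y. \<bar>x (\<sigma> i) y - x (\<sigma> j) y\<bar> \<partial>M) < \<epsilon>)"
proof -
  define c where "c k = 1 / real (Suc k)" for k
  have c: "0 < c k" "c k \<le> 1" for k by (simp_all add: c_def)
  have "\<exists>\<phi>. \<forall>k. \<phi> k \<in> test_functions \<Omega> \<and> N2 M (\<lambda>y. \<phi> k y - x k y) < c k \<and> N2 M (\<lambda>y. grad (\<phi> k) y - g k y) < c k"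
    by (rule choice) (use H0_approx[OF x c(1)] in blast)
  then obtain \<phi> where \<phi>: "\<And>k. \<phi> k \<in> test_functions \<Omega>" "\<And>k. N2 M (\<lambda>y. \<phi> k y - x k y) < c k"
    "\<And>k. N2 M (\<lambda>y. grad (\<phi> k) y - g k y) < c k" by blast
  define W where "W = sqrt (measure M (space M))"
  have W0: "0 \<le> W" by (simp add: W_def)
  \<comment> \<open>From \<open>N2_add_le\<close>: twice the approximation error, at most 1, plus
    twice the bound on the gradients.\<close>
  define Q where "Q = 2 + 2 * R"
  have Q: "N2 M (grad (\<phi> k)) \<le> Q" for k
    using N2_add_le[OF L2_diff[OF grad_L2(1)[OF \<phi>(1)[of k]] H0_D(3)[OF x[of k]]] H0_D(3)[OF x[of k]]]
      \<phi>(3)[of k] c(2)[of k] R[of k] by (simp add: Q_def)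
  have Q0: "0 \<le> Q" using Q[of 0] N2_nonneg[of M "grad (\<phi> 0)"] by linarith
  define B where "B = max (W * sqrt Q) (W * sqrt (P * Q))"
  have B1: "(\<integral>y. norm (grad (\<phi> k) y) \<partial>lborel) \<le> B" for k
  proof -
    have "(\<integral>y. norm (grad (\<phi> k) y) \<partial>M) \<le> W * sqrt (N2 M (grad (\<phi> k)))"
      unfolding W_def by (rule L2_imp_integrable(2)[OF grad_L2(1)[OF \<phi>(1)]])
    also have "\<dots> \<le> W * sqrt Q" using Q W0 by (intro mult_left_mono) auto
    finally show ?thesis by (simp add: grad_L2(3)[OF \<phi>(1)] B_def)
  qed
  have lebM: "(\<integral>y. \<bar>\<phi> i y - \<psi> y\<bar> \<partial>M) = (\<integral>y. \<bar>\<phi> i y - \<psi> y\<bar> \<partial>lborel)" if \<psi>: "\<psi> \<in> borel_measurable borel" "\<And>y. y \<notin> \<Omega> \<Longrightarrow> \<psi> y = 0" for i \<psi>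
    using test_functions_D(4,6)[OF \<phi>(1)] \<psi> sets_\<Omega> by (intro lebesgue_on_lborel(1)) auto
  have B2: "(\<integral>y. \<bar>\<phi> k y\<bar> \<partial>lborel) \<le> B" for k
  proof -
    have "(\<integral>y. norm (\<phi> k y) \<partial>M) \<le> W * sqrt (N2 M (\<phi> k))"
      unfolding W_def by (rule L2_imp_integrable(2)[OF test_L2[OF \<phi>(1)]])
    also have "N2 M (\<phi> k) \<le> P * Q"
      using order_trans[OF Poincare_H0[OF H0_test[OF \<phi>(1)]] mult_left_mono[OF Q]] P_pos by simp
    then have "W * sqrt (N2 M (\<phi> k)) \<le> W * sqrt (P * Q)" using W0 by (intro mult_left_mono) auto
    finally show ?thesis using lebM[of "\<lambda>_. 0" k] by (simp add: B_def)
  qed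
  from Rellich_L1[of \<phi> \<Omega> B, OF \<phi>(1) bounded_\<Omega> B1 B2]
  obtain \<sigma> :: "nat \<Rightarrow> nat" where \<sigma>_rel: "strict_mono \<sigma> \<and> (\<forall>\<epsilon>>0. \<exists>K. \<forall>i\<ge>K. \<forall>j\<ge>K. (\<integral>y. \<bar>\<phi> (\<sigma> i) y - \<phi> (\<sigma> j) y\<bar> \<partial>lborel) < \<epsilon>)" ..
  note \<sigma> = \<sigma>_rel[THEN conjunct1] and rel = \<sigma>_rel[THEN conjunct2]
  have "\<exists>K. \<forall>i\<ge>K. \<forall>j\<ge>K. (\<integral>y. \<bar>x (\<sigma> i) y - x (\<sigma> j) y\<bar> \<partial>M) < \<epsilon>" if \<epsilon>: "0 < \<epsilon>" for \<epsilon>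
  proof -
    have "0 < \<epsilon> / 2" using \<epsilon> by simp
    from rel[THEN spec, THEN mp, OF this]
    obtain K1 where K1: "\<And>i j. i \<ge> K1 \<Longrightarrow> j \<ge> K1 \<Longrightarrow> (\<integral>y. \<bar>\<phi> (\<sigma> i) y - \<phi> (\<sigma> j) y\<bar> \<partial>lborel) < \<epsilon> / 2" by blast
    have "(\<lambda>k. W * sqrt (c k)) \<longlonglongrightarrow> W * sqrt 0"
      unfolding c_def by (intro tendsto_intros LIMSEQ_Suc[OF lim_1_over_n])
    then have "\<forall>\<^sub>F k in sequentially. W * sqrt (c k) < \<epsilon> / 4" using \<epsilon> by (intro order_tendstoD(2)) auto
    then obtain K2 where K2: "\<And>k. k \<ge> K2 \<Longrightarrow> W * sqrt (c k) < \<epsilon> / 4" by (auto simp: eventually_sequentially)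
    have near: "integrable M (\<lambda>y. \<bar>\<phi> k y - x k y\<bar>)" "(\<integral>y. \<bar>\<phi> k y - x k y\<bar> \<partial>M) \<le> W * sqrt (c k)" for k
    proof -
      note L = L2_diff[OF test_L2[OF \<phi>(1)] H0_D(1)[OF x], of k k]
      show "integrable M (\<lambda>y. \<bar>\<phi> k y - x k y\<bar>)" using L2_imp_integrable(1)[OF L] by simp
      have "(\<integral>y. \<bar>\<phi> k y - x k y\<bar> \<partial>M) \<le> W * sqrt (N2 M (\<lambda>y. \<phi> k y - x k y))"
        using L2_imp_integrable(2)[OF L] by (simp add: W_def)
      also have "\<dots> \<le> W * sqrt (c k)" using \<phi>(2)[of k] W0 by (intro mult_left_mono) auto
      finally show "(\<integral>y. \<bar>\<phi> k y - x k y\<bar> \<partial>M) \<le> W * sqrt (c k)" .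
    qed
    have "(\<integral>y. \<bar>x (\<sigma> i) y - x (\<sigma> j) y\<bar> \<partial>M) < \<epsilon>" if ij: "max K1 K2 \<le> i" "max K1 K2 \<le> j" for i j
    proof -
      \<comment> \<open>A strictly increasing index map stays above the identity, so the
        approximation errors at \<open>\<sigma> i\<close> and \<open>\<sigma> j\<close> are already
        small.\<close>
      have \<sigma>K: "K2 \<le> \<sigma> i" "K2 \<le> \<sigma> j" using ij seq_suble[OF \<sigma>, of i] seq_suble[OF \<sigma>, of j] by auto
      have i1: "integrable M (\<lambda>y. \<bar>x (\<sigma> i) y - x (\<sigma> j) y\<bar>)"
        using L2_imp_integrable(1)[OF L2_diff[OF H0_D(1)[OF x] H0_D(1)[OF x]]] by simp
      have i2: "integrable M (\<lambda>y. \<bar>\<phi> (\<sigma> i) y - \<phi> (\<sigma> j) y\<bar>)"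
        using L2_imp_integrable(1)[OF L2_diff[OF test_L2[OF \<phi>(1)] test_L2[OF \<phi>(1)]]] by simp
      have "(\<integral>y. \<bar>x (\<sigma> i) y - x (\<sigma> j) y\<bar> \<partial>M) \<le>
          (\<integral>y. \<bar>\<phi> (\<sigma> i) y - x (\<sigma> i) y\<bar> + \<bar>\<phi> (\<sigma> i) y - \<phi> (\<sigma> j) y\<bar> + \<bar>\<phi> (\<sigma> j) y - x (\<sigma> j) y\<bar> \<partial>M)"
        by (intro integral_mono i1 Bochner_Integration.integrable_add near(1) i2) linarith
      also have "\<dots> = (\<integral>y. \<bar>\<phi> (\<sigma> i) y - x (\<sigma> i) y\<bar> \<partial>M) + (\<integral>y. \<bar>\<phi> (\<sigma> i) y - \<phi> (\<sigma> j) y\<bar> \<partial>M) + (\<integral>y. \<bar>\<phi> (\<sigma> j) y - x (\<sigma> j) y\<bar> \<partial>M)"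
        using near(1) i2 by simp
      also have "(\<integral>y. \<bar>\<phi> (\<sigma> i) y - \<phi> (\<sigma> j) y\<bar> \<partial>M) = (\<integral>y. \<bar>\<phi> (\<sigma> i) y - \<phi> (\<sigma> j) y\<bar> \<partial>lborel)"
        by (rule lebM[OF test_functions_D(4)[OF \<phi>(1)] test_functions_D(6)[OF \<phi>(1)]])
      finally show ?thesis
        using near(2)[of "\<sigma> i"] near(2)[of "\<sigma> j"] K2[OF \<sigma>K(1)] K2[OF \<sigma>K(2)] K1[of i j] ij by simp
    qed
    then show ?thesis by blast
  qed
  then show ?thesis using \<sigma> by blast
qed

text \<open>Interpolation between L1, where the sequence is Cauchy, and the critical space, where it
  is bounded by Sobolev's inequality.\<close>

theorem Rellich_H0:
  fixes x :: "nat \<Rightarrow> real^'n \<Rightarrow> real"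
  assumes p: "1 \<le> p" "p < s" and x: "\<And>k. H0 (x k) (g k)" and R: "\<And>k. N2 M (g k) \<le> R"
  shows "\<exists>\<sigma>::nat \<Rightarrow> nat. strict_mono \<sigma> \<and>
    (\<forall>\<epsilon>>0. \<exists>K. \<forall>i\<ge>K. \<forall>j\<ge>K. Lqn M p (\<lambda>y. x (\<sigma> i) y - x (\<sigma> j) y) < \<epsilon>)"
proof -
  from Rellich_H0_L1[of x g R, OF x R]
  obtain \<sigma> :: "nat \<Rightarrow> nat" where \<sigma>_rel: "strict_mono \<sigma> \<and> (\<forall>\<epsilon>>0. \<exists>K. \<forall>i\<ge>K. \<forall>j\<ge>K. (\<integral>y. \<bar>x (\<sigma> i) y - x (\<sigma> j) y\<bar> \<partial>M) < \<epsilon>)" ..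
  note \<sigma> = \<sigma>_rel[THEN conjunct1] and rel = \<sigma>_rel[THEN conjunct2]
  have s0: "0 < s" "0 < p" using p by auto
  define Q where "Q = (S * sqrt (4 * R)) powr s"
  have R0: "0 \<le> R" using R[of 0] N2_nonneg[of M "g 0"] by linarith
  have Q0: "0 \<le> Q" by (simp add: Q_def)
  have "\<exists>K. \<forall>i\<ge>K. \<forall>j\<ge>K. Lqn M p (\<lambda>y. x (\<sigma> i) y - x (\<sigma> j) y) < \<epsilon>" if \<epsilon>: "0 < \<epsilon>" for \<epsilon>
  proof -
    \<comment> \<open>\<open>Q\<close> bounds the \<open>s\<close>-th powers of all differences, so
      the critical part of the interpolation contributes at most half of
      \<open>\<epsilon> powr p\<close>.\<close>
    define \<eta> where "\<eta> = \<epsilon> powr p / (2 * (Q + 1))"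
    have \<eta>: "0 < \<eta>" using \<epsilon> Q0 by (simp add: \<eta>_def)
    obtain C where C: "0 < C" "\<And>t. 0 \<le> t \<Longrightarrow> t powr p \<le> \<eta> * t powr s + C * t" using powr_interpolate[OF p \<eta>] by blast
    have "0 < \<epsilon> powr p / 2 / C" using \<epsilon> C by simp
    from rel[THEN spec, THEN mp, OF this]
    obtain K where K: "\<And>i j. i \<ge> K \<Longrightarrow> j \<ge> K \<Longrightarrow> (\<integral>y. \<bar>x (\<sigma> i) y - x (\<sigma> j) y\<bar> \<partial>M) < \<epsilon> powr p / 2 / C" by blast
    have "Lqn M p (\<lambda>y. x (\<sigma> i) y - x (\<sigma> j) y) < \<epsilon>" if ij: "K \<le> i" "K \<le> j" for i j
    proof -
      define w where "w y = x (\<sigma> i) y - x (\<sigma> j) y" for y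
      have w: "H0 w (\<lambda>y. g (\<sigma> i) y - g (\<sigma> j) y)" unfolding w_def by (rule H0_diff[OF x x])
      have "N2 M (\<lambda>y. g (\<sigma> i) y - g (\<sigma> j) y) \<le> 4 * R"
        using N2_add_le[OF H0_D(3)[OF x] L2_scale[OF H0_D(3)[OF x], of "-1"], of "\<sigma> i" "\<sigma> j"] N2_scale[of M "-1" "g (\<sigma> j)"] R[of "\<sigma> i"] R[of "\<sigma> j"] by simp
      then have "Lqn M s w \<le> S * sqrt (4 * R)"
        using order_trans[OF Sobolev_H0(2)[OF w] mult_left_mono[OF real_sqrt_le_mono]] S_pos by simp
      then have "Lqn M s w powr s \<le> Q" unfolding Q_def using s0 by (intro powr_mono2) auto
      then have ws: "(\<integral>y. \<bar>w y\<bar> powr s \<partial>M) \<le> Q" unfolding Lqn_powr[OF s0(1)] .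
      have ints: "integrable M (\<lambda>y. \<bar>w y\<bar> powr s)" by (rule Lq_D(2)[OF Sobolev_H0(1)[OF w]])
      have intp: "integrable M (\<lambda>y. \<bar>w y\<bar> powr p)" using Lqn_H0_le(1)[OF w, of p] p by (simp add: Lq_D)
      have i1: "integrable M (\<lambda>y. \<bar>w y\<bar>)" using L2_imp_integrable(1)[OF H0_D(1)[OF w]] by simp
      have "(\<integral>y. \<bar>w y\<bar> powr p \<partial>M) \<le> (\<integral>y. \<eta> * \<bar>w y\<bar> powr s + C * \<bar>w y\<bar> \<partial>M)"
        using intp ints i1 C(2) by (intro integral_mono) auto
      also have "\<dots> = \<eta> * (\<integral>y. \<bar>w y\<bar> powr s \<partial>M) + C * (\<integral>y. \<bar>w y\<bar> \<partial>M)" using ints i1 by simp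
      also have "\<eta> * (\<integral>y. \<bar>w y\<bar> powr s \<partial>M) \<le> \<eta> * (Q + 1)" using ws \<eta> by (intro mult_left_mono) auto
      also have "\<eta> * (Q + 1) = \<epsilon> powr p / 2"
      proof -
        have "y / (2 * z) * z = y / 2" if "0 < z" for y z :: real using that by simp
        then show ?thesis using Q0 by (simp only: \<eta>_def)
      qed
      also have "C * (\<integral>y. \<bar>w y\<bar> \<partial>M) < C * (\<epsilon> powr p / 2 / C)" using K[OF ij] C by (intro mult_strict_left_mono) (auto simp: w_def)
      finally have "(\<integral>y. \<bar>w y\<bar> powr p \<partial>M) < \<epsilon> powr p" using C by simp
      then have "(\<integral>y. \<bar>w y\<bar> powr p \<partial>M) powr (1 / p) < (\<epsilon> powr p) powr (1 / p)" using s0 by (intro powr_less_mono2) auto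
      then show ?thesis using \<epsilon> s0 by (simp add: Lqn_def powr_powr w_def)
    qed
    then show ?thesis by blast
  qed
  then show ?thesis using \<sigma> by blast
qed

section \<open>The Dirichlet space as an instance of the abstract setting\<close>

definition ip :: "(real^'n \<Rightarrow> real) \<Rightarrow> (real^'n \<Rightarrow> real) \<Rightarrow> real" where
  "ip u v = (\<integral>x. weak_gradient \<Omega> u x \<bullet> weak_gradient \<Omega> v x \<partial>M)"

lemma ip_self: "ip u u = N2 M (weak_gradient \<Omega> u)"
  by (simp add: ip_def N2_def power2_norm_eq_inner)

lemma ip_cong:
  assumes "WG u g" "WG v h"
  shows "ip u v = (\<integral>x. g x \<bullet> h x \<partial>M)"
  unfolding ip_def
proof (rule integral_cong_AE)
  show "AE x in M. weak_gradient \<Omega> u x \<bullet> weak_gradient \<Omega> v x = g x \<bullet> h x"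
    using weak_gradient_AE[OF assms(1)] weak_gradient_AE[OF assms(2)] by eventually_elim simp
qed (use assms WG_weak_gradient WG_L2 L2_D(1) in \<open>blast intro: borel_measurable_inner\<close>)+

lemma subspace_H01: "subspace (H01 \<Omega>)"
proof (rule subspaceI)
  have "(\<lambda>_. 0) \<in> test_functions \<Omega>" by (simp add: test_functions_def)
  then show "0 \<in> H01 \<Omega>" using H01_I[OF H0_test] by (simp add: zero_fun_def)
  show "u + v \<in> H01 \<Omega>" if "u \<in> H01 \<Omega>" "v \<in> H01 \<Omega>" for u v
    using that H01_I[OF H0_add] by (simp add: H01_iff plus_fun_def)
  show "c *\<^sub>R u \<in> H01 \<Omega>" if "u \<in> H01 \<Omega>" for u c
    using that H01_I[OF H0_scale] by (simp add: H01_iff scaleR_fun_def)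
qed

text \<open>A bump function on a small box is continuous and positive at \<open>z\<close>; if it
  vanished almost everywhere in the open set, it would vanish at \<open>z\<close> too.\<close>

lemma nontrivial_H01:
  assumes \<Omega>: "\<Omega> \<noteq> {}" and q: "0 < q" "q \<le> s"
  shows "\<exists>w\<in>H01 \<Omega>. 0 < Lqn M q w"
proof -
  obtain z where z: "z \<in> \<Omega>" using \<Omega> by blast
  obtain a b where ab: "z \<in> box a b" "cbox a b \<subseteq> \<Omega>" using open_contains_cbox[of \<Omega>] open_\<Omega> z by (metis (no_types))
  define w where "w = bump 1 a b"
  have w: "w \<in> test_functions \<Omega>" unfolding w_def by (rule bump_test_function[OF ab(2)])
  note H = H0_test[OF w]
  have "Lqn M q w \<noteq> 0"
  proof
    assume "Lqn M q w = 0"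
    then have "(\<integral>x. \<bar>w x\<bar> powr q \<partial>M) = 0" by (simp add: Lqn_def)
    then have "AE x in M. \<bar>w x\<bar> powr q = 0"
      using integral_nonneg_eq_0_iff_AE[OF Lq_D(2)[OF Lqn_H0_le(1)[OF H q]]] by simp
    then have ae: "AE x in lebesgue. x \<in> \<Omega> \<longrightarrow> x \<in> {x. w x = 0}"
      using sets_\<Omega> by (simp add: AE_restrict_space_iff)
    have "closed {x. w x = 0}" using test_functions_D(3)[OF w] by (intro closed_Collect_eq) (auto intro: continuous_intros)
    then have "z \<in> {x. w x = 0}" using mem_closed_if_AE_lebesgue_open[OF open_\<Omega> _ ae z] by simp
    then show False using bump_pos[of 1 z a b] ab(1) by (simp add: w_def)
  qed
  then have "0 < Lqn M q w" using Lqn_nonneg[of M q w] by linarith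
  then show ?thesis using H01_I[OF H] by blast
qed

text \<open>The abstract setting works with a single constant for the embeddings, the derivative
  bounds and the Taylor remainders; a sum of nonnegative terms dominates each of them for both
  exponents.\<close>

definition K :: "real \<Rightarrow> real" where
  "K p = 1 + 2 * p + 2 * s + 2 * taylor_const p + 2 * taylor_const s
     + (measure M (space M) + 1) powr (1 / p) * S + (measure M (space M) + 1) powr (1 / s) * S"

lemma nehari_H01:
  assumes \<Omega>: "\<Omega> \<noteq> {}" and p: "2 < p" "p < s" and ab: "0 < a" "0 < b"
  shows "nehari (H01 \<Omega>) ip (Lqn M) (powr_derivative M) (K p) p s a b"
proof -
  have q2: "2 < q" "0 < q" "q \<le> s" if "q \<in> {p, s}" for q using that p by auto
  have H: "H0 u (weak_gradient \<Omega> u)" if "u \<in> H01 \<Omega>" for u using that by (simp add: H01_iff)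
  have W: "WG u (weak_gradient \<Omega> u)" if "u \<in> H01 \<Omega>" for u using H0_D(2)[OF H[OF that]] .
  have Q: "u \<in> Lq M q" if "q \<in> {p, s}" "u \<in> H01 \<Omega>" for q u using Lqn_H0_le(1)[OF H[OF that(2)] q2(2,3)[OF that(1)]] .
  have pos: "0 \<le> taylor_const p" "0 \<le> taylor_const s" "0 \<le> (measure M (space M) + 1) powr (1 / p) * S"
    "0 \<le> (measure M (space M) + 1) powr (1 / s) * S" "0 < p" "0 < s"
    using taylor_const_pos[of p] taylor_const_pos[of s] p S_pos by auto
  have Kge: "1 \<le> K p" "2 * q \<le> K p" "2 * taylor_const q \<le> K p" "(measure M (space M) + 1) powr (1 / q) * S \<le> K p"
    if "q \<in> {p, s}" for q using that pos unfolding K_def by auto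
  have cmpl: "sqrt (ip (u - v) (u - v)) = sqrt (N2 M (\<lambda>y. g y - h y))" if "WG u g" "WG v h" "u \<in> L2 M" "v \<in> L2 M" for u v g h
    using N2_weak_gradient[OF WG_diff[OF that(3,1,4,2)]] by (simp add: ip_self fun_diff_def)
  show ?thesis
  proof
    show "subspace (H01 \<Omega>)" by (rule subspace_H01)
    show "ip (u + v) w = ip u w + ip v w" if "u \<in> H01 \<Omega>" "v \<in> H01 \<Omega>" "w \<in> H01 \<Omega>" for u v w
    proof -
      have "ip (u + v) w = (\<integral>x. (weak_gradient \<Omega> u x + weak_gradient \<Omega> v x) \<bullet> weak_gradient \<Omega> w x \<partial>M)"
        unfolding plus_fun_def by (rule ip_cong[OF WG_add W]) (use that H H0_D(1) W in blast)+
      also have "\<dots> = ip u w + ip v w"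
        unfolding ip_def using L2_inner_integrable[OF H0_D(3)[OF H[OF that(1)]] H0_D(3)[OF H[OF that(3)]]]
          L2_inner_integrable[OF H0_D(3)[OF H[OF that(2)]] H0_D(3)[OF H[OF that(3)]]] by (simp add: inner_add_left)
      finally show ?thesis .
    qed
    show "ip (c *\<^sub>R u) v = c * ip u v" if "u \<in> H01 \<Omega>" "v \<in> H01 \<Omega>" for u v c
    proof -
      have "ip (c *\<^sub>R u) v = (\<integral>x. (c *\<^sub>R weak_gradient \<Omega> u x) \<bullet> weak_gradient \<Omega> v x \<partial>M)"
        using ip_cong[OF WG_scale[OF W[OF that(1)]] W[OF that(2)]] by (simp add: scaleR_fun_def)
      then show ?thesis by (simp add: ip_def)
    qed
    show "ip u v = ip v u" for u v by (simp add: ip_def inner_commute)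
    show "0 \<le> ip u u" for u by (simp add: ip_self)
    show "0 \<le> Lqn M q u" for q u by simp
    show "Lqn M q (c *\<^sub>R u) = \<bar>c\<bar> * Lqn M q u" if "q \<in> {p, s}" for q u c
      using Lqn_scale[OF q2(2)[OF that]] by (simp add: scaleR_fun_def)
    show "Lqn M q u \<le> K p * sqrt (ip u u)" if "q \<in> {p, s}" "u \<in> H01 \<Omega>" for q u
      using order_trans[OF Lqn_H0_le(2)[OF H[OF that(2)] q2(2,3)[OF that(1)]] mult_right_mono[OF Kge(4)[OF that(1)]]]
      by (simp add: ip_self)
    show "powr_derivative M q u (c *\<^sub>R h) = c * powr_derivative M q u h" for q u h c
      by (simp add: powr_derivative_def scaleR_fun_def mult.left_commute[of _ c] mult.assoc flip: integral_mult_right_zero)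
    show "powr_derivative M q (c *\<^sub>R u) h = c powr (q - 1) * powr_derivative M q u h" if "0 < c" for q u h c
    proof -
      have "powr_derivative M q (c *\<^sub>R u) h = (\<integral>x. c powr (q - 1) * (q * (sgn (u x) * \<bar>u x\<bar> powr (q - 1)) * h x) \<partial>M)"
        unfolding powr_derivative_def using that
        by (intro Bochner_Integration.integral_cong) (auto simp: scaleR_fun_def sgn_mult abs_mult powr_mult)
      then show ?thesis by (simp add: powr_derivative_def)
    qed
    show "\<bar>powr_derivative M q u h\<bar> \<le> K p * (Lqn M q u powr (q - 1) * Lqn M q h)"
      if "q \<in> {p, s}" "u \<in> H01 \<Omega>" "h \<in> H01 \<Omega>" for q u h
      using powr_derivative_integrable(2)[OF q2(1)[OF that(1)] Q[OF that(1,2)] Q[OF that(1,3)]]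
      by (rule order_trans) (intro mult_right_mono Kge(2)[OF that(1)], simp)
    show "\<bar>Lqn M q (u + h) powr q - Lqn M q u powr q - powr_derivative M q u h\<bar>
        \<le> K p * (Lqn M q u powr (q - 2) * (Lqn M q h)\<^sup>2 + Lqn M q h powr q)"
      if "q \<in> {p, s}" "u \<in> H01 \<Omega>" "h \<in> H01 \<Omega>" for q u h
      using Lqn_taylor[OF q2(1)[OF that(1)] Q[OF that(1,2)] Q[OF that(1,3)]] unfolding plus_fun_def
      by (rule order_trans) (intro mult_right_mono Kge(3)[OF that(1)], simp)
    show "\<exists>v\<in>H01 \<Omega>. (\<lambda>k. sqrt (ip (x k - v) (x k - v))) \<longlonglongrightarrow> 0"
      if x: "\<And>k::nat. x k \<in> H01 \<Omega>"
        and Cauchy: "\<And>\<epsilon>. 0 < \<epsilon> \<Longrightarrow> \<exists>L. \<forall>i\<ge>L. \<forall>j\<ge>L. sqrt (ip (x i - x j) (x i - x j)) < \<epsilon>" for x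
    proof -
      define g where "g k = weak_gradient \<Omega> (x k)" for k
      have Hx: "H0 (x k) (g k)" for k unfolding g_def by (rule H[OF x])
      have "\<exists>L. \<forall>i\<ge>L. \<forall>j\<ge>L. N2 M (\<lambda>y. g i y - g j y) < \<epsilon>" if \<epsilon>: "0 < \<epsilon>" for \<epsilon>
        using Cauchy[of "sqrt \<epsilon>"] \<epsilon> by (simp add: cmpl[OF H0_D(2)[OF Hx] H0_D(2)[OF Hx] H0_D(1)[OF Hx] H0_D(1)[OF Hx]])
      from H0_complete[OF Hx this] obtain u G where u: "H0 u G" "(\<lambda>k. N2 M (\<lambda>y. g k y - G y)) \<longlonglongrightarrow> 0" by blast
      have "(\<lambda>k. sqrt (N2 M (\<lambda>y. g k y - G y))) \<longlonglongrightarrow> sqrt 0" by (intro tendsto_intros u(2))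
      then have "(\<lambda>k. sqrt (ip (x k - u) (x k - u))) \<longlonglongrightarrow> 0"
        by (simp add: cmpl[OF H0_D(2)[OF Hx] H0_D(2)[OF u(1)] H0_D(1)[OF Hx] H0_D(1)[OF u(1)]])
      then show ?thesis using H01_I[OF u(1)] by blast
    qed
    show "\<exists>\<sigma>::nat \<Rightarrow> nat. strict_mono \<sigma> \<and> (\<forall>\<epsilon>>0. \<exists>L. \<forall>i\<ge>L. \<forall>j\<ge>L. Lqn M p (x (\<sigma> i) - x (\<sigma> j)) < \<epsilon>)"
      if x: "\<And>k::nat. x k \<in> H01 \<Omega>" and R: "\<And>k. sqrt (ip (x k) (x k)) \<le> R" for x R
    proof -
      have "N2 M (weak_gradient \<Omega> (x k)) \<le> R\<^sup>2" for k
        using R[of k] by (simp add: ip_self) (metis N2_nonneg real_sqrt_le_iff real_sqrt_pow2 power_mono real_sqrt_ge_zero)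
      from Rellich_H0[of p x "\<lambda>k. weak_gradient \<Omega> (x k)", OF _ _ H[OF x] this] p
      show ?thesis by (simp add: fun_diff_def)
    qed
    show "\<exists>w\<in>H01 \<Omega>. 0 < Lqn M p w" using nontrivial_H01[OF \<Omega>, of p] p by simp
    show "1 \<le> K p" using Kge(1)[of p] by simp
  qed (use p ab in auto)
qed

end

theorem theorem1p8:
  fixes \<Omega> :: "(real^'n) set" and a b p :: real
  assumes "CARD('n) > 4"
    and "open \<Omega>" and "connected \<Omega>" and "\<Omega> \<noteq> {}" and "bounded \<Omega>"
    and "2 < p" and "p < critical_exponent CARD('n)"
    and "a > 0" and "b > 0"
  shows "\<exists>lam0 > 0. \<forall>lam > lam0. \<exists>v.
           kirchhoff_solution \<Omega> a b p lam v \<and>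
           \<not> (AE x in lebesgue_on \<Omega>. v x = 0) \<and>
           energy \<Omega> a b p lam v > 0"
proof -
  define s where "s = critical_exponent CARD('n)"
  interpret dirichlet \<Omega> s using assms by unfold_locales (auto simp: s_def)
  interpret nehari "H01 \<Omega>" ip "Lqn M" "powr_derivative M" "K p" p s a b
    using assms by (intro nehari_H01) (auto simp: s_def)
  have n: "n u = H01_norm \<Omega> u" for u by (simp add: n_def ip_self H01_norm_eq)
  have E: "E lam u = energy \<Omega> a b p lam u" for lam u
    by (simp add: E_def energy_def J_def n Lnorm_eq_Lqn s_def[symmetric])
  obtain lam0 where lam0: "0 < lam0" and sol: "\<And>lam. lam0 < lam \<Longrightarrow> \<exists>v\<in>H01 \<Omega>. 0 < Lqn M p v \<and> 0 < E lam v \<and>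
     (\<exists>C. \<forall>h\<in>H01 \<Omega>. n h \<le> 1 \<longrightarrow> \<bar>E lam (v + h) - E lam v\<bar> \<le> C * n h ^ 2)"
    using critical_point_exists by blast
  have "\<exists>v. kirchhoff_solution \<Omega> a b p lam v \<and> \<not> (AE x in lebesgue_on \<Omega>. v x = 0) \<and> energy \<Omega> a b p lam v > 0"
    if lam_gt: "lam0 < lam" for lam
  proof -
    obtain v C where v: "v \<in> H01 \<Omega>" "0 < Lqn M p v" "0 < E lam v"
      and C: "\<And>h. h \<in> H01 \<Omega> \<Longrightarrow> n h \<le> 1 \<Longrightarrow> \<bar>E lam (v + h) - E lam v\<bar> \<le> C * n h ^ 2"
      using sol[OF lam_gt] by blast
    have "H01_has_derivative \<Omega> (energy \<Omega> a b p lam) (\<lambda>h. 0) v"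
      unfolding H01_has_derivative_def
    proof (intro conjI allI impI ballI)
      fix \<epsilon> :: real assume \<epsilon>: "0 < \<epsilon>"
      \<comment> \<open>Within this radius one of the two factors \<open>n h\<close> of the
        quadratic bound, multiplied by \<open>\<bar>C\<bar> + 1\<close>, is at most
        \<open>\<epsilon>\<close>; the entry 1 is the range in which that bound holds.\<close>
      define \<delta> where "\<delta> = min 1 (\<epsilon> / (\<bar>C\<bar> + 1))"
      have "\<bar>energy \<Omega> a b p lam (\<lambda>x. v x + h x) - energy \<Omega> a b p lam v - 0\<bar> \<le> \<epsilon> * H01_norm \<Omega> h"
        if h: "h \<in> H01 \<Omega>" "H01_norm \<Omega> h < \<delta>" for h
      proof -
        have nh: "n h \<le> 1" "n h < \<epsilon> / (\<bar>C\<bar> + 1)" using h by (auto simp: n \<delta>_def)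
        have n0: "0 \<le> n h" using h by simp
        have "\<bar>E lam (v + h) - E lam v\<bar> \<le> C * n h ^ 2" by (rule C[OF h(1) nh(1)])
        also have "\<dots> \<le> (\<bar>C\<bar> + 1) * n h * n h"
          unfolding power2_eq_square mult.assoc by (intro mult_right_mono) auto
        also have "\<dots> \<le> \<epsilon> * n h"
        proof (rule mult_right_mono[OF _ n0])
          show "(\<bar>C\<bar> + 1) * n h \<le> \<epsilon>" using nh(2) by (simp add: pos_less_divide_eq mult.commute)
        qed
        finally show ?thesis by (simp add: E n plus_fun_def)
      qed
      then show "\<exists>\<delta>>0. \<forall>h\<in>H01 \<Omega>. H01_norm \<Omega> h < \<delta> \<longrightarrow>
          \<bar>energy \<Omega> a b p lam (\<lambda>x. v x + h x) - energy \<Omega> a b p lam v - 0\<bar> \<le> \<epsilon> * H01_norm \<Omega> h"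
        using \<epsilon> by (intro exI[of _ \<delta>]) (auto simp: \<delta>_def)
    qed (auto intro!: exI[of _ 0])
    \<comment> \<open>A function vanishing almost everywhere would have \<open>p\<close>-norm
      zero.\<close>
    moreover have "\<not> (AE x in lebesgue_on \<Omega>. v x = 0)"
    proof
      assume "AE x in lebesgue_on \<Omega>. v x = 0"
      then have "(\<integral>x. \<bar>v x\<bar> powr p \<partial>M) = 0" by (intro integral_eq_zero_AE) (auto elim: eventually_mono)
      then show False using v(2) by (simp add: Lqn_def)
    qed
    ultimately show ?thesis using v by (auto simp: kirchhoff_solution_def critical_point_def E)
  qed
  then show ?thesis using lam0 by blast
qed

end
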